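(* Let $T:(X_0,X_1)\to(Y_0,Y_1)$ be an operator between couples of complex Banach spaces and let $I\subset(0,1)$ be an interval of invertibility of $T$ with respect to the family of complex interpolation functors $F_\theta(A_0,A_1)=[A_0,A_1]_\theta$. Then for any $\theta_0,\theta_1\in I$ the inverse operators $T_{\theta_0}^{-1}$ and $T_{\theta_1}^{-1}$ agree on $[Y_0,Y_1]_{\theta_0}\cap[Y_0,Y_1]_{\theta_1}$.
   Context: An operator $T:\vec X\to\vec Y$ is a linear map $X_0+X_1\to Y_0+Y_1$ bounded $X_j\to Y_j$. Complex method: $\mathcal F(\vec X)$ is the space of bounded continuous $f:\bar S\to X_0+X_1$ on the closed strip $\bar S=\{0\le\mathrm{Re}\,z\le1\}$, analytic in the interior, with $t\mapsto f(j+it)$ bounded continuous into $X_j$, normed by $\max_j\sup_t\|f(j+it)\|_{X_j}$; $[\vec X]_\theta=\{f(\theta):f\in\mathcal F(\vec X)\}$ with the quotient norm. $T_\theta$ is the restriction $T:[X_0,X_1]_\theta\to[Y_0,Y_1]_\theta$. The set of $\theta\in(0,1)$ for which $T_\theta$ is invertible is open; an interval of invertibility is a connected component of this set. *)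

theory Defs
  imports "HOL-Analysis.Analysis"
begin

text \<open>A Banach couple is modelled inside an ambient complex vector space ('a, smul C)
  (a module over the complex numbers):
  sp C j (j = 0,1) is the subspace X_j and nm C j its norm.\<close>

record 'a couple =
  smul :: "complex \<Rightarrow> 'a \<Rightarrow> 'a"
  sp :: "nat \<Rightarrow> 'a set"
  nm :: "nat \<Rightarrow> 'a \<Rightarrow> real"

definition banach_subspace :: "(complex \<Rightarrow> 'a::ab_group_add \<Rightarrow> 'a) \<Rightarrow> 'a set \<Rightarrow> ('a \<Rightarrow> real) \<Rightarrow> bool" where
  "banach_subspace sc X n \<longleftrightarrow>
     0 \<in> X \<and> (\<forall>x\<in>X. \<forall>y\<in>X. x + y \<in> X) \<and> (\<forall>c. \<forall>x\<in>X. sc c x \<in> X) \<and>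
     (\<forall>x\<in>X. n x \<ge> 0 \<and> (n x = 0 \<longleftrightarrow> x = 0)) \<and>
     (\<forall>c. \<forall>x\<in>X. n (sc c x) = cmod c * n x) \<and>
     (\<forall>x\<in>X. \<forall>y\<in>X. n (x + y) \<le> n x + n y) \<and>
     (\<forall>s. (\<forall>k. s k \<in> X) \<and> (\<forall>e>0. \<exists>N. \<forall>m\<ge>N. \<forall>k\<ge>N. n (s m - s k) < e)
          \<longrightarrow> (\<exists>l\<in>X. (\<lambda>k. n (s k - l)) \<longlonglongrightarrow> 0))"

definition sumspace :: "'a::ab_group_add couple \<Rightarrow> 'a set" where
  "sumspace A = {a + b | a b. a \<in> sp A 0 \<and> b \<in> sp A 1}"

definition sum_norm :: "'a::ab_group_add couple \<Rightarrow> 'a \<Rightarrow> real" where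
  "sum_norm A x = Inf {nm A 0 a + nm A 1 b | a b. a \<in> sp A 0 \<and> b \<in> sp A 1 \<and> x = a + b}"

text \<open>Compatibility (continuous embedding into a common Hausdorff TVS) is expressed
  equivalently by requiring the sum norm on X_0 + X_1 to be a norm.\<close>
definition banach_couple :: "'a::ab_group_add couple \<Rightarrow> bool" where
  "banach_couple A \<longleftrightarrow> module (smul A) \<and> banach_subspace (smul A) (sp A 0) (nm A 0) \<and> banach_subspace (smul A) (sp A 1) (nm A 1) \<and>
     (\<forall>x\<in>sumspace A. x \<noteq> 0 \<longrightarrow> sum_norm A x > 0)"

definition strip :: "complex set" where
  "strip = {z. 0 \<le> Re z \<and> Re z \<le> 1}"

definition calF :: "'a::ab_group_add couple \<Rightarrow> (complex \<Rightarrow> 'a) set" where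
  "calF A = {f.
     (\<forall>z\<in>strip. f z \<in> sumspace A) \<and>
     (\<exists>B. \<forall>z\<in>strip. sum_norm A (f z) \<le> B) \<and>
     (\<forall>z\<in>strip. \<forall>e>0. \<exists>d>0. \<forall>w\<in>strip. cmod (w - z) < d \<longrightarrow> sum_norm A (f w - f z) < e) \<and>
     (\<forall>z. 0 < Re z \<and> Re z < 1 \<longrightarrow>
        (\<exists>D\<in>sumspace A. \<forall>e>0. \<exists>d>0. \<forall>w. 0 < Re w \<and> Re w < 1 \<and> 0 < cmod (w - z) \<and> cmod (w - z) < d
             \<longrightarrow> sum_norm A (smul A (1 / (w - z)) (f w - f z) - D) < e)) \<and>
     (\<forall>j\<in>{0::nat,1}.
        (\<forall>t::real. f (of_nat j + \<i> * of_real t) \<in> sp A j) \<and>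
        (\<exists>B. \<forall>t::real. nm A j (f (of_nat j + \<i> * of_real t)) \<le> B) \<and>
        (\<forall>t::real. \<forall>e>0. \<exists>d>0. \<forall>s::real. \<bar>s - t\<bar> < d \<longrightarrow>
            nm A j (f (of_nat j + \<i> * of_real s) - f (of_nat j + \<i> * of_real t)) < e))}"

definition F_norm :: "'a::ab_group_add couple \<Rightarrow> (complex \<Rightarrow> 'a) \<Rightarrow> real" where
  "F_norm A f = max (SUP t::real. nm A 0 (f (\<i> * of_real t))) (SUP t::real. nm A 1 (f (1 + \<i> * of_real t)))"

definition interp_space :: "'a::ab_group_add couple \<Rightarrow> real \<Rightarrow> 'a set" where
  "interp_space A \<theta> = {f (complex_of_real \<theta>) | f. f \<in> calF A}"

definition interp_norm :: "'a::ab_group_add couple \<Rightarrow> real \<Rightarrow> 'a \<Rightarrow> real" where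
  "interp_norm A \<theta> x = Inf {F_norm A f | f. f \<in> calF A \<and> f (complex_of_real \<theta>) = x}"

definition couple_operator :: "'a::ab_group_add couple \<Rightarrow> 'b::ab_group_add couple \<Rightarrow> ('a \<Rightarrow> 'b) \<Rightarrow> bool" where
  "couple_operator A B T \<longleftrightarrow>
     (\<forall>x\<in>sumspace A. \<forall>y\<in>sumspace A. T (x + y) = T x + T y) \<and>
     (\<forall>c. \<forall>x\<in>sumspace A. T (smul A c x) = smul B c (T x)) \<and>
     (\<forall>j\<in>{0::nat,1}. T ` sp A j \<subseteq> sp B j \<and> (\<exists>C. \<forall>x\<in>sp A j. nm B j (T x) \<le> C * nm A j x))"

definition interp_invertible :: "'a::ab_group_add couple \<Rightarrow> 'b::ab_group_add couple \<Rightarrow> ('a \<Rightarrow> 'b) \<Rightarrow> real \<Rightarrow> bool" where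
  "interp_invertible A B T \<theta> \<longleftrightarrow>
     bij_betw T (interp_space A \<theta>) (interp_space B \<theta>) \<and>
     (\<exists>C. \<forall>y\<in>interp_space B \<theta>.
        interp_norm A \<theta> (the_inv_into (interp_space A \<theta>) T y) \<le> C * interp_norm B \<theta> y)"

definition invertibility_set :: "'a::ab_group_add couple \<Rightarrow> 'b::ab_group_add couple \<Rightarrow> ('a \<Rightarrow> 'b) \<Rightarrow> real set" where
  "invertibility_set A B T = {\<theta>. 0 < \<theta> \<and> \<theta> < 1 \<and> interp_invertible A B T \<theta>}"

end

theory Submission
  imports Defs "HOL-Complex_Analysis.Complex_Analysis"
begin

text \<open>
  Elements of the interpolation spaces are handled through their representing analytic functions.
  Scalar complex analysis is transferred to functions with values in \<open>X\<^sub>0 + X\<^sub>1\<close> by bounded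
  functionals (Hahn-Banach); in particular a representing function that vanishes at \<open>\<theta>\<close> can be divided
  by \<open>\<psi> \<theta> z = (z - \<theta>) / (z + 1)\<close>. Iterating such divisions gives, as in Sneiberg's theorem, that
  invertibility at \<open>s\<close> implies invertibility near \<open>s\<close> with a uniform bound.

  For \<open>w \<in> Y\<^sub>0 \<inter> Y\<^sub>1\<close> the function \<open>s \<mapsto> T\<^sub>s\<^sup>-\<^sup>1 w\<close> extends to a locally analytic function of \<open>z\<close> that depends
  only on \<open>Re z\<close>, so it is constant on intervals of invertibility.

  To reduce the theorem to this case, write \<open>x\<^sub>0\<close>, \<open>x\<^sub>1\<close> for the two preimages of \<open>y\<close> and choose \<open>r\<close>, \<open>s\<close> in
  the (open) interval of invertibility with \<open>r < \<theta>\<^sub>0, \<theta>\<^sub>1 < s\<close>. A Laurent splitting of a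
  \<open>2\<pi>\<i>\<close>-periodic representing function yields \<open>x\<^sub>i = p\<^sub>i - q\<^sub>i\<close> with \<open>p\<^sub>i \<in> X\<^sub>1\<close> in the space at \<open>s\<close> and
  \<open>q\<^sub>i \<in> X\<^sub>0\<close> in the space at \<open>r\<close>. Then \<open>w = T (p\<^sub>0 - p\<^sub>1) = T (q\<^sub>0 - q\<^sub>1)\<close> lies in \<open>Y\<^sub>0 \<inter> Y\<^sub>1\<close>, whence
  \<open>p\<^sub>0 - p\<^sub>1 = q\<^sub>0 - q\<^sub>1\<close>, that is, \<open>x\<^sub>0 = x\<^sub>1\<close>.
\<close>

section \<open>Complex Banach spaces on subsets and the Hahn-Banach theorem\<close>

text \<open>The obstacle is that an element \<open>y\<close> of both target spaces comes with two
  unrelated representing functions, so there is no evident family of preimages of \<open>y\<close>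
  that varies analytically between the two parameters. An element of \<open>Y_0 \<inter> Y_1\<close>
  is better behaved: one constant function represents it at every parameter, and this function is
  invariant under imaginary translations. Both facts are used, which is why the comparison is
  reduced to such an element instead of being made for \<open>y\<close> itself. The spaces are
  subsets of an ambient module without a topology. Norm limits are therefore statements about real
  sequences, integrals over vertical lines are replaced by averages over dyadic nodes, and scalar
  theorems enter through functionals, always with constants that do not depend on the functional.
  Quantitative bounds are kept on the two boundary lines only. Inside the strip a qualitative bound
  is enough, because the maximum principle sharpens it.\<close>

locale cnormed = module sc for sc :: "complex \<Rightarrow> 'a::ab_group_add \<Rightarrow> 'a" +
  fixes V :: "'a set" and n :: "'a \<Rightarrow> real"
  assumes banach: "banach_subspace sc V n"
begin

lemma zero_mem [simp, intro]: "0 \<in> V"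
  and add_mem [simp, intro]: "x \<in> V \<Longrightarrow> y \<in> V \<Longrightarrow> x + y \<in> V"
  and scale_mem [simp, intro]: "x \<in> V \<Longrightarrow> sc c x \<in> V"
  and norm_ge_zero: "x \<in> V \<Longrightarrow> 0 \<le> n x"
  and norm_eq_zero: "x \<in> V \<Longrightarrow> n x = 0 \<longleftrightarrow> x = 0"
  and norm_scale: "x \<in> V \<Longrightarrow> n (sc c x) = cmod c * n x"
  and norm_triangle: "x \<in> V \<Longrightarrow> y \<in> V \<Longrightarrow> n (x + y) \<le> n x + n y"
  and cauchy_limit: "(\<And>k. s k \<in> V) \<Longrightarrow> (\<And>e. 0 < e \<Longrightarrow> \<exists>N. \<forall>m\<ge>N. \<forall>k\<ge>N. n (s m - s k) < e)
      \<Longrightarrow> \<exists>l\<in>V. (\<lambda>k. n (s k - l)) \<longlonglongrightarrow> 0"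
  using banach unfolding banach_subspace_def by simp_all

lemma uminus_mem [simp, intro]: "x \<in> V \<Longrightarrow> - x \<in> V"
  using scale_mem[of x "-1"] by (simp add: scale_minus_left)

lemma diff_mem [simp, intro]: "x \<in> V \<Longrightarrow> y \<in> V \<Longrightarrow> x - y \<in> V"
  using add_mem[of x "-y"] by auto

lemma sum_mem [simp, intro]: "(\<And>i. i \<in> I \<Longrightarrow> f i \<in> V) \<Longrightarrow> sum f I \<in> V"
  by (induction I rule: infinite_finite_induct) auto

lemma norm_zero [simp]: "n 0 = 0"
  using norm_eq_zero[of 0] by simp

lemma norm_minus: "x \<in> V \<Longrightarrow> n (- x) = n x"
  using norm_scale[of x "-1"] by (simp add: scale_minus_left)

lemma norm_diff_commute: "x \<in> V \<Longrightarrow> y \<in> V \<Longrightarrow> n (x - y) = n (y - x)"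
  using norm_minus[of "x - y"] by auto

lemma norm_triangle_diff: "x \<in> V \<Longrightarrow> y \<in> V \<Longrightarrow> n (x - y) \<le> n x + n y"
  using norm_triangle[of x "- y"] norm_minus[of y] by auto

lemma norm_triangle_via: "x \<in> V \<Longrightarrow> y \<in> V \<Longrightarrow> z \<in> V \<Longrightarrow> n (x - z) \<le> n (x - y) + n (y - z)"
  using norm_triangle[of "x - y" "y - z"] by (auto simp: algebra_simps)

lemma norm_le_via: "x \<in> V \<Longrightarrow> y \<in> V \<Longrightarrow> n x \<le> n (x - y) + n y"
  using norm_triangle[of "x - y" y] by auto

lemma norm_sum: "(\<And>i. i \<in> I \<Longrightarrow> f i \<in> V) \<Longrightarrow> n (sum f I) \<le> (\<Sum>i\<in>I. n (f i))"
proof (induction I rule: infinite_finite_induct)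
  case (insert x F)
  then show ?case using norm_triangle[of "f x" "sum f F"] sum_mem[of F f] by fastforce
qed auto

lemma limit_unique:
  assumes "\<And>k. s k \<in> V" "l \<in> V" "l' \<in> V"
    and "(\<lambda>k. n (s k - l)) \<longlonglongrightarrow> 0" "(\<lambda>k. n (s k - l')) \<longlonglongrightarrow> 0"
  shows "l = l'"
proof -
  have "(\<lambda>k. n (s k - l) + n (s k - l')) \<longlonglongrightarrow> 0"
    using tendsto_add[OF assms(4,5)] by simp
  moreover have "n (l - l') \<le> n (s k - l) + n (s k - l')" for k
    using norm_triangle_via[of l "s k" l'] norm_diff_commute[of l "s k"] assms by auto
  ultimately have "n (l - l') \<le> 0"
    by (intro LIMSEQ_le_const) auto
  then show ?thesis using norm_ge_zero[of "l - l'"] norm_eq_zero[of "l - l'"] assms by auto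
qed

text \<open>This is the closed unit ball of the dual space: the bound has constant \<open>1\<close>,
  so estimates by functionals involve no operator norm. Values outside \<open>V\<close> are left
  arbitrary.\<close>

definition dual :: "('a \<Rightarrow> complex) set" where
  "dual = {l. (\<forall>x\<in>V. \<forall>y\<in>V. l (x + y) = l x + l y) \<and> (\<forall>c. \<forall>x\<in>V. l (sc c x) = c * l x) \<and>
     (\<forall>x\<in>V. cmod (l x) \<le> n x)}"

lemma dual_add: "l \<in> dual \<Longrightarrow> x \<in> V \<Longrightarrow> y \<in> V \<Longrightarrow> l (x + y) = l x + l y"
  and dual_scale: "l \<in> dual \<Longrightarrow> x \<in> V \<Longrightarrow> l (sc c x) = c * l x"
  and dual_bound: "l \<in> dual \<Longrightarrow> x \<in> V \<Longrightarrow> cmod (l x) \<le> n x"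
  by (auto simp: dual_def)

lemma dual_zero: "l \<in> dual \<Longrightarrow> l 0 = 0"
  using dual_add[of l 0 0] by simp

lemma dual_diff: "l \<in> dual \<Longrightarrow> x \<in> V \<Longrightarrow> y \<in> V \<Longrightarrow> l (x - y) = l x - l y"
  using dual_add[of l "x - y" y] by auto

lemma dual_sum: "l \<in> dual \<Longrightarrow> (\<And>i. i \<in> I \<Longrightarrow> f i \<in> V) \<Longrightarrow> l (sum f I) = (\<Sum>i\<in>I. l (f i))"
proof (induction I rule: infinite_finite_induct)
  case (insert x F)
  then show ?case using dual_add[of l "f x" "sum f F"] sum_mem[of F f] by fastforce
qed (auto simp: dual_zero)

definition sublinear :: "('a \<Rightarrow> real) \<Rightarrow> bool" where
  "sublinear p \<longleftrightarrow> (\<forall>x\<in>V. \<forall>y\<in>V. p (x + y) \<le> p x + p y) \<and>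
     (\<forall>c>0. \<forall>x\<in>V. p (sc (complex_of_real c) x) = c * p x)"

lemma sublinearD:
  assumes "sublinear p"
  shows "x \<in> V \<Longrightarrow> y \<in> V \<Longrightarrow> p (x + y) \<le> p x + p y"
    and "0 < c \<Longrightarrow> x \<in> V \<Longrightarrow> p (sc (complex_of_real c) x) = c * p x"
    and "p 0 = 0"
    and "x \<in> V \<Longrightarrow> - p (- x) \<le> p x"
proof -
  show *: "x \<in> V \<Longrightarrow> y \<in> V \<Longrightarrow> p (x + y) \<le> p x + p y"
    "0 < c \<Longrightarrow> x \<in> V \<Longrightarrow> p (sc (complex_of_real c) x) = c * p x" for x y c
    using assms by (auto simp: sublinear_def)
  show 0: "p 0 = 0" using *(2)[of 2 0] by simp
  show "x \<in> V \<Longrightarrow> - p (- x) \<le> p x" using *(1)[of x "-x"] 0 by auto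
qed

text \<open>The functional below is again sublinear; a sublinear functional that is minimal must
  coincide with all its modifications of this kind, hence is additive.\<close>

lemma sublinear_modify:
  assumes p: "sublinear p" and u: "u \<in> V"
  defines "q \<equiv> \<lambda>x. INF t\<in>{0..}. p (x + sc (complex_of_real t) u) - t * p u"
  shows "sublinear q" and "\<And>x. x \<in> V \<Longrightarrow> q x \<le> p x"
    and "\<And>x. x \<in> V \<Longrightarrow> q x \<le> p (x + u) - p u"
proof -
  note pD = sublinearD[OF p]
  define F where "F x t = p (x + sc (complex_of_real t) u) - t * p u" for x t
  have mem: "sc (complex_of_real t) u \<in> V" for t using u by auto
  have hom: "p (sc (complex_of_real t) u) = t * p u" if "t \<ge> 0" for t
    using that pD(2)[of t u] pD(3) u by (cases "t = 0") auto
  \<comment> \<open>Subadditivity for \<open>t u = (x + t u) + (- x)\<close> gives a bound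
    independent of \<open>t\<close>, so the infimum defining \<open>q\<close> is over a set bounded
    below.\<close>
  have lower: "- p (- x) \<le> F x t" if "x \<in> V" "t \<ge> 0" for x t
    using pD(1)[of "x + sc (complex_of_real t) u" "- x"] that mem[of t] hom[of t] add_mem
    by (auto simp: F_def)
  have bdd: "bdd_below (F x ` {0..})" if "x \<in> V" for x
    using lower[OF that] by (auto intro!: bdd_belowI)
  have qF: "q x = Inf (F x ` {0..})" for x by (simp add: q_def F_def)
  have le: "q x \<le> F x t" if "x \<in> V" "t \<ge> 0" for x t
    unfolding qF using bdd[OF that(1)] that(2) by (intro cInf_lower) auto
  have ge: "b \<le> q x" if "\<And>t. t \<ge> 0 \<Longrightarrow> b \<le> F x t" for x b
    unfolding qF using that by (intro cInf_greatest) auto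
  show "q x \<le> p x" if "x \<in> V" for x using le[OF that, of 0] by (simp add: F_def)
  show "q x \<le> p (x + u) - p u" if "x \<in> V" for x using le[OF that, of 1] by (simp add: F_def)
  have sub: "q (x + y) \<le> q x + q y" if "x \<in> V" "y \<in> V" for x y
  proof -
    have 1: "q (x + y) \<le> F x t + F y t'" if "t \<ge> 0" "t' \<ge> 0" for t t'
    proof -
      have "q (x + y) \<le> F (x + y) (t + t')"
        using le[of "x + y" "t + t'"] that \<open>x \<in> V\<close> \<open>y \<in> V\<close> by auto
      also have "\<dots> \<le> F x t + F y t'"
        using pD(1)[of "x + sc (complex_of_real t) u" "y + sc (complex_of_real t') u"] mem
          \<open>x \<in> V\<close> \<open>y \<in> V\<close> add_mem
        by (simp add: F_def algebra_simps scale_left_distrib)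
      finally show ?thesis .
    qed
    have 2: "q (x + y) - F x t \<le> q y" if "t \<ge> 0" for t
      using 1[OF that] by (intro ge) (simp add: algebra_simps)
    have "q (x + y) - q y \<le> q x"
      using 2 by (intro ge) (simp add: algebra_simps)
    then show ?thesis by simp
  qed
  have half: "q (sc (complex_of_real c) x) \<le> c * q x" if "c > 0" "x \<in> V" for c x
  proof -
    have "q (sc (complex_of_real c) x) / c \<le> F x t" if "t \<ge> 0" for t
    proof -
      have "q (sc (complex_of_real c) x) \<le> F (sc (complex_of_real c) x) (c * t)"
        using le[of "sc (complex_of_real c) x" "c * t"] \<open>c > 0\<close> \<open>x \<in> V\<close> that by auto
      also have "\<dots> = c * F x t"
        using pD(2)[of c "x + sc (complex_of_real t) u"] \<open>c > 0\<close> \<open>x \<in> V\<close> mem[of t] add_mem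
        by (simp add: F_def scale_right_distrib algebra_simps)
      finally show ?thesis using \<open>c > 0\<close> by (simp add: field_simps)
    qed
    then have "q (sc (complex_of_real c) x) / c \<le> q x" by (rule ge)
    then show ?thesis using \<open>c > 0\<close> by (simp add: field_simps)
  qed
  have "q (sc (complex_of_real c) x) = c * q x" if "c > 0" "x \<in> V" for c x
  proof (rule antisym[OF half[OF that]])
    have "q (sc (complex_of_real (1/c)) (sc (complex_of_real c) x)) \<le> (1/c) * q (sc (complex_of_real c) x)"
      using that by (intro half) auto
    then show "c * q x \<le> q (sc (complex_of_real c) x)"
      using that by (simp add: field_simps flip: of_real_mult)
  qed
  with sub show "sublinear q" by (auto simp: sublinear_def)
qed

text \<open>Zorn's lemma downwards: along a chain the pointwise infimum is again sublinear, and
  \<open>- q (- x)\<close> bounds it from below. Competitors are normalised to \<open>0\<close>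
  outside \<open>V\<close>, so that they are determined by their values on \<open>V\<close>.\<close>

lemma minimal_sublinear:
  assumes q: "sublinear q"
  obtains p where "sublinear p" "\<And>x. x \<in> V \<Longrightarrow> p x \<le> q x"
    "\<And>r. sublinear r \<Longrightarrow> (\<And>x. x \<in> V \<Longrightarrow> r x \<le> p x) \<Longrightarrow> (\<And>x. x \<in> V \<Longrightarrow> r x = p x)"
proof -
  define A where "A = {p. sublinear p \<and> (\<forall>x\<in>V. p x \<le> q x) \<and> (\<forall>x. x \<notin> V \<longrightarrow> p x = 0)}"
  define P where "P = (\<lambda>p r :: 'a \<Rightarrow> real. \<forall>x. r x \<le> p x)"
  have restrict: "sublinear (\<lambda>x. if x \<in> V then r x else 0)" if "sublinear r" for r
    using that by (auto simp: sublinear_def)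
  have po: "partial_order_on A (relation_of P A)"
    by (rule partial_order_on_relation_ofI) (auto simp: P_def intro: order_trans intro!: ext antisym)
  have "\<exists>u\<in>A. \<forall>a\<in>C. P a u" if C: "C \<in> Chains (relation_of P A)" for C
  proof (cases "C = {}")
    case True
    have "(\<lambda>x. if x \<in> V then q x else 0) \<in> A" using restrict[OF q] by (auto simp: A_def)
    with True show ?thesis by auto
  next
    case False
    have CA: "C \<subseteq> A" using C by (auto simp: Chains_def relation_of_def)
    have lin: "P a b \<or> P b a" if "a \<in> C" "b \<in> C" for a b
      using C that by (auto simp: Chains_def relation_of_def)
    define u where "u x = (INF p\<in>C. p x)" for x
    have low: "- q (- x) \<le> p x" if "x \<in> V" "p \<in> C" for x p
    proof -
      have "p \<in> A" using CA that by auto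
      then have "p (- x) \<le> q (- x)" "- p (- x) \<le> p x"
        using that sublinearD(4)[of p x] by (auto simp: A_def)
      then show ?thesis by linarith
    qed
    have out: "p x = 0" if "x \<notin> V" "p \<in> C" for x p using CA that by (auto simp: A_def)
    have bdd: "bdd_below ((\<lambda>p. p x) ` C)" for x
    proof (rule bdd_belowI2[of _ "if x \<in> V then - q (- x) else 0"])
      show "(if x \<in> V then - q (- x) else 0) \<le> p x" if "p \<in> C" for p
        using low[of x p] out[of x p] that by auto
    qed
    have le: "u x \<le> p x" if "p \<in> C" for x p
      unfolding u_def using bdd that by (intro cINF_lower)
    have ge: "b \<le> u x" if "\<And>p. p \<in> C \<Longrightarrow> b \<le> p x" for b x
      unfolding u_def using that False by (intro cINF_greatest)
    have sub: "u (x + y) \<le> u x + u y" if "x \<in> V" "y \<in> V" for x y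
    proof -
      have 1: "u (x + y) \<le> p x + p' y" if "p \<in> C" "p' \<in> C" for p p'
      proof -
        \<comment> \<open>The smaller of two chain members bounds both terms at once, so its own
          subadditivity suffices.\<close>
        obtain r where r: "r \<in> C" "r x \<le> p x" "r y \<le> p' y"
          using lin[OF \<open>p \<in> C\<close> \<open>p' \<in> C\<close>] \<open>p \<in> C\<close> \<open>p' \<in> C\<close> unfolding P_def by blast
        have "u (x + y) \<le> r (x + y)" using le r by auto
        also have "\<dots> \<le> r x + r y"
          using r CA \<open>x \<in> V\<close> \<open>y \<in> V\<close> sublinearD(1)[of r] by (auto simp: A_def)
        finally show ?thesis using r by linarith
      qed
      have 2: "u (x + y) - p x \<le> u y" if "p \<in> C" for p
        using 1[OF that] by (intro ge) (simp add: algebra_simps)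
      have "u (x + y) - u y \<le> u x" using 2 by (intro ge) (simp add: algebra_simps)
      then show ?thesis by simp
    qed
    have half: "u (sc (complex_of_real c) x) \<le> c * u x" if "c > 0" "x \<in> V" for c x
    proof -
      have "u (sc (complex_of_real c) x) / c \<le> p x" if "p \<in> C" for p
      proof -
        have "u (sc (complex_of_real c) x) \<le> p (sc (complex_of_real c) x)" using le that by auto
        also have "\<dots> = c * p x"
          using sublinearD(2)[of p c x] that CA \<open>c > 0\<close> \<open>x \<in> V\<close> by (auto simp: A_def)
        finally show ?thesis using \<open>c > 0\<close> by (simp add: field_simps)
      qed
      then have "u (sc (complex_of_real c) x) / c \<le> u x" by (rule ge)
      then show ?thesis using \<open>c > 0\<close> by (simp add: field_simps)
    qed
    have "u (sc (complex_of_real c) x) = c * u x" if "c > 0" "x \<in> V" for c x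
    proof (rule antisym[OF half[OF that]])
      have "u (sc (complex_of_real (1/c)) (sc (complex_of_real c) x)) \<le> (1/c) * u (sc (complex_of_real c) x)"
        using that by (intro half) auto
      then show "c * u x \<le> u (sc (complex_of_real c) x)"
        using that by (simp add: field_simps flip: of_real_mult)
    qed
    with sub have "sublinear u" by (auto simp: sublinear_def)
    moreover have "u x \<le> q x" if "x \<in> V" for x
    proof -
      obtain p where "p \<in> C" using False by auto
      then have "p x \<le> q x" using CA that by (auto simp: A_def)
      then show ?thesis using le[OF \<open>p \<in> C\<close>, of x] by linarith
    qed
    moreover have "u x = 0" if "x \<notin> V" for x
    proof -
      obtain p where "p \<in> C" using False by auto
      then show ?thesis using ge[of 0 x] le[of p x] out[OF that] by (metis order.antisym order.refl)
    qed
    ultimately have "u \<in> A" by (auto simp: A_def)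
    then show ?thesis using le by (auto simp: P_def)
  qed
  from predicate_Zorn[OF po this] obtain m where m: "m \<in> A" "\<And>a. a \<in> A \<Longrightarrow> P m a \<Longrightarrow> a = m"
    by blast
  show thesis
  proof
    show "sublinear m" "\<And>x. x \<in> V \<Longrightarrow> m x \<le> q x" using m by (auto simp: A_def)
    fix r x assume r: "sublinear r" "\<And>x. x \<in> V \<Longrightarrow> r x \<le> m x" and x: "x \<in> V"
    have "(\<lambda>x. if x \<in> V then r x else 0) = m"
      using restrict[OF r(1)] r(2) m(1) by (intro m(2)) (force simp: A_def P_def)+
    then show "r x = m x" using x by (metis (mono_tags, lifting))
  qed
qed

text \<open>A minimal functional below \<open>n\<close> alone need not see \<open>u\<close>.
  Starting from \<open>n\<close> modified in the direction \<open>u\<close> forces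
  \<open>p (- u) \<le> - n u\<close>, so the minimal functional attains the norm at
  \<open>u\<close>. Complex linearity is restored by the combination
  \<open>p x - i p (i x)\<close>.\<close>

theorem hahn_banach:
  assumes u: "u \<in> V"
  obtains l where "l \<in> dual" "cmod (l u) = n u"
proof -
  have n: "sublinear n" by (auto simp: sublinear_def norm_triangle norm_scale)
  obtain q where q: "sublinear q" "\<And>x. x \<in> V \<Longrightarrow> q x \<le> n x" "q (- u) \<le> - n u"
  proof
    show "sublinear (\<lambda>x. INF t\<in>{0..}. n (x + sc (complex_of_real t) u) - t * n u)"
      by (rule sublinear_modify(1)[OF n u])
    show "(INF t\<in>{0..}. n (x + sc (complex_of_real t) u) - t * n u) \<le> n x" if "x \<in> V" for x
      by (rule sublinear_modify(2)[OF n u that])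
    show "(INF t\<in>{0..}. n (- u + sc (complex_of_real t) u) - t * n u) \<le> - n u"
      using sublinear_modify(3)[OF n u, of "-u"] u by auto
  qed
  obtain p where p: "sublinear p" "\<And>x. x \<in> V \<Longrightarrow> p x \<le> q x"
    and min: "\<And>r x. sublinear r \<Longrightarrow> (\<And>x. x \<in> V \<Longrightarrow> r x \<le> p x) \<Longrightarrow> x \<in> V \<Longrightarrow> r x = p x"
    using minimal_sublinear[OF q(1)] by metis
  note pD = sublinearD[OF p(1)]
  have add: "p (x + y) = p x + p y" if "x \<in> V" "y \<in> V" for x y
  proof (rule antisym[OF pD(1)[OF that]])
    note mod = sublinear_modify[OF p(1) that(2)]
    have "p x \<le> p (x + y) - p y"
      using mod(3)[OF that(1)] min[OF mod(1) mod(2) that(1)] by simp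
    then show "p x + p y \<le> p (x + y)" by simp
  qed
  have neg: "p (- x) = - p x" if "x \<in> V" for x
    using add[of x "-x"] that pD(3) by auto
  have hom: "p (sc (complex_of_real c) x) = c * p x" if "x \<in> V" for c x
  proof -
    consider "c > 0" | "c = 0" | "c < 0" by linarith
    then show ?thesis
    proof cases
      case 3
      have "p (sc (complex_of_real (- c)) x) = - c * p x" using 3 that by (intro pD(2)) auto
      then show ?thesis using neg[of "sc (complex_of_real c) x"] that by (auto simp: scale_minus_left)
    qed (use that pD in auto)
  qed
  define l where "l x = Complex (p x) (- p (sc \<i> x))" for x
  have l_add: "l (x + y) = l x + l y" if "x \<in> V" "y \<in> V" for x y
    using that by (auto simp: l_def scale_right_distrib add complex_eq_iff)
  have l_scale: "l (sc c x) = c * l x" if "x \<in> V" for c x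
  proof -
    have 1: "p (sc c x) = Re c * p x + Im c * p (sc \<i> x)" if "x \<in> V" for c x
    proof -
      have "sc c x = sc (complex_of_real (Re c)) x + sc (complex_of_real (Im c)) (sc \<i> x)"
        by (subst complex_eq[of c]) (simp add: scale_left_distrib mult.commute)
      then show ?thesis using that add hom[of x] hom[of "sc \<i> x" "Im c"] by auto
    qed
    have 2: "p (sc \<i> (sc c x)) = Re c * p (sc \<i> x) - Im c * p x"
      using 1[OF that, of "\<i> * c"] by simp
    show ?thesis using 1[OF that, of c] 2 by (simp add: l_def complex_eq_iff algebra_simps)
  qed
  have l_bound: "cmod (l x) \<le> n x" if "x \<in> V" for x
  proof -
    \<comment> \<open>\<open>w\<close> is the unit scalar that rotates \<open>l x\<close> onto the
      nonnegative reals, so that \<open>cmod (l x)\<close> becomes a value of the real functional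
      \<open>p\<close>; the default \<open>1\<close> covers \<open>l x = 0\<close>.\<close>
    define w where "w = (if l x = 0 then 1 else cnj (l x) / cmod (l x))"
    have w: "cmod w = 1" "w * l x = complex_of_real (cmod (l x))"
      by (auto simp: w_def norm_divide mult.commute[of "cnj _"] complex_norm_square[symmetric]
          power2_eq_square simp flip: of_real_mult of_real_divide of_real_power)
    have "cmod (l x) = Re (l (sc w x))" using l_scale[OF that, of w] w by simp
    also have "\<dots> = p (sc w x)" by (simp add: l_def)
    also have "\<dots> \<le> n (sc w x)" using p(2) q(2) that by (meson scale_mem order_trans)
    finally show ?thesis using that w by (simp add: norm_scale)
  qed
  have "p (- u) \<le> - n u" using p(2)[of "-u"] q(3) u by fastforce
  then have "n u \<le> p u" using neg[OF u] by simp
  also have "\<dots> = Re (l u)" by (simp add: l_def)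
  also have "\<dots> \<le> cmod (l u)" by (rule complex_Re_le_cmod)
  finally have "cmod (l u) = n u" using l_bound[OF u] by simp
  moreover have "l \<in> dual" using l_add l_scale l_bound by (auto simp: dual_def)
  ultimately show thesis using that by blast
qed

lemma norm_le_dual:
  assumes "x \<in> V" "\<And>l. l \<in> dual \<Longrightarrow> cmod (l x) \<le> B"
  shows "n x \<le> B"
  using hahn_banach[OF assms(1)] assms(2) by metis

lemma eq_dual:
  assumes "x \<in> V" "y \<in> V" "\<And>l. l \<in> dual \<Longrightarrow> l x = l y"
  shows "x = y"
proof -
  have "n (x - y) \<le> 0"
    using assms by (intro norm_le_dual) (auto simp: dual_diff)
  then show ?thesis using norm_ge_zero[of "x - y"] norm_eq_zero[of "x - y"] assms by auto
qed

end

section \<open>Weak and strong holomorphy\<close>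

context cnormed
begin

lemma summable_limit:
  assumes s: "\<And>k. s k \<in> V" and sm: "summable (\<lambda>k. n (s k))"
  shows "\<exists>l\<in>V. (\<lambda>k. n (sum s {..<k} - l)) \<longlonglongrightarrow> 0"
proof (rule cauchy_limit)
  show "sum s {..<k} \<in> V" for k using s by auto
  define P where "P k = (\<Sum>i<k. n (s i))" for k
  have "Cauchy P"
    using sm unfolding P_def by (simp add: summable_iff_convergent Cauchy_convergent_iff)
  have le: "n (sum s {..<m} - sum s {..<k}) \<le> dist (P m) (P k)" if "k \<le> m" for m k
  proof -
    have "sum s {..<m} - sum s {..<k} = sum s {k..<m}" "P m - P k = (\<Sum>i=k..<m. n (s i))"
      using that by (simp_all add: P_def lessThan_atLeast0 sum_diff_nat_ivl)
    then show ?thesis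
      using norm_sum[of "{k..<m}" s] s by (simp add: dist_real_def)
  qed
  fix e :: real assume "0 < e"
  then obtain M where M: "\<And>m k. m \<ge> M \<Longrightarrow> k \<ge> M \<Longrightarrow> dist (P m) (P k) < e"
    using \<open>Cauchy P\<close> unfolding Cauchy_def by metis
  have "n (sum s {..<m} - sum s {..<k}) < e" if "m \<ge> M" "k \<ge> M" for m k
  proof (cases "k \<le> m")
    case True then show ?thesis using le[of k m] M[OF that] by linarith
  next
    case False
    then show ?thesis using le[of m k] M[of k m] that s
        norm_diff_commute[of "sum s {..<m}" "sum s {..<k}"] by fastforce
  qed
  then show "\<exists>N. \<forall>m\<ge>N. \<forall>k\<ge>N. n (sum s {..<m} - sum s {..<k}) < e" by blast
qed

text \<open>The domain is an arbitrary metric space because the notion serves both on the complex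
  strip and on the real parameter of a boundary line. The topology of the target is that of
  \<open>n\<close>, which differs between the edge spaces and their sum.\<close>

definition cont_into :: "'b::metric_space set \<Rightarrow> ('b \<Rightarrow> 'a) \<Rightarrow> bool" where
  "cont_into U f \<longleftrightarrow> (\<forall>z\<in>U. \<forall>e>0. \<exists>d>0. \<forall>w\<in>U. dist w z < d \<longrightarrow> n (f w - f z) < e)"

definition weak_hol :: "complex set \<Rightarrow> (complex \<Rightarrow> 'a) \<Rightarrow> bool" where
  "weak_hol U f \<longleftrightarrow> (\<forall>l\<in>dual. (\<lambda>z. l (f z)) holomorphic_on U)"

definition strong_diff :: "complex set \<Rightarrow> (complex \<Rightarrow> 'a) \<Rightarrow> complex \<Rightarrow> bool" where
  "strong_diff U f z \<longleftrightarrow> (\<exists>D\<in>V. \<forall>e>0. \<exists>d>0. \<forall>w\<in>U. 0 < cmod (w - z) \<and> cmod (w - z) < d \<longrightarrow>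
      n (sc (1 / (w - z)) (f w - f z) - D) < e)"

lemma strong_diff_dual_derivative:
  assumes U: "open U" "z \<in> U" "\<And>w. w \<in> U \<Longrightarrow> f w \<in> V" and l: "l \<in> dual" and D: "D \<in> V"
    and lim: "\<And>e. 0 < e \<Longrightarrow> \<exists>d>0. \<forall>w\<in>U. 0 < cmod (w - z) \<and> cmod (w - z) < d \<longrightarrow>
      n (sc (1 / (w - z)) (f w - f z) - D) < e"
  shows "((\<lambda>z. l (f z)) has_field_derivative l D) (at z)"
proof -
  have "((\<lambda>w. (l (f w) - l (f z)) / (w - z)) \<longlongrightarrow> l D) (at z within U)"
  proof (rule tendstoI)
    fix e :: real assume "0 < e"
    then obtain d where d: "d > 0" "\<And>w. w \<in> U \<Longrightarrow> 0 < cmod (w - z) \<Longrightarrow> cmod (w - z) < d \<Longrightarrow>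
      n (sc (1 / (w - z)) (f w - f z) - D) < e" using lim by metis
    have "dist ((l (f w) - l (f z)) / (w - z)) (l D) < e" if "w \<in> U" "w \<noteq> z" "dist w z < d" for w
    proof -
      have "(l (f w) - l (f z)) / (w - z) - l D = l (sc (1 / (w - z)) (f w - f z) - D)"
        using U that D l by (simp add: dual_diff dual_scale)
      then show ?thesis
        using dual_bound[OF l, of "sc (1 / (w - z)) (f w - f z) - D"] d(2)[of w] U that D
        by (simp add: dist_norm)
    qed
    then show "\<forall>\<^sub>F w in at z within U. dist ((l (f w) - l (f z)) / (w - z)) (l D) < e"
      unfolding eventually_at using d(1) by blast
  qed
  then show ?thesis
    using U by (simp add: has_field_derivative_iff at_within_open[of z U])
qed

lemma strong_diff_imp_weak_hol:
  assumes "open U" "\<And>w. w \<in> U \<Longrightarrow> f w \<in> V" "\<And>z. z \<in> U \<Longrightarrow> strong_diff U f z"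
  shows "weak_hol U f"
  unfolding weak_hol_def
proof
  fix l assume l: "l \<in> dual"
  have "\<exists>f'. ((\<lambda>z. l (f z)) has_field_derivative f') (at z)" if z: "z \<in> U" for z
  proof -
    obtain D where "D \<in> V" "\<forall>e>0. \<exists>d>0. \<forall>w\<in>U. 0 < cmod (w - z) \<and> cmod (w - z) < d \<longrightarrow>
      n (sc (1 / (w - z)) (f w - f z) - D) < e"
      using assms(3)[OF z] unfolding strong_diff_def by (elim bexE)
    then show ?thesis using strong_diff_dual_derivative[of U z f l D] assms(1,2) l z by blast
  qed
  then show "(\<lambda>z. l (f z)) holomorphic_on U"
    unfolding holomorphic_on_open[OF assms(1)] by blast
qed

end

text \<open>The difference quotient extends holomorphically over \<open>z0\<close>. On the circle of
  radius \<open>\<rho>\<close> it is at most \<open>2 * B / \<rho>\<close>, hence also inside, and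
  Cauchy's inequality on discs of radius \<open>\<rho> / 2\<close> bounds its derivative by
  \<open>4 * B / \<rho>\<^sup>2\<close>. That the constant depends on \<open>g\<close> only through
  \<open>B\<close> is what allows a use for all functionals at once.\<close>

lemma difference_quotient_lipschitz:
  fixes g :: "complex \<Rightarrow> complex"
  assumes hol: "g holomorphic_on ball z0 (2 * \<rho>)" and \<rho>: "0 < \<rho>"
    and B: "\<And>z. z \<in> ball z0 (2 * \<rho>) \<Longrightarrow> cmod (g z) \<le> B"
    and w: "w \<in> ball z0 (\<rho> / 2)" "w \<noteq> z0" and w': "w' \<in> ball z0 (\<rho> / 2)" "w' \<noteq> z0"
  shows "cmod ((g w - g z0) / (w - z0) - (g w' - g z0) / (w' - z0)) \<le> 4 * B / \<rho>\<^sup>2 * cmod (w - w')"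
proof -
  define Q where "Q = (\<lambda>z. if z = z0 then deriv g z0 else (g z - g z0) / (z - z0))"
  have Q: "Q holomorphic_on ball z0 (2 * \<rho>)"
    unfolding Q_def using pole_lemma_open[OF hol open_ball, of z0] by simp
  have sph: "cmod (Q z) \<le> 2 * B / \<rho>" if "dist z0 z = \<rho>" for z
  proof -
    have "cmod (g z - g z0) \<le> 2 * B"
      using norm_triangle_ineq4[of "g z" "g z0"] B[of z] B[of z0] that \<rho> by auto
    then show ?thesis using that \<rho> by (auto simp: Q_def norm_divide dist_norm norm_minus_commute divide_right_mono)
  qed
  have disc: "cmod (Q z) \<le> 2 * B / \<rho>" if "z \<in> cball z0 \<rho>" for z
  proof (rule maximum_modulus_frontier[of Q "cball z0 \<rho>"])
    show "Q holomorphic_on interior (cball z0 \<rho>)"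
      using Q \<rho> by (auto intro: holomorphic_on_subset)
    show "continuous_on (closure (cball z0 \<rho>)) Q"
      using holomorphic_on_imp_continuous_on[OF Q] \<rho> by (auto intro: continuous_on_subset)
  qed (use that \<rho> sph in auto)
  have der: "cmod (deriv Q z) \<le> 4 * B / \<rho>\<^sup>2" if "z \<in> ball z0 (\<rho> / 2)" for z
  proof -
    have sub: "cball z (\<rho> / 2) \<subseteq> ball z0 (2 * \<rho>)" "cball z (\<rho> / 2) \<subseteq> cball z0 \<rho>"
      using that \<rho> by (auto simp: cball_subset_ball_iff cball_subset_cball_iff dist_commute)
    have "cmod ((deriv ^^ 1) Q z) \<le> fact 1 * (2 * B / \<rho>) / (\<rho> / 2) ^ 1"
    proof (rule Cauchy_inequality)
      show "Q holomorphic_on ball z (\<rho> / 2)"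
        using sub ball_subset_cball by (blast intro: holomorphic_on_subset[OF Q])
      show "continuous_on (cball z (\<rho> / 2)) Q"
        using holomorphic_on_imp_continuous_on[OF Q] sub by (auto intro: continuous_on_subset)
      show "cmod (Q x) \<le> 2 * B / \<rho>" if "cmod (z - x) = \<rho> / 2" for x
        using sub that by (intro disc) (auto simp: dist_norm)
    qed (use \<rho> in auto)
    then show ?thesis using \<rho> by (simp add: power2_eq_square field_simps)
  qed
  have "cmod (Q w - Q w') \<le> 4 * B / \<rho>\<^sup>2 * cmod (w - w')"
  proof (rule field_differentiable_bound[where f' = "deriv Q" and S = "ball z0 (\<rho> / 2)"])
    show "(Q has_field_derivative deriv Q z) (at z within ball z0 (\<rho> / 2))" if "z \<in> ball z0 (\<rho> / 2)" for z
      using holomorphic_derivI[OF Q, of z] that \<rho> by (auto intro: has_field_derivative_at_within)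
  qed (use der w w' in auto)
  then show ?thesis using w w' by (simp add: Q_def)
qed

context cnormed
begin

text \<open>The Lipschitz constant of the scalar difference quotients is common to all functionals,
  so by Hahn-Banach the vector quotients are Lipschitz in norm. They are then Cauchy at
  \<open>z\<close>, and completeness supplies the derivative. The local bound on \<open>f\<close> is
  what makes the constant common.\<close>

lemma weak_hol_imp_strong_diff:
  assumes U: "open U" "z \<in> U" "\<And>w. w \<in> U \<Longrightarrow> f w \<in> V"
    and hol: "weak_hol U f"
    and bounded: "r > 0" "\<And>w. w \<in> ball z r \<Longrightarrow> w \<in> U \<Longrightarrow> n (f w) \<le> B"
  shows "strong_diff U f z"
proof -
  obtain r' where r': "r' > 0" "ball z r' \<subseteq> U" using U openE by blast
  define \<rho> where "\<rho> = min r r' / 2"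
  have \<rho>: "\<rho> > 0" "ball z (2 * \<rho>) \<subseteq> U" "ball z (2 * \<rho>) \<subseteq> ball z r"
    using r' bounded by (auto simp: \<rho>_def)
  define C where "C = 4 * B / \<rho>\<^sup>2"
  define q where "q w = sc (1 / (w - z)) (f w - f z)" for w
  have sub: "ball z (\<rho> / 2) \<subseteq> U" using \<rho> subset_ball[of "\<rho>/2" "2*\<rho>" z] by auto
  have qV: "q w \<in> V" if "w \<in> ball z (\<rho> / 2)" for w
    using that sub U by (auto simp: q_def)
  have lip: "n (q w - q w') \<le> C * cmod (w - w')"
    if "w \<in> ball z (\<rho> / 2)" "w \<noteq> z" "w' \<in> ball z (\<rho> / 2)" "w' \<noteq> z" for w w'
  proof (rule norm_le_dual)
    show "q w - q w' \<in> V" using qV that by auto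
    fix l assume l: "l \<in> dual"
    have "w \<in> U" "w' \<in> U" using sub that by auto
    then have "l (q w - q w') = (l (f w) - l (f z)) / (w - z) - (l (f w') - l (f z)) / (w' - z)"
      using l qV that U by (simp add: dual_diff q_def dual_scale)
    also have "cmod \<dots> \<le> C * cmod (w - w')"
      unfolding C_def
    proof (rule difference_quotient_lipschitz)
      show "(\<lambda>z. l (f z)) holomorphic_on ball z (2 * \<rho>)"
        using hol l \<rho> by (auto simp: weak_hol_def intro: holomorphic_on_subset)
      show "cmod (l (f w)) \<le> B" if "w \<in> ball z (2 * \<rho>)" for w
      proof -
        have "w \<in> U" "w \<in> ball z r" using that \<rho>(2,3) by auto
        then show ?thesis using dual_bound[OF l U(3)] bounded(2) order_trans by blast
      qed
    qed (use that \<rho> in auto)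
    finally show "cmod (l (q w - q w')) \<le> C * cmod (w - w')" .
  qed
  have C0: "C \<ge> 0"
  proof -
    have "0 \<le> n (f z)" "n (f z) \<le> B" using norm_ge_zero[of "f z"] U bounded by auto
    then show ?thesis by (simp add: C_def)
  qed
  \<comment> \<open>The shift by \<open>2\<close> in the denominator keeps every point, including
    the one for \<open>k = 0\<close>, strictly inside the ball of radius
    \<open>\<rho> / 2\<close>.\<close>
  define s where "s k = z + complex_of_real (\<rho> / 2 / (real k + 2))" for k :: nat
  have s: "s k \<in> ball z (\<rho> / 2)" "s k \<noteq> z" for k
  proof -
    have c: "0 < \<rho> / 2 / (real k + 2)" "\<rho> / 2 / (real k + 2) < \<rho> / 2"
      using \<rho>(1) by (simp_all add: field_simps add_pos_nonneg)
    then show "s k \<noteq> z" "s k \<in> ball z (\<rho> / 2)"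
      unfolding s_def mem_ball dist_norm norm_minus_commute[of z] add_diff_cancel_left' norm_of_real
      by (simp_all only: abs_of_pos of_real_eq_0_iff add_cancel_left_right less_irrefl)
  qed
  have slim: "s \<longlonglongrightarrow> z"
  proof -
    have "(\<lambda>k. complex_of_real (\<rho> / 2 / (real k + 2))) \<longlonglongrightarrow> complex_of_real 0"
      by (intro tendsto_of_real) real_asymp
    then show ?thesis unfolding s_def using tendsto_add[OF tendsto_const, of _ 0 sequentially z] by simp
  qed
  have "\<exists>D\<in>V. (\<lambda>k. n (q (s k) - D)) \<longlonglongrightarrow> 0"
  proof (rule cauchy_limit)
    show "q (s k) \<in> V" for k using qV s by auto
    fix e :: real assume "e > 0"
    have "Cauchy s" using slim by (rule LIMSEQ_imp_Cauchy)
    moreover have "e / (C + 1) > 0" using \<open>e > 0\<close> C0 by simp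
    ultimately obtain M where M: "\<And>m k. m \<ge> M \<Longrightarrow> k \<ge> M \<Longrightarrow> cmod (s m - s k) < e / (C + 1)"
      unfolding Cauchy_def dist_norm by metis
    have "n (q (s m) - q (s k)) < e" if "m \<ge> M" "k \<ge> M" for m k
    proof -
      have "n (q (s m) - q (s k)) \<le> C * cmod (s m - s k)" using s by (intro lip) auto
      also have "\<dots> \<le> C * (e / (C + 1))" using M[OF that] C0 by (intro mult_left_mono) auto
      also have "\<dots> < e" using \<open>e > 0\<close> C0 by (simp add: field_simps)
      finally show ?thesis .
    qed
    then show "\<exists>N. \<forall>m\<ge>N. \<forall>k\<ge>N. n (q (s m) - q (s k)) < e" by blast
  qed
  then obtain D where D: "D \<in> V" "(\<lambda>k. n (q (s k) - D)) \<longlonglongrightarrow> 0" by blast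
  have est: "n (q w - D) \<le> C * cmod (w - z)" if w: "w \<in> ball z (\<rho> / 2)" "w \<noteq> z" for w
  proof (rule LIMSEQ_le_const)
    have "(\<lambda>k. C * cmod (w - s k) + n (q (s k) - D)) \<longlonglongrightarrow> C * cmod (w - z) + 0"
      by (intro tendsto_intros slim D)
    then show "(\<lambda>k. C * cmod (w - s k) + n (q (s k) - D)) \<longlonglongrightarrow> C * cmod (w - z)" by simp
    have "n (q w - D) \<le> C * cmod (w - s k) + n (q (s k) - D)" for k
      using norm_triangle_via[of "q w" "q (s k)" D] lip[of w "s k"] w s[of k] qV D by force
    then show "\<exists>N. \<forall>k\<ge>N. n (q w - D) \<le> C * cmod (w - s k) + n (q (s k) - D)" by blast
  qed
  show ?thesis
    unfolding strong_diff_def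
  proof (intro bexI[OF _ D(1)] allI impI)
    fix e :: real assume "e > 0"
    define d where "d = min (\<rho> / 2) (e / (C + 1))"
    have "d > 0" using \<rho> \<open>e > 0\<close> C0 by (simp add: d_def)
    moreover have "n (q w - D) < e" if "0 < cmod (w - z)" "cmod (w - z) < d" for w
    proof -
      have "n (q w - D) \<le> C * cmod (w - z)"
        using that by (intro est) (auto simp: d_def dist_norm norm_minus_commute)
      also have "\<dots> \<le> C * (e / (C + 1))" using that C0 by (intro mult_left_mono) (auto simp: d_def)
      also have "\<dots> < e" using \<open>e > 0\<close> C0 by (simp add: field_simps)
      finally show ?thesis .
    qed
    ultimately show "\<exists>d>0. \<forall>w\<in>U. 0 < cmod (w - z) \<and> cmod (w - z) < d \<longrightarrow>
        n (sc (1 / (w - z)) (f w - f z) - D) < e"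
      unfolding q_def by blast
  qed
qed

end

section \<open>Banach couples\<close>

definition ostrip :: "complex set" where
  "ostrip = {z. 0 < Re z \<and> Re z < 1}"

lemma open_ostrip: "open ostrip"
  unfolding ostrip_def by (intro open_Collect_conj open_Collect_less continuous_intros)

lemma ostrip_subset_strip: "ostrip \<subseteq> strip"
  by (auto simp: ostrip_def strip_def)

text \<open>The index \<open>1\<close> of a couple must not be rewritten to \<open>Suc 0\<close>.\<close>

declare One_nat_def [simp del]

locale couple =
  fixes A :: "'a::ab_group_add couple"
  assumes couple: "banach_couple A"
begin

abbreviation "S \<equiv> sumspace A"
abbreviation "N \<equiv> sum_norm A"

lemma module: "module (smul A)"
  using couple by (simp add: banach_couple_def)

lemma cnormed_sp: "j \<in> {0, 1} \<Longrightarrow> cnormed (smul A) (sp A j) (nm A j)"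
  using couple by (auto simp: banach_couple_def cnormed_def cnormed_axioms_def)

sublocale E0: cnormed "smul A" "sp A 0" "nm A 0" using cnormed_sp[of 0] by simp
sublocale E1: cnormed "smul A" "sp A 1" "nm A 1" using cnormed_sp[of 1] by simp

lemma sumspaceE:
  assumes "x \<in> S"
  obtains a b where "a \<in> sp A 0" "b \<in> sp A 1" "x = a + b"
  using assms by (auto simp: sumspace_def)

lemma sumspaceI: "a \<in> sp A 0 \<Longrightarrow> b \<in> sp A 1 \<Longrightarrow> a + b \<in> S"
  by (auto simp: sumspace_def)

lemma sum_norm_le: "a \<in> sp A 0 \<Longrightarrow> b \<in> sp A 1 \<Longrightarrow> N (a + b) \<le> nm A 0 a + nm A 1 b"
  unfolding sum_norm_def
  by (rule cInf_lower) (auto intro!: bdd_belowI[of _ 0] add_nonneg_nonneg E0.norm_ge_zero E1.norm_ge_zero)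

lemma sum_norm_split:
  assumes "x \<in> S" "N x < c"
  obtains a b where "a \<in> sp A 0" "b \<in> sp A 1" "x = a + b" "nm A 0 a + nm A 1 b < c"
proof -
  have "{nm A 0 a + nm A 1 b | a b. a \<in> sp A 0 \<and> b \<in> sp A 1 \<and> x = a + b} \<noteq> {}"
    using assms(1) unfolding sumspace_def by fast
  from cInf_lessD[OF this assms(2)[unfolded sum_norm_def]] obtain y
    where "y \<in> {nm A 0 a + nm A 1 b | a b. a \<in> sp A 0 \<and> b \<in> sp A 1 \<and> x = a + b}" "y < c"
    by (elim bexE)
  then obtain a b where "y = nm A 0 a + nm A 1 b" "a \<in> sp A 0" "b \<in> sp A 1" "x = a + b" by fast
  with \<open>y < c\<close> show ?thesis by (intro that[of a b]) simp_all
qed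

lemma sum_norm_nonneg: "x \<in> S \<Longrightarrow> 0 \<le> N x"
  using sum_norm_split[of x 0] E0.norm_ge_zero E1.norm_ge_zero
  by (smt (verit))

lemma sp_subset_sumspace: "j \<in> {0, 1} \<Longrightarrow> sp A j \<subseteq> S"
  using sumspaceI[of _ 0] sumspaceI[of 0] by auto

lemma sum_norm_le_nm: "j \<in> {0, 1} \<Longrightarrow> x \<in> sp A j \<Longrightarrow> N x \<le> nm A j x"
  using sum_norm_le[of x 0] sum_norm_le[of 0 x] by auto

text \<open>Completeness is the substantial part: a rapidly converging subsequence has increments
  that split into two absolutely summable series, one in each space, and their sums add up to the
  limit. Definiteness is the compatibility clause of a couple.\<close>

lemma banach_sumspace: "banach_subspace (smul A) S N"
proof -
  have zero: "0 \<in> S" using sumspaceI[of 0 0] by auto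
  have add: "x + y \<in> S" if "x \<in> S" "y \<in> S" for x y
  proof -
    obtain a b c d where "a \<in> sp A 0" "b \<in> sp A 1" "x = a + b" "c \<in> sp A 0" "d \<in> sp A 1" "y = c + d"

      using \<open>x \<in> S\<close> \<open>y \<in> S\<close> by (meson sumspaceE)
    then show ?thesis using sumspaceI[of "a + c" "b + d"] by (auto simp: algebra_simps)
  qed
  have scl: "smul A c x \<in> S" if "x \<in> S" for c x
  proof -
    obtain a b where "a \<in> sp A 0" "b \<in> sp A 1" "x = a + b" using \<open>x \<in> S\<close> by (meson sumspaceE)
    then show ?thesis
      using sumspaceI[of "smul A c a" "smul A c b"] by (auto simp: E0.scale_right_distrib)
  qed
  have diff: "x - y \<in> S" if "x \<in> S" "y \<in> S" for x y
    using add[OF that(1) scl[OF that(2), of "-1"]] by (simp add: E0.scale_minus_left)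
  have N0: "N 0 = 0"
    using sum_norm_le[of 0 0] sum_norm_nonneg[OF zero] by auto
  have eq0: "N x = 0 \<longleftrightarrow> x = 0" if "x \<in> S" for x
    using couple that N0 unfolding banach_couple_def by force
  have scale_le: "N (smul A c x) \<le> cmod c * N x" if "x \<in> S" for c x
  proof (rule field_le_epsilon)
    fix e :: real assume "e > 0"
    \<comment> \<open>The summand \<open>1\<close> keeps the denominator positive when
      \<open>c = 0\<close>.\<close>
    have pos: "e / (cmod c + 1) > 0" using \<open>e > 0\<close> by (simp add: add_nonneg_pos)
    then have "N x < N x + e / (cmod c + 1)" by simp
    from sum_norm_split[OF \<open>x \<in> S\<close> this] obtain a b where ab: "a \<in> sp A 0" "b \<in> sp A 1" "x = a + b"
      "nm A 0 a + nm A 1 b < N x + e / (cmod c + 1)" .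
    have "N (smul A c x) \<le> cmod c * (nm A 0 a + nm A 1 b)"
      using sum_norm_le[of "smul A c a" "smul A c b"] ab
      by (simp add: E0.norm_scale E1.norm_scale E0.scale_right_distrib distrib_left)
    also have "\<dots> \<le> cmod c * (N x + e / (cmod c + 1))" using ab by (intro mult_left_mono) auto
    also have "\<dots> \<le> cmod c * N x + e"
      using \<open>e > 0\<close> by (simp add: distrib_left pos_divide_le_eq add_pos_nonneg algebra_simps)
    finally show "N (smul A c x) \<le> cmod c * N x + e" .
  qed
  have scale: "N (smul A c x) = cmod c * N x" if "x \<in> S" for c x
  proof (cases "c = 0")
    case False
    have "N x \<le> cmod (1 / c) * N (smul A c x)"
      using scale_le[OF scl[OF that], of "1 / c" c] False by simp
    then have "cmod c * N x \<le> N (smul A c x)"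
      using False by (simp add: norm_divide field_simps)
    then show ?thesis using scale_le[OF that, of c] by simp
  qed (simp add: N0)
  have tri: "N (x + y) \<le> N x + N y" if "x \<in> S" "y \<in> S" for x y
  proof (rule field_le_epsilon)
    fix e :: real assume "e > 0"
    from \<open>e > 0\<close> have "N x < N x + e / 2" by simp
    from sum_norm_split[OF \<open>x \<in> S\<close> this] obtain a b where ab: "a \<in> sp A 0" "b \<in> sp A 1"
      "x = a + b" "nm A 0 a + nm A 1 b < N x + e / 2" .
    from \<open>e > 0\<close> have "N y < N y + e / 2" by simp
    from sum_norm_split[OF \<open>y \<in> S\<close> this] obtain c d where cd: "c \<in> sp A 0" "d \<in> sp A 1"
      "y = c + d" "nm A 0 c + nm A 1 d < N y + e / 2" .
    have "N ((a + c) + (b + d)) \<le> nm A 0 (a + c) + nm A 1 (b + d)"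
      using ab cd by (intro sum_norm_le) auto
    also have "\<dots> \<le> nm A 0 a + nm A 0 c + (nm A 1 b + nm A 1 d)"
      using ab cd by (intro add_mono E0.norm_triangle E1.norm_triangle)
    finally show "N (x + y) \<le> N x + N y + e" using ab cd by (simp add: algebra_simps)
  qed
  have complete: "\<exists>l\<in>S. (\<lambda>k. N (s k - l)) \<longlonglongrightarrow> 0"
    if s: "\<forall>k. s k \<in> S" and cau: "\<forall>e>0. \<exists>M. \<forall>m\<ge>M. \<forall>k\<ge>M. N (s m - s k) < e" for s
  proof -
    obtain M where M: "\<And>i m k. m \<ge> M i \<Longrightarrow> k \<ge> M i \<Longrightarrow> N (s m - s k) < (1/2) ^ i"
      using cau[rule_format, of "(1/2) ^ _"] by (metis zero_less_power half_gt_zero_iff zero_less_one)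
    \<comment> \<open>With cumulative sums both \<open>r i\<close> and \<open>r (Suc i)\<close> are
      at least \<open>M i\<close>, so consecutive terms of the subsequence differ by less than
      \<open>(1/2) ^ i\<close>.\<close>
    define r where "r i = (\<Sum>k\<le>i. M k)" for i
    have rM: "M i \<le> r i" for i unfolding r_def by (intro member_le_sum) auto
    have rS: "M i \<le> r (Suc i)" for i using rM[of i] by (simp add: r_def)
    have "\<exists>a b. a \<in> sp A 0 \<and> b \<in> sp A 1 \<and> s (r (Suc i)) - s (r i) = a + b \<and>
        nm A 0 a + nm A 1 b < (1/2) ^ i" for i
    proof -
      have "s (r (Suc i)) - s (r i) \<in> S" using diff s by simp
      from sum_norm_split[OF this M[OF rS rM]] show ?thesis by metis
    qed
    then obtain a b where ab: "\<And>i. a i \<in> sp A 0" "\<And>i. b i \<in> sp A 1"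
      "\<And>i. s (r (Suc i)) - s (r i) = a i + b i" "\<And>i. nm A 0 (a i) + nm A 1 (b i) < (1/2) ^ i"
      by metis
    have nn: "0 \<le> nm A 0 (a i)" "0 \<le> nm A 1 (b i)" for i
      using ab E0.norm_ge_zero E1.norm_ge_zero by auto
    have "summable (\<lambda>i. nm A 0 (a i))" "summable (\<lambda>i. nm A 1 (b i))"
    proof -
      show "summable (\<lambda>i. nm A 0 (a i))"
        by (rule summable_comparison_test'[OF summable_geometric[of "1/2::real"]])
          (use nn ab(4) in \<open>auto simp: less_imp_le intro: order_trans[OF _ less_imp_le[OF ab(4)]]\<close>)
      show "summable (\<lambda>i. nm A 1 (b i))"
        by (rule summable_comparison_test'[OF summable_geometric[of "1/2::real"]])
          (use nn ab(4) in \<open>auto simp: less_imp_le intro: order_trans[OF _ less_imp_le[OF ab(4)]]\<close>)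
    qed
    then obtain la lb where la: "la \<in> sp A 0" "(\<lambda>k. nm A 0 (sum a {..<k} - la)) \<longlonglongrightarrow> 0"
      and lb: "lb \<in> sp A 1" "(\<lambda>k. nm A 1 (sum b {..<k} - lb)) \<longlonglongrightarrow> 0"
      using E0.summable_limit[of a] E1.summable_limit[of b] ab by blast
    define l where "l = s (r 0) + (la + lb)"
    have lS: "l \<in> S" using add s sumspaceI la lb by (simp add: l_def)
    have tel: "s (r k) = s (r 0) + (sum a {..<k} + sum b {..<k})" for k
    proof (induction k)
      case (Suc k)
      then show ?case using ab(3)[of k] by (simp add: algebra_simps)
    qed simp
    have le: "N (s (r k) - l) \<le> nm A 0 (sum a {..<k} - la) + nm A 1 (sum b {..<k} - lb)" for k
    proof -
      have "s (r k) - l = (sum a {..<k} - la) + (sum b {..<k} - lb)"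
        unfolding tel[of k] l_def by (simp add: algebra_simps)
      then show ?thesis using ab la lb by (simp add: sum_norm_le)
    qed
    have "(\<lambda>k. N (s k - l)) \<longlonglongrightarrow> 0"
    proof (rule LIMSEQ_I)
      fix e :: real assume "e > 0"
      have "(\<lambda>k. nm A 0 (sum a {..<k} - la) + nm A 1 (sum b {..<k} - lb)) \<longlonglongrightarrow> 0"
        using tendsto_add[OF la(2) lb(2)] by simp
      then have "\<forall>\<^sub>F k in sequentially. nm A 0 (sum a {..<k} - la) + nm A 1 (sum b {..<k} - lb) < e / 2"
        using \<open>e > 0\<close> by (intro order_tendstoD) auto
      moreover have "(\<lambda>k. (1/2::real) ^ k) \<longlonglongrightarrow> 0" by (intro LIMSEQ_realpow_zero) auto
      then have "\<forall>\<^sub>F k in sequentially. (1/2::real) ^ k < e / 2"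
        using \<open>e > 0\<close> by (intro order_tendstoD) auto
      ultimately have "\<forall>\<^sub>F k in sequentially. N (s (r k) - l) < e / 2 \<and> (1/2::real) ^ k < e / 2"
        by eventually_elim (blast intro: le_less_trans[OF le])
      then obtain i where i: "N (s (r i) - l) < e / 2" "(1/2::real) ^ i < e / 2"
        by (auto dest: eventually_happens'[OF sequentially_bot])
      have "N (s k - l) < e" if "k \<ge> M i" for k
      proof -
        have "N (s k - s (r i) + (s (r i) - l)) \<le> N (s k - s (r i)) + N (s (r i) - l)"
          using s lS diff by (intro tri) auto
        then show ?thesis using M[OF that rM[of i]] i by simp
      qed
      moreover have "0 \<le> N (s k - l)" for k using sum_norm_nonneg diff s lS by auto
      ultimately show "\<exists>no. \<forall>k\<ge>no. norm (N (s k - l) - 0) < e" by auto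
    qed
    with lS show ?thesis by blast
  qed
  show ?thesis
    unfolding banach_subspace_def
    using zero add scl sum_norm_nonneg eq0 scale tri complete by auto
qed

sublocale E: cnormed "smul A" S N
  using module banach_sumspace by (simp add: cnormed_def cnormed_axioms_def)

end

section \<open>Calculus of norm continuity and weak holomorphy\<close>

context cnormed
begin

lemma cont_into_tendsto:
  assumes "cont_into U f" "z \<in> U" "\<And>w. w \<in> U \<Longrightarrow> f w \<in> V"
  shows "((\<lambda>w. n (f w - f z)) \<longlongrightarrow> 0) (at z within U)"
proof (rule tendstoI)
  fix e :: real assume "e > 0"
  then obtain d where "d > 0" "\<And>w. w \<in> U \<Longrightarrow> dist w z < d \<Longrightarrow> n (f w - f z) < e"
    using assms(1,2) unfolding cont_into_def by metis
  then show "\<forall>\<^sub>F w in at z within U. dist (n (f w - f z)) 0 < e"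
    using assms norm_ge_zero[of "f _ - f z"] by (auto simp: eventually_at)
qed

lemma cont_intoI:
  assumes "\<And>z. z \<in> U \<Longrightarrow> ((\<lambda>w. n (f w - f z)) \<longlongrightarrow> 0) (at z within U)"
  shows "cont_into U f"
  unfolding cont_into_def
proof (intro ballI allI impI)
  fix z and e :: real assume z: "z \<in> U" and "e > 0"
  then have "\<forall>\<^sub>F w in at z within U. n (f w - f z) < e"
    using order_tendstoD(2)[OF assms] by blast
  then obtain d where d: "d > 0" "\<And>w. w \<in> U \<Longrightarrow> w \<noteq> z \<Longrightarrow> dist w z < d \<Longrightarrow> n (f w - f z) < e"
    unfolding eventually_at by blast
  have "n (f w - f z) < e" if "w \<in> U" "dist w z < d" for w
    using d(2)[OF that(1) _ that(2)] \<open>e > 0\<close> by (cases "w = z") auto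
  with d(1) show "\<exists>d>0. \<forall>w\<in>U. dist w z < d \<longrightarrow> n (f w - f z) < e" by blast
qed

lemma cont_into_add:
  assumes f: "cont_into U f" "\<And>w. w \<in> U \<Longrightarrow> f w \<in> V" and g: "cont_into U g" "\<And>w. w \<in> U \<Longrightarrow> g w \<in> V"
  shows "cont_into U (\<lambda>z. f z + g z)"
proof (rule cont_intoI)
  fix z assume z: "z \<in> U"
  show "((\<lambda>w. n (f w + g w - (f z + g z))) \<longlongrightarrow> 0) (at z within U)"
  proof (rule Lim_null_comparison)
    show "((\<lambda>w. n (f w - f z) + n (g w - g z)) \<longlongrightarrow> 0) (at z within U)"
      using tendsto_add[OF cont_into_tendsto[OF f(1) z f(2)] cont_into_tendsto[OF g(1) z g(2)]] by simp
    have "norm (n (f w + g w - (f z + g z))) \<le> n (f w - f z) + n (g w - g z)" if "w \<in> U" for w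
      using norm_triangle[of "f w - f z" "g w - g z"] norm_ge_zero[of "f w + g w - (f z + g z)"]
        f g z that by (auto simp: algebra_simps)
    then show "\<forall>\<^sub>F w in at z within U. norm (n (f w + g w - (f z + g z))) \<le> n (f w - f z) + n (g w - g z)"
      by (auto simp: eventually_at_filter)
  qed
qed

lemma cont_into_scale:
  assumes f: "cont_into U f" "\<And>w. w \<in> U \<Longrightarrow> f w \<in> V" and g: "continuous_on U g"
  shows "cont_into U (\<lambda>z. sc (g z) (f z))"
proof (rule cont_intoI)
  fix z assume z: "z \<in> U"
  have gz: "(g \<longlongrightarrow> g z) (at z within U)" using g z by (auto simp: continuous_on_def)
  show "((\<lambda>w. n (sc (g w) (f w) - sc (g z) (f z))) \<longlongrightarrow> 0) (at z within U)"
  proof (rule Lim_null_comparison)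
    have "((\<lambda>w. cmod (g w) * n (f w - f z) + cmod (g w - g z) * n (f z)) \<longlongrightarrow>
        cmod (g z) * 0 + cmod (g z - g z) * n (f z)) (at z within U)"
      by (intro tendsto_intros gz cont_into_tendsto[OF f(1) z f(2)])
    then show "((\<lambda>w. cmod (g w) * n (f w - f z) + cmod (g w - g z) * n (f z)) \<longlongrightarrow> 0) (at z within U)"
      by simp
    have "norm (n (sc (g w) (f w) - sc (g z) (f z))) \<le> cmod (g w) * n (f w - f z) + cmod (g w - g z) * n (f z)"
      if "w \<in> U" for w
    proof -
      have "sc (g w) (f w) - sc (g z) (f z) = sc (g w) (f w - f z) + sc (g w - g z) (f z)"
        by (simp add: scale_right_diff_distrib scale_left_diff_distrib)
      then show ?thesis
        using norm_triangle[of "sc (g w) (f w - f z)" "sc (g w - g z) (f z)"]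
          norm_ge_zero[of "sc (g w) (f w) - sc (g z) (f z)"] f z that by (simp add: norm_scale)
    qed
    then show "\<forall>\<^sub>F w in at z within U. norm (n (sc (g w) (f w) - sc (g z) (f z)))
        \<le> cmod (g w) * n (f w - f z) + cmod (g w - g z) * n (f z)"
      by (auto simp: eventually_at_filter)
  qed
qed

lemma cont_into_compose:
  assumes f: "cont_into U f" and h: "continuous_on W h" "\<And>w. w \<in> W \<Longrightarrow> h w \<in> U"
  shows "cont_into W (\<lambda>z. f (h z))"
  unfolding cont_into_def
proof (intro ballI allI impI)
  fix z and e :: real assume z: "z \<in> W" and "e > 0"
  then obtain d where d: "d > 0" "\<And>w. w \<in> U \<Longrightarrow> dist w (h z) < d \<Longrightarrow> n (f w - f (h z)) < e"
    using f h(2)[OF z] unfolding cont_into_def by metis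
  obtain d' where d': "d' > 0" "\<And>w. w \<in> W \<Longrightarrow> dist w z < d' \<Longrightarrow> dist (h w) (h z) < d"
    using h(1) z d(1) unfolding continuous_on_iff by metis
  show "\<exists>d>0. \<forall>w\<in>W. dist w z < d \<longrightarrow> n (f (h w) - f (h z)) < e"
    using d d' h(2) by (intro exI[of _ d']) auto
qed

lemma cont_into_bounded_near:
  assumes "cont_into U f" "z \<in> U" "\<And>w. w \<in> U \<Longrightarrow> f w \<in> V"
  obtains r where "r > 0" "\<And>w. w \<in> ball z r \<Longrightarrow> w \<in> U \<Longrightarrow> n (f w) \<le> n (f z) + 1"
proof -
  obtain r where r: "r > 0" "\<And>w. w \<in> U \<Longrightarrow> dist w z < r \<Longrightarrow> n (f w - f z) < 1"
    using assms(1,2) unfolding cont_into_def by (metis zero_less_one)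
  have "n (f w) \<le> n (f z) + 1" if "w \<in> ball z r" "w \<in> U" for w
    using r(2)[of w] norm_le_via[of "f w" "f z"] that assms by (auto simp: dist_commute)
  with r(1) show thesis by (rule that)
qed

lemma cont_into_limit:
  assumes F: "\<And>k. cont_into U (F k)" "\<And>k w. w \<in> U \<Longrightarrow> F k w \<in> V" and f: "\<And>w. w \<in> U \<Longrightarrow> f w \<in> V"
    and lim: "\<And>z. z \<in> U \<Longrightarrow> \<exists>r>0. \<forall>e>0. \<exists>k. \<forall>w\<in>U. dist w z < r \<longrightarrow> n (F k w - f w) < e"
  shows "cont_into U f"
  unfolding cont_into_def
proof (intro ballI allI impI)
  fix z and e :: real assume z: "z \<in> U" and "e > 0"
  then have e3: "e / 3 > 0" by simp
  obtain r where r: "r > 0" "\<And>e. e > 0 \<Longrightarrow> \<exists>k. \<forall>w\<in>U. dist w z < r \<longrightarrow> n (F k w - f w) < e"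
    using lim[OF z] by blast
  obtain k where k: "\<And>w. w \<in> U \<Longrightarrow> dist w z < r \<Longrightarrow> n (F k w - f w) < e / 3"
    using r(2)[OF e3] by blast
  obtain d where d: "d > 0" "\<And>w. w \<in> U \<Longrightarrow> dist w z < d \<Longrightarrow> n (F k w - F k z) < e / 3"
    using F(1)[of k] z e3 unfolding cont_into_def by blast
  have "n (f w - f z) < e" if "w \<in> U" "dist w z < min r d" for w
  proof -
    have "n (f w - f z) \<le> n (f w - F k w) + (n (F k w - F k z) + n (F k z - f z))"
      using norm_triangle_via[of "f w" "F k w" "f z"] norm_triangle_via[of "F k w" "F k z" "f z"] F f that z
      by fastforce
    then show ?thesis
      using k[of w] k[of z] d(2)[of w] that z r(1) norm_diff_commute[of "f w" "F k w"] F f by auto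
  qed
  then show "\<exists>d>0. \<forall>w\<in>U. dist w z < d \<longrightarrow> n (f w - f z) < e"
    using r(1) d(1) by (intro exI[of _ "min r d"]) auto
qed

lemma weak_hol_add:
  assumes "weak_hol U f" "weak_hol U g" "\<And>w. w \<in> U \<Longrightarrow> f w \<in> V" "\<And>w. w \<in> U \<Longrightarrow> g w \<in> V"
  shows "weak_hol U (\<lambda>z. f z + g z)"
  unfolding weak_hol_def
proof
  fix l assume l: "l \<in> dual"
  have "(\<lambda>z. l (f z) + l (g z)) holomorphic_on U"
    using assms l by (auto simp: weak_hol_def intro!: holomorphic_intros)
  then show "(\<lambda>z. l (f z + g z)) holomorphic_on U"
    by (rule holomorphic_transform) (use assms l in \<open>auto simp: dual_add\<close>)
qed

lemma weak_hol_scale: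
  assumes "weak_hol U f" "g holomorphic_on U" "\<And>w. w \<in> U \<Longrightarrow> f w \<in> V"
  shows "weak_hol U (\<lambda>z. sc (g z) (f z))"
  unfolding weak_hol_def
proof
  fix l assume l: "l \<in> dual"
  have "(\<lambda>z. g z * l (f z)) holomorphic_on U"
    using assms l by (auto simp: weak_hol_def intro!: holomorphic_intros)
  then show "(\<lambda>z. l (sc (g z) (f z))) holomorphic_on U"
    by (rule holomorphic_transform) (use assms l in \<open>auto simp: dual_scale\<close>)
qed

lemma weak_hol_compose:
  assumes "weak_hol U f" "h holomorphic_on W" "\<And>w. w \<in> W \<Longrightarrow> h w \<in> U"
  shows "weak_hol W (\<lambda>z. f (h z))"
  unfolding weak_hol_def
proof
  fix l assume l: "l \<in> dual"
  then have "(\<lambda>z. l (f z)) holomorphic_on U" using assms(1) by (auto simp: weak_hol_def)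
  from holomorphic_on_compose_gen[OF assms(2) this] assms(3)
  show "(\<lambda>z. l (f (h z))) holomorphic_on W" by (auto simp: o_def)
qed

text \<open>Uniform convergence near each point passes from the norm to every functional, so
  Weierstrass' theorem applies. It needs all large indices, whereas continuity of a limit needs just
  one good approximant.\<close>

lemma weak_hol_limit:
  fixes F :: "nat \<Rightarrow> complex \<Rightarrow> 'a"
  assumes U: "open U" and F: "\<And>k. weak_hol U (F k)" "\<And>k w. w \<in> U \<Longrightarrow> F k w \<in> V"
    and f: "\<And>w. w \<in> U \<Longrightarrow> f w \<in> V"
    and lim: "\<And>z. z \<in> U \<Longrightarrow> \<exists>r>0. \<forall>e>0. \<exists>K. \<forall>k\<ge>K. \<forall>w\<in>U. dist w z < r \<longrightarrow> n (F k w - f w) < e"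
  shows "weak_hol U f"
  unfolding weak_hol_def
proof
  fix l assume l: "l \<in> dual"
  show "(\<lambda>z. l (f z)) holomorphic_on U"
  proof (rule holomorphic_uniform_sequence[OF U])
    show "(\<lambda>z. l (F k z)) holomorphic_on U" for k using F(1) l by (auto simp: weak_hol_def)
    fix z assume z: "z \<in> U"
    from lim[OF z] obtain r where r: "r > 0"
      "\<forall>e>0. \<exists>K. \<forall>k\<ge>K. \<forall>w\<in>U. dist w z < r \<longrightarrow> n (F k w - f w) < e"
      by (elim exE conjE)
    obtain d where d: "d > 0" "cball z d \<subseteq> U" using U z open_contains_cball by blast
    define \<rho> where "\<rho> = min d (r / 2)"
    have \<rho>: "\<rho> > 0" "cball z \<rho> \<subseteq> U" "\<rho> < r" using d r(1) by (auto simp: \<rho>_def)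
    have "uniform_limit (cball z \<rho>) (\<lambda>k z. l (F k z)) (\<lambda>z. l (f z)) sequentially"
    proof (rule uniform_limitI)
      fix e :: real assume "e > 0"
      from r(2)[THEN spec, THEN mp, OF this]
      obtain K where K: "\<forall>k\<ge>K. \<forall>w\<in>U. dist w z < r \<longrightarrow> n (F k w - f w) < e" by (elim exE)
      have "dist (l (F k w)) (l (f w)) < e" if "k \<ge> K" "w \<in> cball z \<rho>" for k w
      proof -
        have w: "w \<in> U" "dist w z < r" using that \<rho> by (auto simp: dist_commute)
        have "dist (l (F k w)) (l (f w)) = cmod (l (F k w - f w))"
          using l F f w by (simp add: dist_norm dual_diff)
        also have "\<dots> \<le> n (F k w - f w)" using l F f w by (intro dual_bound) auto
        also have "\<dots> < e" using K that w by auto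
        finally show ?thesis .
      qed
      then show "\<forall>\<^sub>F k in sequentially. \<forall>w\<in>cball z \<rho>. dist (l (F k w)) (l (f w)) < e"
        unfolding eventually_sequentially by blast
    qed
    with \<rho> show "\<exists>d>0. cball z d \<subseteq> U \<and>
        uniform_limit (cball z d) (\<lambda>k z. l (F k z)) (\<lambda>z. l (f z)) sequentially" by blast
  qed
qed

end

section \<open>The space of representing functions\<close>

text \<open>A common parametrisation of the two edges, so that boundary conditions can be quantified
  over \<open>j\<close>; imaginary translation becomes a shift of the real parameter.\<close>

definition bd :: "nat \<Rightarrow> real \<Rightarrow> complex" where
  "bd j t = of_nat j + \<i> * of_real t"

lemma bd_strip: "j \<in> {0, 1} \<Longrightarrow> bd j t \<in> strip"
  by (auto simp: bd_def strip_def)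

lemma bd_add: "bd j t + \<i> * of_real s = bd j (t + s)"
  by (simp add: bd_def algebra_simps)

text \<open>The ball of radius \<open>M\<close> in the space of representing functions, as a
  predicate. Bounds replace the suprema of \<open>F_norm\<close> throughout, and they are monotone
  in \<open>M\<close>, additive and stable under limits.\<close>

definition Fb :: "'a::ab_group_add couple \<Rightarrow> real \<Rightarrow> (complex \<Rightarrow> 'a) \<Rightarrow> bool" where
  "Fb A M f \<longleftrightarrow> f \<in> calF A \<and> (\<forall>j\<in>{0,1}. \<forall>t. nm A j (f (bd j t)) \<le> M)"

lemma FbD: "Fb A M f \<Longrightarrow> f \<in> calF A" "Fb A M f \<Longrightarrow> j \<in> {0,1} \<Longrightarrow> nm A j (f (bd j t)) \<le> M"
  by (auto simp: Fb_def)

context couple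
begin

text \<open>Membership in \<open>calF\<close> up to boundedness, with weak holomorphy in place of norm differentiability.\<close>

definition locF :: "(complex \<Rightarrow> 'a) \<Rightarrow> bool" where
  "locF f \<longleftrightarrow> (\<forall>z\<in>strip. f z \<in> S) \<and> E.cont_into strip f \<and> E.weak_hol ostrip f \<and>
    (\<forall>j\<in>{0,1}. (\<forall>t. f (bd j t) \<in> sp A j) \<and> cnormed.cont_into (nm A j) UNIV (\<lambda>t. f (bd j t)))"

text \<open>Weak and norm differentiability coincide here because continuity supplies the local
  bound under which weak holomorphy implies differentiability in norm. Closure properties can then
  be proved for the weak form, where scalar theorems apply.\<close>

lemma calF_iff:
  "f \<in> calF A \<longleftrightarrow> locF f \<and> (\<exists>B. \<forall>z\<in>strip. N (f z) \<le> B) \<and>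
     (\<forall>j\<in>{0,1}. \<exists>B. \<forall>t. nm A j (f (bd j t)) \<le> B)"
proof -
  have strong: "(\<forall>z. 0 < Re z \<and> Re z < 1 \<longrightarrow>
        (\<exists>D\<in>sumspace A. \<forall>e>0. \<exists>d>0. \<forall>w. 0 < Re w \<and> Re w < 1 \<and> 0 < cmod (w - z) \<and> cmod (w - z) < d
             \<longrightarrow> sum_norm A (smul A (1 / (w - z)) (f w - f z) - D) < e)) \<longleftrightarrow>
      (\<forall>z\<in>ostrip. E.strong_diff ostrip f z)"
    unfolding E.strong_diff_def ostrip_def Ball_def mem_Collect_eq by (simp only: imp_conjL)
  have weak: "(\<forall>z\<in>ostrip. E.strong_diff ostrip f z) \<longleftrightarrow> E.weak_hol ostrip f"
    if f: "\<forall>z\<in>strip. f z \<in> S" "E.cont_into strip f"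
  proof
    have mem: "f w \<in> S" if "w \<in> ostrip" for w using f ostrip_subset_strip that by auto
    show "E.weak_hol ostrip f" if "\<forall>z\<in>ostrip. E.strong_diff ostrip f z"
      using that open_ostrip mem by (intro E.strong_diff_imp_weak_hol) auto
    show "\<forall>z\<in>ostrip. E.strong_diff ostrip f z" if "E.weak_hol ostrip f"
    proof
      fix z assume z: "z \<in> ostrip"
      then have "z \<in> strip" using ostrip_subset_strip by auto
      from E.cont_into_bounded_near[OF f(2) this] f(1) obtain r where
        r: "r > 0" "\<And>w. w \<in> ball z r \<Longrightarrow> w \<in> strip \<Longrightarrow> N (f w) \<le> N (f z) + 1" by blast
      show "E.strong_diff ostrip f z"
        using z mem that r ostrip_subset_strip
        by (intro E.weak_hol_imp_strong_diff[OF open_ostrip, where r = r and B = "N (f z) + 1"]) auto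
    qed
  qed
  have cont: "(\<forall>z\<in>strip. \<forall>e>0. \<exists>d>0. \<forall>w\<in>strip. cmod (w - z) < d \<longrightarrow> sum_norm A (f w - f z) < e)
      \<longleftrightarrow> E.cont_into strip f"
    by (simp only: E.cont_into_def dist_norm)
  have bcont: "(\<forall>t::real. \<forall>e>0. \<exists>d>0. \<forall>s::real. \<bar>s - t\<bar> < d \<longrightarrow>
            nm A j (f (of_nat j + \<i> * of_real s) - f (of_nat j + \<i> * of_real t)) < e)
      \<longleftrightarrow> cnormed.cont_into (nm A j) UNIV (\<lambda>t. f (bd j t))" if "j \<in> {0,1}" for j
    by (simp add: cnormed.cont_into_def[OF cnormed_sp[OF that]] dist_norm bd_def)
  show ?thesis
    unfolding calF_def mem_Collect_eq strong cont locF_def using weak bcont by (auto simp: bd_def)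
qed

lemma locF_props:
  assumes "locF f"
  shows "z \<in> strip \<Longrightarrow> f z \<in> S" "E.cont_into strip f" "E.weak_hol ostrip f"
    "j \<in> {0,1} \<Longrightarrow> f (bd j t) \<in> sp A j" "j \<in> {0,1} \<Longrightarrow> cnormed.cont_into (nm A j) UNIV (\<lambda>t. f (bd j t))"
  using assms by (auto simp: locF_def)

lemma calF_locF: "f \<in> calF A \<Longrightarrow> locF f"
  by (simp add: calF_iff)

lemma calF_bounded:
  assumes "f \<in> calF A"
  obtains B where "\<And>z. z \<in> strip \<Longrightarrow> N (f z) \<le> B"
  using assms by (auto simp: calF_iff)

lemma calF_Fb:
  assumes "f \<in> calF A"
  obtains M where "M > 0" "Fb A M f"
proof -
  obtain B0 B1 where "\<forall>t. nm A 0 (f (bd 0 t)) \<le> B0" "\<forall>t. nm A 1 (f (bd 1 t)) \<le> B1"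
    using assms by (auto simp: calF_iff)
  then have "Fb A (max 1 (max B0 B1)) f"
    using assms by (auto simp: Fb_def le_max_iff_disj)
  then show thesis by (intro that[of "max 1 (max B0 B1)"]) auto
qed

text \<open>\<open>B\<close> certifies membership in \<open>calF\<close>; the radius
  \<open>M\<close> is decided on the two edges alone. Rough interior estimates therefore cost
  nothing in the constants.\<close>

lemma FbI:
  assumes "locF f" "\<And>z. z \<in> strip \<Longrightarrow> N (f z) \<le> B" "\<And>j t. j \<in> {0,1} \<Longrightarrow> nm A j (f (bd j t)) \<le> M"
  shows "Fb A M f"
  using assms unfolding Fb_def calF_iff by blast

lemma Fb_mono: "Fb A M f \<Longrightarrow> M \<le> M' \<Longrightarrow> Fb A M' f"
  unfolding Fb_def by (meson order_trans)

lemma Fb_add: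
  assumes "Fb A M f" "Fb A M' g"
  shows "Fb A (M + M') (\<lambda>z. f z + g z)"
proof -
  note f = locF_props[OF calF_locF[OF FbD(1)[OF assms(1)]]]
  note g = locF_props[OF calF_locF[OF FbD(1)[OF assms(2)]]]
  obtain B B' where B: "\<And>z. z \<in> strip \<Longrightarrow> N (f z) \<le> B" "\<And>z. z \<in> strip \<Longrightarrow> N (g z) \<le> B'"
    using assms calF_bounded FbD(1) by metis
  show ?thesis
  proof (rule FbI)
    show "locF (\<lambda>z. f z + g z)"
      unfolding locF_def
    proof (intro conjI ballI)
      show "E.cont_into strip (\<lambda>z. f z + g z)" using f g by (intro E.cont_into_add) auto
      show "E.weak_hol ostrip (\<lambda>z. f z + g z)"
        using f g ostrip_subset_strip by (intro E.weak_hol_add) auto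
      fix j :: nat assume j: "j \<in> {0,1}"
      interpret J: cnormed "smul A" "sp A j" "nm A j" by (rule cnormed_sp[OF j])
      show "\<forall>t. f (bd j t) + g (bd j t) \<in> sp A j" using f(4) g(4) j by auto
      show "J.cont_into UNIV (\<lambda>t. f (bd j t) + g (bd j t))"
        using f(4,5) g(4,5) j by (intro J.cont_into_add) auto
    qed (use f g in auto)
    show "N (f z + g z) \<le> B + B'" if "z \<in> strip" for z
      using E.norm_triangle[of "f z" "g z"] f(1) g(1) B that by fastforce
    fix j :: nat and t assume j: "j \<in> {0,1}"
    interpret J: cnormed "smul A" "sp A j" "nm A j" by (rule cnormed_sp[OF j])
    show "nm A j (f (bd j t) + g (bd j t)) \<le> M + M'"
      using J.norm_triangle[OF f(4)[OF j] g(4)[OF j], of t t] FbD(2)[OF assms(1) j, of t] FbD(2)[OF assms(2) j, of t]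
      by linarith
  qed
qed

text \<open>Again two bounds of different kinds: \<open>B\<close> secures boundedness on the strip,
  while the new radius involves only the edge bound \<open>K\<close>. This matters for factors such
  as the inverse of \<open>\<psi>\<close>, and for \<open>\<psi>\<close> itself, whose edge bound is
  \<open>1\<close>.\<close>

lemma Fb_scale:
  assumes f: "Fb A M f" and g: "continuous_on strip g" "g holomorphic_on ostrip"
    and B: "\<And>z. z \<in> strip \<Longrightarrow> cmod (g z) \<le> B" and K: "\<And>j t. j \<in> {0,1} \<Longrightarrow> cmod (g (bd j t)) \<le> K"
  shows "Fb A (K * M) (\<lambda>z. smul A (g z) (f z))"
proof -
  note F = locF_props[OF calF_locF[OF FbD(1)[OF f]]]
  obtain B' where B': "\<And>z. z \<in> strip \<Longrightarrow> N (f z) \<le> B'" using f calF_bounded FbD(1) by metis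
  show ?thesis
  proof (rule FbI)
    show "locF (\<lambda>z. smul A (g z) (f z))"
      unfolding locF_def
    proof (intro conjI ballI)
      show "E.cont_into strip (\<lambda>z. smul A (g z) (f z))" using F g by (intro E.cont_into_scale) auto
      show "E.weak_hol ostrip (\<lambda>z. smul A (g z) (f z))"
        using F g ostrip_subset_strip by (intro E.weak_hol_scale) auto
      fix j :: nat assume j: "j \<in> {0,1}"
      interpret J: cnormed "smul A" "sp A j" "nm A j" by (rule cnormed_sp[OF j])
      show "\<forall>t. smul A (g (bd j t)) (f (bd j t)) \<in> sp A j" using F(4) j by auto
      have "continuous_on UNIV (bd j)" unfolding bd_def by (intro continuous_intros)
      then have "continuous_on UNIV (\<lambda>t. g (bd j t))"
        using continuous_on_compose2[OF g(1), of UNIV "bd j"] bd_strip[OF j] by auto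
      then show "J.cont_into UNIV (\<lambda>t. smul A (g (bd j t)) (f (bd j t)))"
        using F(4,5) j by (intro J.cont_into_scale) auto
    qed (use F in auto)
    show "N (smul A (g z) (f z)) \<le> B * B'" if "z \<in> strip" for z
      using F(1) that B[OF that] B'[OF that] E.norm_ge_zero order_trans[OF norm_ge_zero B[OF that]]
      by (simp add: E.norm_scale mult_mono)
    fix j :: nat and t assume j: "j \<in> {0,1}"
    interpret J: cnormed "smul A" "sp A j" "nm A j" by (rule cnormed_sp[OF j])
    show "nm A j (smul A (g (bd j t)) (f (bd j t))) \<le> K * M"
      using F(4)[OF j] FbD(2)[OF f j, of t] K[OF j, of t] J.norm_ge_zero order_trans[OF norm_ge_zero K[OF j, of t]]
      by (simp add: J.norm_scale mult_mono)
  qed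
qed

lemma Fb_scale_const:
  assumes "Fb A M f"
  shows "Fb A (cmod c * M) (\<lambda>z. smul A c (f z))"
  using assms by (rule Fb_scale[where B = "cmod c"]) auto

lemma Fb_diff:
  assumes "Fb A M f" "Fb A M' g"
  shows "Fb A (M + M') (\<lambda>z. f z - g z)"
  using Fb_add[OF assms(1) Fb_scale_const[OF assms(2), of "-1"]]
  by (simp add: E0.scale_minus_left)

lemma Fb_zero: "Fb A 0 (\<lambda>z. 0)"
proof (rule FbI)
  have "cnormed.cont_into (nm A j) UNIV (\<lambda>t::real. 0)" if "j \<in> {0,1}" for j
  proof -
    interpret J: cnormed "smul A" "sp A j" "nm A j" by (rule cnormed_sp[OF that])
    show ?thesis by (auto simp: J.cont_into_def)
  qed
  then show "locF (\<lambda>z. 0)"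
    by (auto simp: locF_def E.cont_into_def E.weak_hol_def)
qed auto

lemma Fb_sum:
  assumes "\<And>i. i \<in> I \<Longrightarrow> Fb A (M i) (f i)"
  shows "Fb A (\<Sum>i\<in>I. M i) (\<lambda>z. \<Sum>i\<in>I. f i z)"
  using assms
proof (induction I rule: infinite_finite_induct)
  case (insert x F)
  then show ?case using Fb_add[of "M x" "f x" "sum M F"] by simp
qed (auto simp: Fb_zero)

text \<open>Constant functions place the intersection of the edge spaces in every interpolation
  space, with a bound that does not depend on the parameter.\<close>

lemma Fb_const:
  assumes "y \<in> sp A 0" "y \<in> sp A 1"
  shows "Fb A (max (nm A 0 y) (nm A 1 y)) (\<lambda>z. y)"
proof (rule FbI)
  have "cnormed.cont_into (nm A j) UNIV (\<lambda>t::real. y)" if "j \<in> {0,1}" for j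
  proof -
    interpret J: cnormed "smul A" "sp A j" "nm A j" by (rule cnormed_sp[OF that])
    show ?thesis by (auto simp: J.cont_into_def)
  qed
  then show "locF (\<lambda>z. y)"
    using assms sp_subset_sumspace[of 0] by (auto simp: locF_def E.cont_into_def E.weak_hol_def)
qed auto

text \<open>Translation symmetry of the strip. By it the value of \<open>f\<close> at any complex
  point is an element of the interpolation space at the real part, with the same bound as at the
  real point itself.\<close>

lemma Fb_shift:
  assumes f: "Fb A M f"
  shows "Fb A M (\<lambda>z. f (z + \<i> * of_real s))"
proof -
  note F = locF_props[OF calF_locF[OF FbD(1)[OF f]]]
  obtain B' where B': "\<And>z. z \<in> strip \<Longrightarrow> N (f z) \<le> B'" using f calF_bounded FbD(1) by metis
  have st: "z + \<i> * of_real s \<in> strip" if "z \<in> strip" for z using that by (auto simp: strip_def)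
  have os: "z + \<i> * of_real s \<in> ostrip" if "z \<in> ostrip" for z using that by (auto simp: ostrip_def)
  show ?thesis
  proof (rule FbI)
    show "locF (\<lambda>z. f (z + \<i> * of_real s))"
      unfolding locF_def
    proof (intro conjI ballI)
      show "E.cont_into strip (\<lambda>z. f (z + \<i> * of_real s))"
        using F(2) st by (intro E.cont_into_compose[of strip f strip "\<lambda>z. z + \<i> * of_real s"]) (auto intro!: continuous_intros)
      show "E.weak_hol ostrip (\<lambda>z. f (z + \<i> * of_real s))"
        using F(3) os by (intro E.weak_hol_compose[of ostrip f "\<lambda>z. z + \<i> * of_real s" ostrip]) (auto intro!: holomorphic_intros)
      fix j :: nat assume j: "j \<in> {0,1}"
      interpret J: cnormed "smul A" "sp A j" "nm A j" by (rule cnormed_sp[OF j])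
      show "\<forall>t. f (bd j t + \<i> * of_real s) \<in> sp A j" using F(4) j by (auto simp: bd_add)
      show "J.cont_into UNIV (\<lambda>t. f (bd j t + \<i> * of_real s))"
        unfolding bd_add using F(5)[OF j] by (intro J.cont_into_compose[of UNIV "\<lambda>t. f (bd j t)" UNIV "\<lambda>t. t + s"]) (auto intro!: continuous_intros)
    qed (use F st in auto)
    show "N (f (z + \<i> * of_real s)) \<le> B'" if "z \<in> strip" for z using B' st that by auto
    show "nm A j (f (bd j t + \<i> * of_real s)) \<le> M" if "j \<in> {0,1}" for j t
      unfolding bd_add using FbD(2)[OF f that] by auto
  qed
qed

end

section \<open>Maximum principle and completeness\<close>

text \<open>Phragmen-Lindelof argument: the factor \<open>exp (e * z\<^sup>2)\<close> decays along
  the strip, so the maximum principle on a tall rectangle applies to the product, and then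
  \<open>e\<close> tends to \<open>0\<close>.\<close>

lemma strip_maximum_principle:
  fixes g :: "complex \<Rightarrow> complex"
  assumes cont: "continuous_on strip g" and hol: "g holomorphic_on ostrip"
    and B: "\<And>z. z \<in> strip \<Longrightarrow> cmod (g z) \<le> B"
    and M: "\<And>j t. j \<in> {0,1} \<Longrightarrow> cmod (g (bd j t)) \<le> M" and z: "z \<in> strip"
  shows "cmod (g z) \<le> M"
proof -
  have M0: "M \<ge> 0" using M[of 0 0] order_trans[OF norm_ge_zero] by blast
  \<comment> \<open>The added \<open>e\<close> keeps the right-hand side positive even for
    \<open>M = 0\<close>, so that the values on the distant horizontal sides fall below it;
    \<open>exp e\<close> absorbs the contribution of the squared real part, which is at most
    \<open>1\<close>.\<close>
  have bound: "cmod (g z) * exp (e * ((Re z)\<^sup>2 - (Im z)\<^sup>2)) \<le> (M + e) * exp e" if e: "e > 0" for e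
  proof -
    define G where "G z = g z * exp (of_real e * z\<^sup>2)" for z
    have G: "cmod (G w) = cmod (g w) * exp (e * ((Re w)\<^sup>2 - (Im w)\<^sup>2))" for w
      by (simp add: G_def norm_mult Re_power2)
    have "((\<lambda>R. exp (e * (1 - R\<^sup>2))) \<longlongrightarrow> 0) at_top" using e by real_asymp
    from tendsto_mult_right_zero[OF this, of B]
    have "((\<lambda>R. B * exp (e * (1 - R\<^sup>2))) \<longlongrightarrow> 0) at_top" .
    then have "\<forall>\<^sub>F R in at_top. B * exp (e * (1 - R\<^sup>2)) < (M + e) * exp e"
      using e M0 by (intro order_tendstoD) (auto intro: add_nonneg_pos)
    then have "\<forall>\<^sub>F R in at_top. B * exp (e * (1 - R\<^sup>2)) < (M + e) * exp e \<and> R > \<bar>Im z\<bar>"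
      using eventually_gt_at_top by (rule eventually_conj)
    then obtain R where R: "B * exp (e * (1 - R\<^sup>2)) < (M + e) * exp e" "R > \<bar>Im z\<bar>"
      by (auto dest: eventually_happens'[OF trivial_limit_at_top_linorder])
    define Q where "Q = cbox (Complex 0 (- R)) (Complex 1 R)"
    have Q: "w \<in> Q \<longleftrightarrow> 0 \<le> Re w \<and> Re w \<le> 1 \<and> - R \<le> Im w \<and> Im w \<le> R" for w
      by (auto simp: Q_def in_cbox_complex_iff)
    have "cmod (G z) \<le> (M + e) * exp e"
    proof (rule maximum_modulus_frontier[of G Q])
      have "interior Q \<subseteq> ostrip" by (auto simp: Q_def in_box_complex_iff ostrip_def)
      then show "G holomorphic_on interior Q"
        unfolding G_def by (intro holomorphic_intros holomorphic_on_subset[OF hol])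
      have "closure Q \<subseteq> strip" by (auto simp: Q_def in_cbox_complex_iff strip_def)
      then show "continuous_on (closure Q) G"
        unfolding G_def by (intro continuous_intros continuous_on_subset[OF cont])
      show "bounded Q" by (simp add: Q_def)
      show "z \<in> Q" using z R(2) by (auto simp: Q strip_def)
      fix w assume w: "w \<in> frontier Q"
      then have wQ: "w \<in> Q" and "w \<notin> box (Complex 0 (- R)) (Complex 1 R)"
        by (auto simp: Q_def frontier_cbox)
      then consider "w = bd 0 (Im w)" | "w = bd 1 (Im w)" | "\<bar>Im w\<bar> = R"
        unfolding Q in_box_complex_iff by (force simp: bd_def complex_eq_iff)
      then show "cmod (G w) \<le> (M + e) * exp e"
      proof cases
        case 3
        have "e * ((Re w)\<^sup>2 - (Im w)\<^sup>2) \<le> e * (1 - R\<^sup>2)"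
          using 3 wQ e by (intro mult_left_mono diff_mono power_le_one) (auto simp: Q simp flip: 3)
        then have "cmod (G w) \<le> B * exp (e * (1 - R\<^sup>2))"
          unfolding G using B[of w] wQ by (intro mult_mono) (auto simp: Q strip_def intro: order_trans[OF norm_ge_zero B[of w]])
        then show ?thesis using R(1) by linarith
      next
        case 1
        have "cmod (g w) \<le> M + e" using M[of 0 "Im w"] 1 e by simp
        moreover have "e * ((Re w)\<^sup>2 - (Im w)\<^sup>2) \<le> e * 1"
          using wQ e by (intro mult_left_mono) (auto simp: Q intro!: diff_le_eq[THEN iffD2] add_increasing2 power_le_one)
        ultimately show ?thesis unfolding G using M0 e by (intro mult_mono) auto
      next
        case 2
        have "cmod (g w) \<le> M + e" using M[of 1 "Im w"] 2 e by simp
        moreover have "e * ((Re w)\<^sup>2 - (Im w)\<^sup>2) \<le> e * 1"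
          using wQ e by (intro mult_left_mono) (auto simp: Q intro!: diff_le_eq[THEN iffD2] add_increasing2 power_le_one)
        ultimately show ?thesis unfolding G using M0 e by (intro mult_mono) auto
      qed
    qed
    then show ?thesis by (simp add: G)
  qed
  have "((\<lambda>e. cmod (g z) * exp (e * ((Re z)\<^sup>2 - (Im z)\<^sup>2))) \<longlongrightarrow>
      cmod (g z) * exp (0 * ((Re z)\<^sup>2 - (Im z)\<^sup>2))) (at_right 0)"
    by (intro tendsto_intros)
  moreover have "((\<lambda>e. (M + e) * exp e) \<longlongrightarrow> (M + 0) * exp 0) (at_right 0)"
    by (intro tendsto_intros)
  moreover have "\<forall>\<^sub>F e in at_right 0. cmod (g z) * exp (e * ((Re z)\<^sup>2 - (Im z)\<^sup>2)) \<le> (M + e) * exp e"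
    using bound eventually_at_right_less[of "0::real"] by (auto elim!: eventually_mono)
  ultimately have "cmod (g z) * exp (0 * ((Re z)\<^sup>2 - (Im z)\<^sup>2)) \<le> (M + 0) * exp 0"
    by (intro tendsto_le[OF trivial_limit_at_right_real])
  then show ?thesis by simp
qed

context cnormed
begin

lemma dual_continuous:
  assumes l: "l \<in> dual" and f: "cont_into U f" "\<And>w. w \<in> U \<Longrightarrow> f w \<in> V"
  shows "continuous_on U (\<lambda>z. l (f z))"
  unfolding continuous_on_iff
proof (intro ballI allI impI)
  fix z and e :: real assume z: "z \<in> U" and "e > 0"
  then obtain d where d: "d > 0" "\<And>w. w \<in> U \<Longrightarrow> dist w z < d \<Longrightarrow> n (f w - f z) < e"
    using f(1) unfolding cont_into_def by metis
  have "dist (l (f w)) (l (f z)) < e" if "w \<in> U" "dist w z < d" for w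
  proof -
    have "dist (l (f w)) (l (f z)) = cmod (l (f w - f z))"
      using l f(2) z that by (simp add: dist_norm dual_diff)
    also have "\<dots> \<le> n (f w - f z)" using l f(2) z that by (intro dual_bound) auto
    finally show ?thesis using d(2)[OF that] by linarith
  qed
  with d(1) show "\<exists>d>0. \<forall>w\<in>U. dist w z < d \<longrightarrow> dist (l (f w)) (l (f z)) < e" by blast
qed

lemma uniform_cauchy_limit:
  assumes F: "\<And>k w. w \<in> W \<Longrightarrow> F k w \<in> V" "\<And>w. w \<in> W \<Longrightarrow> f w \<in> V"
    and lim: "\<And>w. w \<in> W \<Longrightarrow> (\<lambda>k. n (F k w - f w)) \<longlonglongrightarrow> 0"
    and cau: "\<And>m k w. m \<ge> K \<Longrightarrow> k \<ge> K \<Longrightarrow> w \<in> W \<Longrightarrow> n (F m w - F k w) < e"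
    and k: "k \<ge> K" and w: "w \<in> W"
  shows "n (F k w - f w) \<le> e"
proof (rule LIMSEQ_le_const)
  show "(\<lambda>m. e + n (F m w - f w)) \<longlonglongrightarrow> e"
    using tendsto_add[OF tendsto_const lim[OF w], of e] by simp
  have "n (F k w - f w) \<le> e + n (F m w - f w)" if "m \<ge> K" for m
    using cau[OF k that w] norm_triangle_via[of "F k w" "F m w" "f w"] F w by fastforce
  then show "\<exists>K. \<forall>m\<ge>K. n (F k w - f w) \<le> e + n (F m w - f w)" by blast
qed

end

context couple
begin

text \<open>Each functional of norm at most one sees a scalar function bounded by \<open>M\<close>
  on the edges, since the edge spaces embed in the sum with norm at most one. Hahn-Banach returns
  the estimate to the vector.\<close>

lemma Fb_sum_norm_le:
  assumes f: "Fb A M f" and z: "z \<in> strip"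
  shows "N (f z) \<le> M"
proof (rule E.norm_le_dual)
  note F = locF_props[OF calF_locF[OF FbD(1)[OF f]]]
  show "f z \<in> S" using F z by auto
  fix l assume l: "l \<in> E.dual"
  obtain B where B: "\<And>z. z \<in> strip \<Longrightarrow> N (f z) \<le> B" using calF_bounded FbD(1)[OF f] by metis
  show "cmod (l (f z)) \<le> M"
  proof (rule strip_maximum_principle[OF _ _ _ _ z])
    show "continuous_on strip (\<lambda>z. l (f z))" using l F by (intro E.dual_continuous) auto
    show "(\<lambda>z. l (f z)) holomorphic_on ostrip" using l F by (auto simp: E.weak_hol_def)
    show "cmod (l (f z)) \<le> B" if "z \<in> strip" for z
      using E.dual_bound[OF l F(1)[OF that]] B[OF that] by linarith
    show "cmod (l (f (bd j t))) \<le> M" if j: "j \<in> {0,1}" for j t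
      using E.dual_bound[OF l F(1)[OF bd_strip[OF j]]] sum_norm_le_nm[OF j F(4)[OF j]] FbD(2)[OF f j, of t]
      by (meson order_trans)
  qed
qed

text \<open>Uniformity is asked for only on bounded ranges of \<open>Im z\<close>, because the
  partial sums of a periodization need not converge uniformly on the whole strip. Boundedness of the
  limit has to be established separately.\<close>

lemma locF_limit:
  fixes F :: "nat \<Rightarrow> complex \<Rightarrow> 'a"
  assumes F: "\<And>k. locF (F k)"
    and cauS: "\<And>R e. e > 0 \<Longrightarrow> \<exists>K. \<forall>m\<ge>K. \<forall>k\<ge>K. \<forall>z\<in>strip. \<bar>Im z\<bar> \<le> R \<longrightarrow> N (F m z - F k z) < e"
    and cauB: "\<And>j R e. j \<in> {0,1} \<Longrightarrow> e > 0 \<Longrightarrow>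
      \<exists>K. \<forall>m\<ge>K. \<forall>k\<ge>K. \<forall>t. \<bar>t\<bar> \<le> R \<longrightarrow> nm A j (F m (bd j t) - F k (bd j t)) < e"
  shows "\<exists>f. locF f \<and>
    (\<forall>R. \<forall>e>0. \<exists>K. \<forall>k\<ge>K. \<forall>z\<in>strip. \<bar>Im z\<bar> \<le> R \<longrightarrow> N (F k z - f z) < e) \<and>
    (\<forall>j\<in>{0,1}. \<forall>R. \<forall>e>0. \<exists>K. \<forall>k\<ge>K. \<forall>t. \<bar>t\<bar> \<le> R \<longrightarrow> nm A j (F k (bd j t) - f (bd j t)) < e)"
proof -
  note FD = locF_props[OF F]
  have "\<exists>y\<in>S. (\<lambda>k. N (F k z - y)) \<longlonglongrightarrow> 0" if z: "z \<in> strip" for z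
  proof (rule E.cauchy_limit)
    show "F k z \<in> S" for k using FD(1)[OF z] .
    show "\<exists>K. \<forall>m\<ge>K. \<forall>k\<ge>K. N (F m z - F k z) < e" if "e > 0" for e
      using cauS[OF that, of "\<bar>Im z\<bar>"] z by blast
  qed
  then obtain f where f: "\<And>z. z \<in> strip \<Longrightarrow> f z \<in> S" "\<And>z. z \<in> strip \<Longrightarrow> (\<lambda>k. N (F k z - f z)) \<longlonglongrightarrow> 0"
    by metis
  have limS: "\<exists>K. \<forall>k\<ge>K. \<forall>z\<in>strip. \<bar>Im z\<bar> \<le> R \<longrightarrow> N (F k z - f z) < e" if e: "e > 0" for R e
  proof -
    have "e / 2 > 0" using e by simp
    then obtain K where K: "\<forall>m\<ge>K. \<forall>k\<ge>K. \<forall>z\<in>strip. \<bar>Im z\<bar> \<le> R \<longrightarrow> N (F m z - F k z) < e / 2"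
      using cauS by metis
    have "N (F k z - f z) < e" if "k \<ge> K" "z \<in> strip" "\<bar>Im z\<bar> \<le> R" for k z
    proof -
      have "N (F k z - f z) \<le> e / 2"
        by (rule E.uniform_cauchy_limit[of "{z\<in>strip. \<bar>Im z\<bar> \<le> R}" F f K]) (use K FD(1) f that in auto)
      then show ?thesis using e by linarith
    qed
    then show ?thesis by blast
  qed
  have B: "f (bd j t) \<in> sp A j \<and> (\<lambda>k. nm A j (F k (bd j t) - f (bd j t))) \<longlonglongrightarrow> 0" if j: "j \<in> {0,1}" for j t
  proof -
    interpret J: cnormed "smul A" "sp A j" "nm A j" by (rule cnormed_sp[OF j])
    have "\<exists>y\<in>sp A j. (\<lambda>k. nm A j (F k (bd j t) - y)) \<longlonglongrightarrow> 0"
    proof (rule J.cauchy_limit)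
      show "F k (bd j t) \<in> sp A j" for k using FD(4)[OF j] .
      show "\<exists>K. \<forall>m\<ge>K. \<forall>k\<ge>K. nm A j (F m (bd j t) - F k (bd j t)) < e" if "e > 0" for e
        using cauB[OF j that, of "\<bar>t\<bar>"] by blast
    qed
    then obtain y where y: "y \<in> sp A j" "(\<lambda>k. nm A j (F k (bd j t) - y)) \<longlonglongrightarrow> 0" by blast
    have yS: "y \<in> S" using sp_subset_sumspace[OF j] y by auto
    have "(\<lambda>k. N (F k (bd j t) - y)) \<longlonglongrightarrow> 0"
    proof (rule Lim_null_comparison[OF _ y(2)])
      have "norm (N (F k (bd j t) - y)) \<le> nm A j (F k (bd j t) - y)" for k
        using sum_norm_le_nm[OF j, of "F k (bd j t) - y"] sum_norm_nonneg[of "F k (bd j t) - y"]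
          FD(4)[OF j, of k t] FD(1)[OF bd_strip[OF j]] y(1) yS by auto
      then show "\<forall>\<^sub>F k in sequentially. norm (N (F k (bd j t) - y)) \<le> nm A j (F k (bd j t) - y)" by simp
    qed
    \<comment> \<open>The limit in the edge space is also a limit in the sum space, so uniqueness
      identifies it with the value of \<open>f\<close>.\<close>
    then have "f (bd j t) = y"
      using E.limit_unique[of "\<lambda>k. F k (bd j t)" "f (bd j t)" y] f bd_strip[OF j] FD(1) yS by blast
    with y show ?thesis by simp
  qed
  have limB: "\<exists>K. \<forall>k\<ge>K. \<forall>t. \<bar>t\<bar> \<le> R \<longrightarrow> nm A j (F k (bd j t) - f (bd j t)) < e"
    if j: "j \<in> {0,1}" and e: "e > 0" for j R e
  proof -
    interpret J: cnormed "smul A" "sp A j" "nm A j" by (rule cnormed_sp[OF j])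
    have "e / 2 > 0" using e by simp
    then obtain K where K: "\<forall>m\<ge>K. \<forall>k\<ge>K. \<forall>t. \<bar>t\<bar> \<le> R \<longrightarrow> nm A j (F m (bd j t) - F k (bd j t)) < e / 2"
      using cauB[OF j] by metis
    have "nm A j (F k (bd j t) - f (bd j t)) < e" if "k \<ge> K" "\<bar>t\<bar> \<le> R" for k t
    proof -
      have "nm A j (F k (bd j t) - f (bd j t)) \<le> e / 2"
        by (rule J.uniform_cauchy_limit[of "{t. \<bar>t\<bar> \<le> R}" "\<lambda>k t. F k (bd j t)" "\<lambda>t. f (bd j t)" K])
          (use K FD(4)[OF j] B[OF j] that in auto)
      then show ?thesis using e by linarith
    qed
    then show ?thesis by blast
  qed
  have "locF f"
    unfolding locF_def
  proof (intro conjI ballI)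
    have near: "\<exists>r>0. \<forall>e>0. \<exists>K. \<forall>k\<ge>K. \<forall>w\<in>strip. dist w z < r \<longrightarrow> N (F k w - f w) < e" for z
    proof (rule exI[of _ 1], intro conjI allI impI)
      fix e :: real assume "e > 0"
      then obtain K where K: "\<forall>k\<ge>K. \<forall>w\<in>strip. \<bar>Im w\<bar> \<le> \<bar>Im z\<bar> + 1 \<longrightarrow> N (F k w - f w) < e"
        using limS by metis
      have "\<bar>Im w\<bar> \<le> \<bar>Im z\<bar> + 1" if "dist w z < 1" for w
        using abs_Im_le_cmod[of "w - z"] that by (auto simp: dist_norm)
      with K show "\<exists>K. \<forall>k\<ge>K. \<forall>w\<in>strip. dist w z < 1 \<longrightarrow> N (F k w - f w) < e" by blast
    qed simp
    show "E.cont_into strip f"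
    proof (rule E.cont_into_limit[of strip F])
      show "\<exists>r>0. \<forall>e>0. \<exists>k. \<forall>w\<in>strip. dist w z < r \<longrightarrow> N (F k w - f w) < e" for z
        using near[of z] by (meson order_refl)
    qed (use FD f in auto)
    show "E.weak_hol ostrip f"
    proof (rule E.weak_hol_limit[OF open_ostrip, of F])
      show "\<exists>r>0. \<forall>e>0. \<exists>K. \<forall>k\<ge>K. \<forall>w\<in>ostrip. dist w z < r \<longrightarrow> N (F k w - f w) < e" for z
        using near[of z] ostrip_subset_strip by (meson subsetD)
    qed (use FD f ostrip_subset_strip in auto)
    show "f z \<in> S" if "z \<in> strip" for z using f that by auto
    fix j :: nat assume j: "j \<in> {0,1}"
    interpret J: cnormed "smul A" "sp A j" "nm A j" by (rule cnormed_sp[OF j])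
    show "\<forall>t. f (bd j t) \<in> sp A j" using B[OF j] by blast
    show "J.cont_into UNIV (\<lambda>t. f (bd j t))"
    proof (rule J.cont_into_limit[of UNIV "\<lambda>k t. F k (bd j t)"])
      fix z :: real
      show "\<exists>r>0. \<forall>e>0. \<exists>k. \<forall>w\<in>UNIV. dist w z < r \<longrightarrow> nm A j (F k (bd j w) - f (bd j w)) < e"
      proof (rule exI[of _ 1], intro conjI allI impI)
        fix e :: real assume "e > 0"
        then obtain K where K: "\<forall>k\<ge>K. \<forall>t. \<bar>t\<bar> \<le> \<bar>z\<bar> + 1 \<longrightarrow> nm A j (F k (bd j t) - f (bd j t)) < e"
          using limB[OF j] by metis
        then show "\<exists>k. \<forall>w\<in>UNIV. dist w z < 1 \<longrightarrow> nm A j (F k (bd j w) - f (bd j w)) < e"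
          by (intro exI[of _ K]) (auto simp: dist_real_def)
      qed simp
    qed (use FD(4,5)[OF j] B[OF j] in auto)
  qed
  with limS limB show ?thesis by blast
qed

text \<open>This is completeness of \<open>calF\<close>. Regularity comes from the local limit
  theorem; the Cauchy condition, being uniform on the strip and on the edges, transfers boundedness
  and gives convergence in norm.\<close>

lemma Fb_cauchy_limit:
  fixes F :: "nat \<Rightarrow> complex \<Rightarrow> 'a"
  assumes F: "\<And>k. F k \<in> calF A"
    and cau: "\<And>e. e > 0 \<Longrightarrow> \<exists>K. \<forall>m\<ge>K. \<forall>k\<ge>K. Fb A e (\<lambda>z. F m z - F k z)"
  obtains f where "f \<in> calF A" "\<And>e. e > 0 \<Longrightarrow> \<exists>K. \<forall>k\<ge>K. Fb A e (\<lambda>z. F k z - f z)"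
proof -
  have cS: "\<exists>K. \<forall>m\<ge>K. \<forall>k\<ge>K. \<forall>z\<in>strip. N (F m z - F k z) < e" if "e > 0" for e
  proof -
    obtain K where K: "\<forall>m\<ge>K. \<forall>k\<ge>K. Fb A (e/2) (\<lambda>z. F m z - F k z)" using cau[of "e/2"] \<open>e > 0\<close> by auto
    have "N (F m z - F k z) < e" if "m \<ge> K" "k \<ge> K" "z \<in> strip" for m k z
      using Fb_sum_norm_le[OF K[rule_format, OF that(1,2)] that(3)] \<open>e > 0\<close> by linarith
    then show ?thesis by blast
  qed
  have cB: "\<exists>K. \<forall>m\<ge>K. \<forall>k\<ge>K. \<forall>t. nm A j (F m (bd j t) - F k (bd j t)) < e"
    if "e > 0" and j: "j \<in> {0,1}" for e j
  proof -
    obtain K where K: "\<forall>m\<ge>K. \<forall>k\<ge>K. Fb A (e/2) (\<lambda>z. F m z - F k z)" using cau[of "e/2"] \<open>e > 0\<close> by auto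
    have "nm A j (F m (bd j t) - F k (bd j t)) < e" if "m \<ge> K" "k \<ge> K" for m k t
      using FbD(2)[OF K[rule_format, OF that(1,2)] j, of t] \<open>e > 0\<close> by linarith
    then show ?thesis by blast
  qed
  have a: "locF (F k)" for k using F calF_locF by blast
  have b: "\<exists>K. \<forall>m\<ge>K. \<forall>k\<ge>K. \<forall>z\<in>strip. \<bar>Im z\<bar> \<le> R \<longrightarrow> N (F m z - F k z) < e" if "e > 0" for R e
      using cS[OF that] by blast
  have c: "\<exists>K. \<forall>m\<ge>K. \<forall>k\<ge>K. \<forall>t. \<bar>t\<bar> \<le> R \<longrightarrow> nm A j (F m (bd j t) - F k (bd j t)) < e"
      if "j \<in> {0,1}" "e > 0" for j R e
      using cB[OF that(2,1)] by blast
  have "\<exists>f. locF f \<and>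
    (\<forall>R. \<forall>e>0. \<exists>K. \<forall>k\<ge>K. \<forall>z\<in>strip. \<bar>Im z\<bar> \<le> R \<longrightarrow> N (F k z - f z) < e) \<and>
    (\<forall>j\<in>{0,1}. \<forall>R. \<forall>e>0. \<exists>K. \<forall>k\<ge>K. \<forall>t. \<bar>t\<bar> \<le> R \<longrightarrow> nm A j (F k (bd j t) - f (bd j t)) < e)"
    by (rule locF_limit) (rule a, rule b, assumption, rule c, assumption+)
  then obtain f where f: "locF f"
    "\<forall>R. \<forall>e>0. \<exists>K. \<forall>k\<ge>K. \<forall>z\<in>strip. \<bar>Im z\<bar> \<le> R \<longrightarrow> N (F k z - f z) < e"
    "\<forall>j\<in>{0,1}. \<forall>R. \<forall>e>0. \<exists>K. \<forall>k\<ge>K. \<forall>t. \<bar>t\<bar> \<le> R \<longrightarrow> nm A j (F k (bd j t) - f (bd j t)) < e"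
    by (elim exE conjE)
  note FD = locF_props[OF calF_locF[OF F]] and fD = locF_props[OF f(1)]
  have uS: "\<exists>K. \<forall>k\<ge>K. \<forall>z\<in>strip. N (F k z - f z) \<le> e" if e: "e > 0" for e
  proof -
    obtain K where K: "\<forall>m\<ge>K. \<forall>k\<ge>K. \<forall>z\<in>strip. N (F m z - F k z) < e" using cS[OF e] by blast
    have "N (F k z - f z) \<le> e" if "k \<ge> K" "z \<in> strip" for k z
    proof (rule E.uniform_cauchy_limit[of strip F f K])
      show "(\<lambda>k. N (F k w - f w)) \<longlonglongrightarrow> 0" if "w \<in> strip" for w
      proof (rule LIMSEQ_I)
        fix r :: real assume "r > 0"
        with f(2) obtain K where K: "\<forall>k\<ge>K. \<forall>z\<in>strip. \<bar>Im z\<bar> \<le> \<bar>Im w\<bar> \<longrightarrow> N (F k z - f z) < r" by blast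
        have "norm (N (F k w - f w) - 0) < r" if "k \<ge> K" for k
          using K \<open>w \<in> strip\<close> that sum_norm_nonneg[of "F k w - f w"] FD(1) fD(1) by auto
        then show "\<exists>no. \<forall>n\<ge>no. norm (N (F n w - f w) - 0) < r" by blast
      qed
    qed (use K FD fD that in auto)
    then show ?thesis by blast
  qed
  have uB: "\<exists>K. \<forall>k\<ge>K. \<forall>t. nm A j (F k (bd j t) - f (bd j t)) \<le> e" if e: "e > 0" and j: "j \<in> {0,1}" for e j
  proof -
    interpret J: cnormed "smul A" "sp A j" "nm A j" by (rule cnormed_sp[OF j])
    obtain K where K: "\<forall>m\<ge>K. \<forall>k\<ge>K. \<forall>t. nm A j (F m (bd j t) - F k (bd j t)) < e" using cB[OF e j] by blast
    have "nm A j (F k (bd j t) - f (bd j t)) \<le> e" if "k \<ge> K" for k t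
    proof (rule J.uniform_cauchy_limit[of UNIV "\<lambda>k t. F k (bd j t)" "\<lambda>t. f (bd j t)" K])
      show "(\<lambda>k. nm A j (F k (bd j w) - f (bd j w))) \<longlonglongrightarrow> 0" for w
      proof (rule LIMSEQ_I)
        fix r :: real assume "r > 0"
        then obtain K where K: "\<forall>k\<ge>K. \<forall>t. \<bar>t\<bar> \<le> \<bar>w\<bar> \<longrightarrow> nm A j (F k (bd j t) - f (bd j t)) < r"
          using f(3) j by blast
        have "norm (nm A j (F k (bd j w) - f (bd j w)) - 0) < r" if "k \<ge> K" for k
          using K that J.norm_ge_zero[of "F k (bd j w) - f (bd j w)"] FD(4)[OF j] fD(4)[OF j] by auto
        then show "\<exists>no. \<forall>n\<ge>no. norm (nm A j (F n (bd j w) - f (bd j w)) - 0) < r" by blast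
      qed
    qed (use K FD(4)[OF j] fD(4)[OF j] that in auto)
    then show ?thesis by blast
  qed
  have fF: "f \<in> calF A"
    unfolding calF_iff
  proof (intro conjI ballI f(1))
    obtain K where K: "\<forall>k\<ge>K. \<forall>z\<in>strip. N (F k z - f z) \<le> 1" using uS[of 1] by auto
    obtain B where B: "\<And>z. z \<in> strip \<Longrightarrow> N (F K z) \<le> B" using calF_bounded[OF F] by metis
    have "N (f z) \<le> 1 + B" if "z \<in> strip" for z
      using E.norm_le_via[of "f z" "F K z"] E.norm_diff_commute[of "f z" "F K z"] K B that FD(1) fD(1)
      by fastforce
    then show "\<exists>B. \<forall>z\<in>strip. N (f z) \<le> B" by blast
    fix j :: nat assume j: "j \<in> {0,1}"
    interpret J: cnormed "smul A" "sp A j" "nm A j" by (rule cnormed_sp[OF j])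
    obtain K where K: "\<forall>k\<ge>K. \<forall>t. nm A j (F k (bd j t) - f (bd j t)) \<le> 1" using uB[OF _ j, of 1] by auto
    obtain B where B: "Fb A B (F K)" using calF_Fb[OF F] by metis
    have "nm A j (f (bd j t)) \<le> 1 + B" for t
      using J.norm_le_via[of "f (bd j t)" "F K (bd j t)"] J.norm_diff_commute[of "f (bd j t)" "F K (bd j t)"]
        K[rule_format, of K t] FbD(2)[OF B j, of t] FD(4)[OF j, of K t] fD(4)[OF j, of t] by simp
    then show "\<exists>B. \<forall>t. nm A j (f (bd j t)) \<le> B" by blast
  qed
  show thesis
  proof (rule that[OF fF])
    fix e :: real assume e: "e > 0"
    obtain K0 where K0: "\<forall>k\<ge>K0. \<forall>t. nm A 0 (F k (bd 0 t) - f (bd 0 t)) \<le> e" using uB[OF e, of 0] by auto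
    obtain K1 where K1: "\<forall>k\<ge>K1. \<forall>t. nm A 1 (F k (bd 1 t) - f (bd 1 t)) \<le> e" using uB[OF e, of 1] by auto
    have "Fb A e (\<lambda>z. F k z - f z)" if "k \<ge> max K0 K1" for k
    proof -
      obtain M M' where "Fb A M (F k)" "Fb A M' f" using calF_Fb F fF by metis
      then have "(\<lambda>z. F k z - f z) \<in> calF A" using Fb_diff FbD(1) by blast
      then show ?thesis using K0 K1 that by (auto simp: Fb_def)
    qed
    then show "\<exists>K. \<forall>k\<ge>K. Fb A e (\<lambda>z. F k z - f z)" by blast
  qed
qed

end

section \<open>Division by a zero\<close>

text \<open>For \<open>\<psi> \<theta> z = (z - \<theta>) / (z + 1)\<close> the inverse is at most
  \<open>1 / \<theta>\<close> on the line \<open>Re z = 0\<close> and at most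
  \<open>2 / (1 - \<theta>)\<close> on the line \<open>Re z = 1\<close>. The constant is a common
  upper bound, continuous in \<open>\<theta>\<close>.\<close>

definition quot_const :: "real \<Rightarrow> real" where
  "quot_const \<theta> = 2 / (\<theta> * (1 - \<theta>))"

text \<open>A substitute for the Blaschke factor of the strip: on the boundary it is bounded by \<open>1\<close> and its
  inverse by \<open>quot_const \<theta>\<close>.\<close>

definition \<psi> :: "real \<Rightarrow> complex \<Rightarrow> complex" where
  "\<psi> \<theta> z = (z - of_real \<theta>) / (z + 1)"

lemma strip_plus_one: "z \<in> strip \<Longrightarrow> z + 1 \<noteq> 0" "z \<in> strip \<Longrightarrow> 1 \<le> cmod (z + 1)"
  using complex_Re_le_cmod[of "z + 1"] by (auto simp: strip_def complex_eq_iff)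

text \<open>The denominator has modulus at least \<open>1\<close> on the strip. This linear bound is
  what makes \<open>\<psi> s\<close> small near \<open>s\<close> and its square a quadratic
  error.\<close>

lemma \<psi>_le_diff:
  assumes "z \<in> strip"
  shows "cmod (\<psi> \<theta> z) \<le> cmod (z - of_real \<theta>)"
proof -
  have "cmod (z - of_real \<theta>) * 1 \<le> cmod (z - of_real \<theta>) * cmod (z + 1)"
    using strip_plus_one(2)[OF assms] by (intro mult_left_mono) auto
  then show ?thesis
    using strip_plus_one[OF assms] by (simp add: \<psi>_def norm_divide field_simps)
qed

lemma \<psi>_le_one:
  assumes "z \<in> strip" "0 \<le> \<theta>" "\<theta> \<le> 1"
  shows "cmod (\<psi> \<theta> z) \<le> 1"
proof -
  have "cmod (z - of_real \<theta>) \<le> cmod (z + 1)"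
    unfolding cmod_def using assms
    by (intro real_sqrt_le_mono add_mono abs_le_square_iff[THEN iffD1]) (auto simp: strip_def)
  then show ?thesis
    using strip_plus_one[OF assms(1)] by (simp add: \<psi>_def norm_divide divide_le_eq)
qed

lemma \<psi>_inverse_bound:
  assumes \<theta>: "0 < \<theta>" "\<theta> < 1" and j: "j \<in> {0,1}"
  shows "cmod ((bd j t + 1) / (bd j t - of_real \<theta>)) \<le> quot_const \<theta>" "bd j t \<noteq> of_real \<theta>"
proof -
  show ne: "bd j t \<noteq> of_real \<theta>" using j \<theta> by (auto simp: bd_def complex_eq_iff)
  have key: "cmod (bd j t + 1) * (\<theta> * (1 - \<theta>)) \<le> 2 * cmod (bd j t - of_real \<theta>)"
  proof (rule power2_le_imp_le)
    consider "j = 0" | "j = 1" using j by auto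
    then show "(cmod (bd j t + 1) * (\<theta> * (1 - \<theta>)))\<^sup>2 \<le> (2 * cmod (bd j t - of_real \<theta>))\<^sup>2"
    proof cases
      case 1
      have a: "(\<theta> * (1 - \<theta>))\<^sup>2 \<le> \<theta>\<^sup>2" "(\<theta> * (1 - \<theta>))\<^sup>2 \<le> 1"
        using \<theta> by (auto intro!: power_mono mult_left_le power_le_one mult_le_one)
      have "(1 + t\<^sup>2) * (\<theta> * (1 - \<theta>))\<^sup>2 \<le> \<theta>\<^sup>2 + t\<^sup>2"
        using a mult_left_mono[OF a(2), of "t\<^sup>2"] by (simp add: distrib_right)
      also have "\<dots> \<le> 4 * (\<theta>\<^sup>2 + t\<^sup>2)" by simp
      finally show ?thesis by (simp add: 1 bd_def power_mult_distrib cmod_power2)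
    next
      case 2
      have a: "(\<theta> * (1 - \<theta>))\<^sup>2 \<le> (1 - \<theta>)\<^sup>2" "(\<theta> * (1 - \<theta>))\<^sup>2 \<le> 1"
        using \<theta> by (auto intro!: power_mono mult_left_le_one_le power_le_one mult_le_one)
      have "(4 + t\<^sup>2) * (\<theta> * (1 - \<theta>))\<^sup>2 \<le> 4 * (1 - \<theta>)\<^sup>2 + t\<^sup>2"
        using a mult_left_mono[OF a(2), of "t\<^sup>2"] by (simp add: distrib_right)
      also have "\<dots> \<le> 4 * ((1 - \<theta>)\<^sup>2 + t\<^sup>2)" by simp
      finally show ?thesis by (simp add: 2 bd_def power_mult_distrib cmod_power2)
    qed
  qed simp
  show "cmod ((bd j t + 1) / (bd j t - of_real \<theta>)) \<le> quot_const \<theta>"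
  proof -
    have "0 < cmod (bd j t - of_real \<theta>)" "0 < \<theta> * (1 - \<theta>)" using ne \<theta> by auto
    with key show ?thesis unfolding quot_const_def norm_divide by (simp add: divide_le_eq le_divide_eq mult.commute)
  qed
qed

context couple
begin

text \<open>The quotient is \<open>(z + 1) / (z - \<theta>)\<close> times \<open>f\<close>, and the
  norm derivative \<open>D\<close> fills the gap with the value \<open>(\<theta> + 1) D\<close>.
  Differentiability in norm gives continuity at \<open>\<theta>\<close>, removable singularities of
  scalar functions give holomorphy, and on the edges the factor costs
  \<open>quot_const \<theta>\<close>.\<close>

lemma Fb_quotient:
  assumes f: "Fb A M f" and \<theta>: "0 < \<theta>" "\<theta> < 1" and zero: "f (of_real \<theta>) = 0"
  obtains h where "Fb A (quot_const \<theta> * M) h" "\<And>z. z \<in> strip \<Longrightarrow> f z = smul A (\<psi> \<theta> z) (h z)"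
proof -
  define c where "c = complex_of_real \<theta>"
  have c: "c \<in> ostrip" "c \<in> strip" using \<theta> by (auto simp: c_def ostrip_def strip_def)
  note F = locF_props[OF calF_locF[OF FbD(1)[OF f]]]
  have mem: "f w \<in> S" if "w \<in> ostrip" for w using F(1) that ostrip_subset_strip by auto
  have "E.strong_diff ostrip f c"
  proof -
    obtain r where r: "r > 0" "\<And>w. w \<in> ball c r \<Longrightarrow> w \<in> strip \<Longrightarrow> N (f w) \<le> N (f c) + 1"
      by (rule E.cont_into_bounded_near[OF F(2) c(2)]) (rule F(1), assumption, rule that)
    show ?thesis
      using c mem F(3) r ostrip_subset_strip
      by (intro E.weak_hol_imp_strong_diff[OF open_ostrip, where r = r and B = "N (f c) + 1"]) auto
  qed
  then obtain D where D: "D \<in> S" "\<forall>e>0. \<exists>d>0. \<forall>w\<in>ostrip. 0 < cmod (w - c) \<and> cmod (w - c) < d \<longrightarrow>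
      N (smul A (1 / (w - c)) (f w - f c) - D) < e"
    unfolding E.strong_diff_def by (elim bexE)
  have fc: "f c = 0" using zero by (simp add: c_def)
  define q where "q w = smul A (1 / (w - c)) (f w)" for w
  define h where "h z = (if z = c then smul A (c + 1) D else smul A ((z + 1) / (z - c)) (f z))" for z
  have h_q: "h w = smul A (w + 1) (q w)" if "w \<noteq> c" for w
    using that by (simp add: h_def q_def)
  have hS: "h z \<in> S" if "z \<in> strip" for z using F(1) that D by (auto simp: h_def)
  have cont: "E.cont_into strip h"
  proof (rule E.cont_intoI)
    fix z assume z: "z \<in> strip"
    show "((\<lambda>w. N (h w - h z)) \<longlongrightarrow> 0) (at z within strip)"
    proof (cases "z = c")
      case False
      have "E.cont_into (strip - {c}) (\<lambda>z. smul A ((z + 1) / (z - c)) (f z))"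
      proof (rule E.cont_into_scale)
        show "E.cont_into (strip - {c}) f"
          by (rule E.cont_into_compose[OF F(2), where h = "\<lambda>z. z"]) (auto intro: continuous_on_id)
      qed (use F(1) in \<open>auto intro!: continuous_intros\<close>)
      from E.cont_into_tendsto[OF this, of z] z False F(1)
      have "((\<lambda>w. N (smul A ((w + 1) / (w - c)) (f w) - smul A ((z + 1) / (z - c)) (f z))) \<longlongrightarrow> 0)
          (at z within (strip - {c}))" by auto
      also have "?this \<longleftrightarrow> ((\<lambda>w. N (h w - h z)) \<longlongrightarrow> 0) (at z within (strip - {c}))"
        using False by (intro filterlim_cong) (auto simp: h_def eventually_at_filter)
      also have "at z within (strip - {c}) = at z within strip"
        using False by (intro at_within_nhd[of _ "- {c}"]) auto
      finally show ?thesis .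
    next
      case True
      have ev: "\<forall>\<^sub>F w in at c within strip. w \<in> ostrip"
        using eventually_at_topological c(1) open_ostrip by blast
      have ql: "((\<lambda>w. N (q w - D)) \<longlongrightarrow> 0) (at c within strip)"
      proof (rule tendstoI)
        fix e :: real assume "e > 0"
        then obtain d where d: "d > 0" "\<And>w. w \<in> ostrip \<Longrightarrow> 0 < cmod (w - c) \<Longrightarrow> cmod (w - c) < d \<Longrightarrow>
            N (q w - D) < e"
          using D(2) unfolding fc q_def by auto
        have "\<forall>\<^sub>F w in at c within strip. 0 < cmod (w - c) \<and> cmod (w - c) < d"
          unfolding eventually_at using d(1) by (auto simp: dist_norm)
        with ev show "\<forall>\<^sub>F w in at c within strip. dist (N (q w - D)) 0 < e"
        proof eventually_elim
          case (elim w)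
          have "q w - D \<in> S" using mem elim D by (auto simp: q_def)
          then show ?case using d(2)[of w] elim sum_norm_nonneg[of "q w - D"] by auto
        qed
      qed
      have "((\<lambda>w. N (h w - h c)) \<longlongrightarrow> 0) (at c within strip)"
      proof (rule Lim_null_comparison)
        have "((\<lambda>w. cmod (w + 1) * N (q w - D) + cmod (w - c) * N D) \<longlongrightarrow>
            cmod (c + 1) * 0 + cmod (c - c) * N D) (at c within strip)"
          by (intro tendsto_intros ql)
        then show "((\<lambda>w. cmod (w + 1) * N (q w - D) + cmod (w - c) * N D) \<longlongrightarrow> 0) (at c within strip)" by simp
        have "\<forall>\<^sub>F w in at c within strip. w \<noteq> c" by (simp add: eventually_at_filter)
        with ev show "\<forall>\<^sub>F w in at c within strip. norm (N (h w - h c))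
            \<le> cmod (w + 1) * N (q w - D) + cmod (w - c) * N D"
        proof eventually_elim
          case (elim w)
          have m: "q w \<in> S" using mem elim by (auto simp: q_def)
          have "h w - h c = smul A (w + 1) (q w - D) + smul A (w - c) D"
            unfolding h_q[OF elim(2)]
            by (simp add: h_def E0.scale_right_diff_distrib E0.scale_left_diff_distrib E0.scale_left_distrib)
          then show ?case
            using E.norm_triangle[of "smul A (w + 1) (q w - D)" "smul A (w - c) D"]
              sum_norm_nonneg[of "h w - h c"] m D hS c elim ostrip_subset_strip
            by (auto simp: E.norm_scale)
        qed
      qed
      then show ?thesis using True by simp
    qed
  qed
  have hol: "E.weak_hol ostrip h"
    unfolding E.weak_hol_def
  proof
    fix l assume l: "l \<in> E.dual"
    have lf: "(\<lambda>z. l (f z)) holomorphic_on ostrip" using F(3) l by (auto simp: E.weak_hol_def)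
    have "((\<lambda>z. l (f z)) has_field_derivative l D) (at c)"
      by (rule E.strong_diff_dual_derivative[OF open_ostrip c(1) _ l D(1)]) (use mem D(2) in auto)
    then have der: "deriv (\<lambda>z. l (f z)) c = l D" by (rule DERIV_imp_deriv)
    have "(\<lambda>z. (z + 1) * (if z = c then deriv (\<lambda>z. l (f z)) c else (l (f z) - l (f c)) / (z - c)))
        holomorphic_on ostrip"
      by (intro holomorphic_intros pole_lemma_open[OF lf open_ostrip])
    then show "(\<lambda>z. l (h z)) holomorphic_on ostrip"
    proof (rule holomorphic_transform)
      fix z assume "z \<in> ostrip"
      then show "(z + 1) * (if z = c then deriv (\<lambda>z. l (f z)) c else (l (f z) - l (f c)) / (z - c)) = l (h z)"
        using mem[of z] l D der by (simp add: h_def E.dual_scale fc E.dual_zero)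
    qed
  qed
  have bd_h: "h (bd j t) = smul A ((bd j t + 1) / (bd j t - c)) (f (bd j t))" if "j \<in> {0,1}" for j t
    using \<psi>_inverse_bound(2)[OF \<theta> that] by (simp add: h_def c_def)
  have "locF h"
    unfolding locF_def
  proof (intro conjI ballI cont hol hS)
    fix j :: nat assume j: "j \<in> {0,1}"
    interpret J: cnormed "smul A" "sp A j" "nm A j" by (rule cnormed_sp[OF j])
    show "\<forall>t. h (bd j t) \<in> sp A j" unfolding bd_h[OF j] using F(4)[OF j] by auto
    have "continuous_on UNIV (\<lambda>t. (bd j t + 1) / (bd j t - c))"
      using \<psi>_inverse_bound(2)[OF \<theta> j] unfolding bd_def c_def by (intro continuous_intros) auto
    then show "J.cont_into UNIV (\<lambda>t. h (bd j t))"
      unfolding bd_h[OF j] using F(4,5)[OF j] by (intro J.cont_into_scale) auto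
  qed
  \<comment> \<open>Some finite bound is enough: continuity handles a ball around \<open>c\<close>,
    and outside it the factor has modulus at most \<open>1 + 2 / r\<close>.\<close>
  moreover obtain B where "\<And>z. z \<in> strip \<Longrightarrow> N (h z) \<le> B"
  proof -
    obtain r where r: "r > 0" "\<And>w. w \<in> ball c r \<Longrightarrow> w \<in> strip \<Longrightarrow> N (h w) \<le> N (h c) + 1"
      by (rule E.cont_into_bounded_near[OF cont c(2)]) (rule hS, assumption, rule that)
    have "N (h z) \<le> max (N (h c) + 1) ((1 + 2 / r) * M)" if z: "z \<in> strip" for z
    proof (cases "z \<in> ball c r")
      case True
      then show ?thesis using r(2)[OF True z] by simp
    next
      case False
      then have dr: "r \<le> cmod (z - c)" by (auto simp: dist_norm norm_minus_commute)
      then have zc: "z \<noteq> c" using r(1) by auto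
      have "cmod (z + 1) \<le> cmod (z - c) + cmod (c + 1)"
        using norm_triangle_ineq[of "z - c" "c + 1"] by simp
      moreover have "cmod (c + 1) \<le> 2"
        using \<theta> norm_of_real[of "\<theta> + 1", where ?'a = complex] by (simp add: c_def)
      ultimately have "cmod ((z + 1) / (z - c)) \<le> 1 + 2 / cmod (z - c)"
        using zc by (simp add: norm_divide field_simps)
      also have "\<dots> \<le> 1 + 2 / r" using dr r(1) by (simp add: frac_le)
      finally have "cmod ((z + 1) / (z - c)) * N (f z) \<le> (1 + 2 / r) * M"
        using Fb_sum_norm_le[OF f z] sum_norm_nonneg[OF F(1)[OF z]] r(1) by (intro mult_mono) auto
      then show ?thesis using zc F(1)[OF z] by (simp add: h_def E.norm_scale)
    qed
    then show thesis using that by blast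
  qed
  ultimately have "Fb A (quot_const \<theta> * M) h"
  proof (rule FbI)
    fix j :: nat and t assume j: "j \<in> {0,1}"
    interpret J: cnormed "smul A" "sp A j" "nm A j" by (rule cnormed_sp[OF j])
    show "nm A j (h (bd j t)) \<le> quot_const \<theta> * M"
      unfolding bd_h[OF j] J.norm_scale[OF F(4)[OF j]]
      using \<psi>_inverse_bound(1)[OF \<theta> j, of t] FbD(2)[OF f j, of t] J.norm_ge_zero[OF F(4)[OF j, of t]]
        order_trans[OF norm_ge_zero \<psi>_inverse_bound(1)[OF \<theta> j, of t]]
      by (intro mult_mono) (auto simp: c_def)
  qed
  then show thesis
  proof (rule that)
    show "f z = smul A (\<psi> \<theta> z) (h z)" if "z \<in> strip" for z
      using strip_plus_one(1)[OF that] fc by (auto simp: h_def \<psi>_def simp flip: c_def)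
  qed
qed

section \<open>Interpolation spaces and quotient norms in terms of \<open>Fb\<close>\<close>

lemma F_norm_le_iff:
  assumes "f \<in> calF A"
  shows "F_norm A f \<le> M \<longleftrightarrow> Fb A M f"
proof -
  obtain B where B: "Fb A B f" using calF_Fb[OF assms] by metis
  have "bdd_above (range (\<lambda>t. nm A 0 (f (\<i> * of_real t))))" "bdd_above (range (\<lambda>t. nm A 1 (f (1 + \<i> * of_real t))))"
    using FbD(2)[OF B, of 0] FbD(2)[OF B, of 1] by (auto simp: bd_def intro!: bdd_aboveI[of _ B])
  then show ?thesis
    using assms by (auto simp: F_norm_def Fb_def bd_def cSUP_le_iff)
qed

lemma F_norm_nonneg:
  assumes "f \<in> calF A"
  shows "0 \<le> F_norm A f"
proof -
  have "Fb A (F_norm A f) f" using F_norm_le_iff[OF assms] by blast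
  then have "nm A 0 (f (bd 0 0)) \<le> F_norm A f" by (rule FbD) simp
  moreover have "0 \<le> nm A 0 (f (bd 0 0))"
    using locF_props(4)[OF calF_locF[OF assms], of 0] by (intro E0.norm_ge_zero) auto
  ultimately show ?thesis by linarith
qed

lemma interp_norm_le:
  assumes "Fb A M f"
  shows "interp_norm A \<theta> (f (of_real \<theta>)) \<le> M"
proof -
  have "interp_norm A \<theta> (f (of_real \<theta>)) \<le> F_norm A f"
    unfolding interp_norm_def
    by (rule cInf_lower) (use FbD(1)[OF assms] F_norm_nonneg in \<open>auto intro!: bdd_belowI[of _ 0]\<close>)
  also have "\<dots> \<le> M" using F_norm_le_iff FbD(1) assms by blast
  finally show ?thesis .
qed

lemma interp_norm_less:
  assumes "x \<in> interp_space A \<theta>" "interp_norm A \<theta> x < M"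
  obtains f where "Fb A M f" "f (of_real \<theta>) = x"
proof -
  have ne: "{F_norm A f | f. f \<in> calF A \<and> f (of_real \<theta>) = x} \<noteq> {}"
    using assms(1) by (auto simp: interp_space_def)
  obtain f where "f \<in> calF A" "f (of_real \<theta>) = x" "F_norm A f < M"
    using cInf_lessD[OF ne assms(2)[unfolded interp_norm_def]] by auto
  then show thesis using F_norm_le_iff[of f M] by (intro that[of f]) auto
qed

lemma interp_spaceI: "Fb A M f \<Longrightarrow> f (of_real \<theta>) \<in> interp_space A \<theta>"
  using FbD(1) by (auto simp: interp_space_def)

lemma interp_spaceE:
  assumes "x \<in> interp_space A \<theta>"
  obtains M f where "M > 0" "Fb A M f" "f (of_real \<theta>) = x"
  using assms calF_Fb unfolding interp_space_def by blast

lemma interp_space_diff: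
  assumes "x \<in> interp_space A \<theta>" "y \<in> interp_space A \<theta>"
  shows "x - y \<in> interp_space A \<theta>"
proof -
  obtain M f M' g where "Fb A M f" "f (of_real \<theta>) = x" "Fb A M' g" "g (of_real \<theta>) = y"
    using assms by (meson interp_spaceE)
  then show ?thesis using interp_spaceI[OF Fb_diff[of M f M' g], of \<theta>] by simp
qed

lemma interp_space_sumspace:
  assumes "x \<in> interp_space A \<theta>" "0 < \<theta>" "\<theta> < 1"
  shows "x \<in> S"
proof -
  have "of_real \<theta> \<in> strip" using assms by (simp add: strip_def)
  with assms(1) show ?thesis using locF_props(1)[OF calF_locF] by (auto simp: interp_space_def)
qed

end

lemma \<psi>_continuous: "continuous_on strip (\<psi> \<theta>)"
  unfolding \<psi>_def using strip_plus_one by (intro continuous_intros) auto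

lemma \<psi>_holomorphic: "\<psi> \<theta> holomorphic_on ostrip"
  unfolding \<psi>_def using strip_plus_one ostrip_subset_strip by (intro holomorphic_intros) auto

lemma of_real_strip: "0 < s \<Longrightarrow> s < 1 \<Longrightarrow> complex_of_real s \<in> strip"
  by (simp add: strip_def)

lemma (in couple) Fb_limit:
  assumes f: "f \<in> calF A" and F: "\<And>k. Fb A M (F k)" and lim: "\<And>e. e > 0 \<Longrightarrow> \<exists>k. Fb A e (\<lambda>z. F k z - f z)"
  shows "Fb A M f"
  unfolding Fb_def
proof (intro conjI ballI allI f)
  fix j :: nat and t assume j: "j \<in> {0,1}"
  interpret J: cnormed "smul A" "sp A j" "nm A j" by (rule cnormed_sp[OF j])
  show "nm A j (f (bd j t)) \<le> M"
  proof (rule field_le_epsilon)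
    fix e :: real assume "e > 0"
    then obtain k where k: "Fb A e (\<lambda>z. F k z - f z)" using lim by blast
    have m: "f (bd j t) \<in> sp A j" "F k (bd j t) \<in> sp A j"
      using locF_props(4)[OF calF_locF[OF f] j] locF_props(4)[OF calF_locF[OF FbD(1)[OF F]] j] by auto
    then show "nm A j (f (bd j t)) \<le> M + e"
      using J.norm_le_via[of "f (bd j t)" "F k (bd j t)"] J.norm_diff_commute[of "f (bd j t)" "F k (bd j t)"]
        FbD(2)[OF k j, of t] FbD(2)[OF F j, of k t] by simp
  qed
qed

section \<open>Operators of couples\<close>

locale couple_map = X: couple X + Y: couple Y
  for X :: "'a::ab_group_add couple" and Y :: "'b::ab_group_add couple" +
  fixes T :: "'a \<Rightarrow> 'b"
  assumes op: "couple_operator X Y T"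
begin

lemma T_add: "x \<in> X.S \<Longrightarrow> y \<in> X.S \<Longrightarrow> T (x + y) = T x + T y"
  and T_scale: "x \<in> X.S \<Longrightarrow> T (smul X c x) = smul Y c (T x)"
  and T_sp: "j \<in> {0,1} \<Longrightarrow> x \<in> sp X j \<Longrightarrow> T x \<in> sp Y j"
  using op unfolding couple_operator_def by blast+

lemma T_zero: "T 0 = 0"
  using T_add[of 0 0] by simp

lemma T_diff: "x \<in> X.S \<Longrightarrow> y \<in> X.S \<Longrightarrow> T (x - y) = T x - T y"
  using T_add[of "x - y" y] by simp

text \<open>One positive constant for both edges; positivity permits division by it, for instance
  when functionals are pulled back along \<open>T\<close>.\<close>

definition op_const :: real where
  "op_const = (SOME C. C > 0 \<and> (\<forall>j\<in>{0,1}. \<forall>x\<in>sp X j. nm Y j (T x) \<le> C * nm X j x))"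

lemma op_const: "op_const > 0" "j \<in> {0,1} \<Longrightarrow> x \<in> sp X j \<Longrightarrow> nm Y j (T x) \<le> op_const * nm X j x"
proof -
  obtain C0 C1 where C: "\<forall>x\<in>sp X 0. nm Y 0 (T x) \<le> C0 * nm X 0 x" "\<forall>x\<in>sp X 1. nm Y 1 (T x) \<le> C1 * nm X 1 x"
    using op unfolding couple_operator_def by auto
  define C where "C = max 1 (max C0 C1)"
  have "nm Y j (T x) \<le> C * nm X j x" if j: "j \<in> {0,1}" and x: "x \<in> sp X j" for j x
  proof -
    consider "j = 0" | "j = 1" using j by auto
    then show ?thesis
    proof cases
      case 1
      have "C0 * nm X 0 x \<le> C * nm X 0 x"
        using X.E0.norm_ge_zero x 1 by (intro mult_right_mono) (auto simp: C_def)
      then show ?thesis using C(1) x 1 by force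
    next
      case 2
      have "C1 * nm X 1 x \<le> C * nm X 1 x"
        using X.E1.norm_ge_zero x 2 by (intro mult_right_mono) (auto simp: C_def)
      then show ?thesis using C(2) x 2 by force
    qed
  qed
  then have "C > 0 \<and> (\<forall>j\<in>{0,1}. \<forall>x\<in>sp X j. nm Y j (T x) \<le> C * nm X j x)" by (auto simp: C_def)
  from someI[of "\<lambda>C. C > 0 \<and> (\<forall>j\<in>{0,1}. \<forall>x\<in>sp X j. nm Y j (T x) \<le> C * nm X j x)", OF this]
  show "op_const > 0" "j \<in> {0,1} \<Longrightarrow> x \<in> sp X j \<Longrightarrow> nm Y j (T x) \<le> op_const * nm X j x"
    unfolding op_const_def by blast+
qed

lemma T_S: "x \<in> X.S \<Longrightarrow> T x \<in> Y.S"
proof (elim X.sumspaceE)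
  fix a b assume "a \<in> sp X 0" "b \<in> sp X 1" "x = a + b"
  moreover from this have "a \<in> X.S" "b \<in> X.S"
    using X.sp_subset_sumspace[of 0] X.sp_subset_sumspace[of 1] by auto
  ultimately show "T x \<in> Y.S"
    using T_add[of a b] T_sp[of 0 a] T_sp[of 1 b] Y.sumspaceI[of "T a" "T b"] by auto
qed

lemma T_N:
  assumes "x \<in> X.S"
  shows "Y.N (T x) \<le> op_const * X.N x"
proof (rule field_le_epsilon)
  fix e :: real assume e: "e > 0"
  then have "X.N x < X.N x + e / op_const" using op_const(1) by simp
  from X.sum_norm_split[OF assms this] obtain a b where ab: "a \<in> sp X 0" "b \<in> sp X 1" "x = a + b"
    "nm X 0 a + nm X 1 b < X.N x + e / op_const" .
  have "a \<in> X.S" "b \<in> X.S"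
    using X.sp_subset_sumspace[of 0] X.sp_subset_sumspace[of 1] ab by auto
  then have "T x = T a + T b" using T_add ab by simp
  then have "Y.N (T x) \<le> nm Y 0 (T a) + nm Y 1 (T b)"
    using Y.sum_norm_le[of "T a" "T b"] T_sp[of 0 a] T_sp[of 1 b] ab by auto
  also have "\<dots> \<le> op_const * (nm X 0 a + nm X 1 b)"
    using op_const(2)[of 0 a] op_const(2)[of 1 b] ab by (auto simp: distrib_left)
  also have "\<dots> \<le> op_const * (X.N x + e / op_const)" using ab op_const(1) by (intro mult_left_mono) auto
  also have "\<dots> = op_const * X.N x + e" using op_const(1) by (simp add: field_simps)
  finally show "Y.N (T x) \<le> op_const * X.N x + e" .
qed

lemma T_cont_into:
  assumes j: "j \<in> {0,1}" and f: "cnormed.cont_into (nm X j) UNIV f" "\<And>t::real. f t \<in> sp X j"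
  shows "cnormed.cont_into (nm Y j) UNIV (\<lambda>t. T (f t))"
proof -
  interpret J: cnormed "smul X" "sp X j" "nm X j" by (rule X.cnormed_sp[OF j])
  interpret K: cnormed "smul Y" "sp Y j" "nm Y j" by (rule Y.cnormed_sp[OF j])
  show ?thesis
  proof (rule K.cont_intoI)
    fix t
    show "((\<lambda>s. nm Y j (T (f s) - T (f t))) \<longlongrightarrow> 0) (at t within UNIV)"
    proof (rule Lim_null_comparison)
      show "((\<lambda>s. op_const * nm X j (f s - f t)) \<longlongrightarrow> 0) (at t within UNIV)"
        using tendsto_mult_right_zero[OF J.cont_into_tendsto[OF f(1), of t]] f(2) by simp
      have "norm (nm Y j (T (f s) - T (f t))) \<le> op_const * nm X j (f s - f t)" for s
      proof -
        have "f s \<in> X.S" "f t \<in> X.S" using f(2) X.sp_subset_sumspace[OF j] by auto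
        then show ?thesis
          using op_const(2)[OF j, of "f s - f t"] T_diff[of "f s" "f t"] f(2)
            K.norm_ge_zero[of "T (f s) - T (f t)"] T_sp[OF j] by auto
      qed
      then show "\<forall>\<^sub>F s in at t within UNIV. norm (nm Y j (T (f s) - T (f t))) \<le> op_const * nm X j (f s - f t)" by simp
    qed
  qed
qed

lemma Fb_T:
  assumes f: "Fb X M f"
  shows "Fb Y (op_const * M) (\<lambda>z. T (f z))"
proof -
  note F = X.locF_props[OF X.calF_locF[OF FbD(1)[OF f]]]
  show ?thesis
  proof (rule Y.FbI)
    show "Y.locF (\<lambda>z. T (f z))"
      unfolding Y.locF_def
    proof (intro conjI ballI)
      show "T (f z) \<in> Y.S" if "z \<in> strip" for z using F(1) that T_S by auto
      show "Y.E.cont_into strip (\<lambda>z. T (f z))"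
      proof (rule Y.E.cont_intoI)
        fix z assume z: "z \<in> strip"
        show "((\<lambda>w. Y.N (T (f w) - T (f z))) \<longlongrightarrow> 0) (at z within strip)"
        proof (rule Lim_null_comparison)
          show "((\<lambda>w. op_const * X.N (f w - f z)) \<longlongrightarrow> 0) (at z within strip)"
            by (rule tendsto_mult_right_zero[OF X.E.cont_into_tendsto[OF F(2) z F(1)]])
          have "norm (Y.N (T (f w) - T (f z))) \<le> op_const * X.N (f w - f z)" if "w \<in> strip" for w
            using T_N[of "f w - f z"] T_diff[of "f w" "f z"] F(1)[OF that] F(1)[OF z]
              Y.sum_norm_nonneg[of "T (f w) - T (f z)"] T_S by auto
          then show "\<forall>\<^sub>F w in at z within strip. norm (Y.N (T (f w) - T (f z))) \<le> op_const * X.N (f w - f z)"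
            by (auto simp: eventually_at_filter)
        qed
      qed
      show "Y.E.weak_hol ostrip (\<lambda>z. T (f z))"
        unfolding Y.E.weak_hol_def
      proof
        fix l assume l: "l \<in> Y.E.dual"
        \<comment> \<open>The pullback of \<open>l\<close> has norm at most \<open>op_const\<close>;
          dividing brings it into the unit ball that \<open>dual\<close> denotes.\<close>
        have "(\<lambda>x. l (T x) / op_const) \<in> X.E.dual"
        proof -
          have "cmod (l (T x) / op_const) \<le> X.N x" if "x \<in> X.S" for x
            using Y.E.dual_bound[OF l T_S[OF that]] T_N[OF that] op_const(1)
            by (simp add: norm_divide divide_le_eq mult.commute)
          then show ?thesis
            using l T_add T_scale T_S
            by (auto simp: X.E.dual_def Y.E.dual_add Y.E.dual_scale add_divide_distrib)
        qed
        then have "(\<lambda>z. l (T (f z)) / op_const) holomorphic_on ostrip"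
          using F(3) unfolding X.E.weak_hol_def by (rule bspec[rotated])
        from holomorphic_on_mult[OF holomorphic_on_const[of "of_real op_const"] this]
        show "(\<lambda>z. l (T (f z))) holomorphic_on ostrip" using op_const(1) by simp
      qed
      fix j :: nat assume j: "j \<in> {0,1}"
      show "\<forall>t. T (f (bd j t)) \<in> sp Y j" using F(4)[OF j] T_sp[OF j] by auto
      show "cnormed.cont_into (nm Y j) UNIV (\<lambda>t. T (f (bd j t)))"
        by (rule T_cont_into[OF j F(5)[OF j] F(4)[OF j]])
    qed
    show "Y.N (T (f z)) \<le> op_const * M" if "z \<in> strip" for z
      using T_N[OF F(1)[OF that]] mult_left_mono[OF X.Fb_sum_norm_le[OF f that], of op_const] op_const(1) by linarith
    show "nm Y j (T (f (bd j t))) \<le> op_const * M" if j: "j \<in> {0,1}" for j t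
      using op_const(2)[OF j F(4)[OF j], of t] mult_left_mono[OF FbD(2)[OF f j, of t], of op_const] op_const(1) by linarith
  qed
qed

text \<open>\<open>T\<^sub>\<theta>\<close> is bijective with an inverse of norm at most \<open>K\<close>, up to attainment of the quotient norms.\<close>

definition inv_at :: "real \<Rightarrow> real \<Rightarrow> bool" where
  "inv_at \<theta> K \<longleftrightarrow> (\<forall>M>0. \<forall>g. Fb Y M g \<longrightarrow> (\<exists>f. Fb X (K * M) f \<and> T (f (of_real \<theta>)) = g (of_real \<theta>))) \<and>
     (\<forall>f\<in>calF X. T (f (of_real \<theta>)) = 0 \<longrightarrow> f (of_real \<theta>) = 0)"

lemma inv_at_surj:
  assumes "inv_at \<theta> K" "M > 0" "Fb Y M g"
  obtains f where "Fb X (K * M) f" "T (f (of_real \<theta>)) = g (of_real \<theta>)"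
  using assms unfolding inv_at_def by blast

lemma inv_at_inj:
  assumes "inv_at \<theta> K" "0 < \<theta>" "\<theta> < 1" "x \<in> interp_space X \<theta>" "y \<in> interp_space X \<theta>" "T x = T y"
  shows "x = y"
proof -
  obtain f where f: "f \<in> calF X" "x - y = f (of_real \<theta>)"
    using X.interp_space_diff[OF assms(4,5)] by (auto simp: interp_space_def)
  have "T (x - y) = 0"
    using assms X.interp_space_sumspace by (simp add: T_diff)
  then have "x - y = 0" using f assms(1) unfolding inv_at_def by metis
  then show ?thesis by simp
qed

lemma interp_invertible_iff:
  assumes \<theta>: "0 < \<theta>" "\<theta> < 1"
  shows "interp_invertible X Y T \<theta> \<longleftrightarrow> (\<exists>K>0. inv_at \<theta> K)"
proof
  assume inv: "interp_invertible X Y T \<theta>"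
  then have bij: "bij_betw T (interp_space X \<theta>) (interp_space Y \<theta>)" by (simp add: interp_invertible_def)
  obtain C where C: "\<forall>y\<in>interp_space Y \<theta>.
      interp_norm X \<theta> (the_inv_into (interp_space X \<theta>) T y) \<le> C * interp_norm Y \<theta> y"
    using inv by (auto simp: interp_invertible_def)
  \<comment> \<open>The constant \<open>C\<close> may be negative, and the infimum defining the
    quotient norm need not be attained. The summand \<open>1\<close> provides the strict inequality
    from which a representing function with the required bound is obtained.\<close>
  have "inv_at \<theta> (\<bar>C\<bar> + 1)"
    unfolding inv_at_def
  proof (intro conjI allI impI ballI)
    fix M :: real and g assume M: "M > 0" and g: "Fb Y M g"
    define y where "y = g (of_real \<theta>)"
    define x where "x = the_inv_into (interp_space X \<theta>) T y"
    have y: "y \<in> interp_space Y \<theta>" using Y.interp_spaceI[OF g] by (simp add: y_def)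
    have x: "x \<in> interp_space X \<theta>" "T x = y"
      using bij y the_inv_into_into[of T "interp_space X \<theta>" y] f_the_inv_into_f[of T "interp_space X \<theta>" y]
      by (auto simp: bij_betw_def x_def)
    have yM: "interp_norm Y \<theta> y \<le> M" unfolding y_def by (rule Y.interp_norm_le[OF g])
    have "interp_norm Y \<theta> y \<ge> 0"
      unfolding interp_norm_def using y Y.F_norm_nonneg by (intro cInf_greatest) (auto simp: interp_space_def)
    then have "C * interp_norm Y \<theta> y \<le> \<bar>C\<bar> * M" using yM by (intro mult_mono) auto
    then have "interp_norm X \<theta> x < (\<bar>C\<bar> + 1) * M"
      using C y M unfolding x_def by (force simp: distrib_right)
    from X.interp_norm_less[OF x(1) this] obtain f where "Fb X ((\<bar>C\<bar> + 1) * M) f" "f (of_real \<theta>) = x" .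
    then show "\<exists>f. Fb X ((\<bar>C\<bar> + 1) * M) f \<and> T (f (of_real \<theta>)) = g (of_real \<theta>)"
      using x(2) by (auto simp: y_def)
  next
    fix f assume f: "f \<in> calF X" "T (f (of_real \<theta>)) = 0"
    have "f (of_real \<theta>) \<in> interp_space X \<theta>" "0 \<in> interp_space X \<theta>"
      using f(1) FbD(1)[OF X.Fb_zero] by (auto simp: interp_space_def)
    then show "f (of_real \<theta>) = 0"
      using bij f(2) T_zero unfolding bij_betw_def inj_on_def by metis
  qed
  then show "\<exists>K>0. inv_at \<theta> K" by (intro exI[of _ "\<bar>C\<bar> + 1"]) auto
next
  assume "\<exists>K>0. inv_at \<theta> K"
  then obtain K where K: "K > 0" "inv_at \<theta> K" by blast
  have inj: "inj_on T (interp_space X \<theta>)"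
    using inv_at_inj[OF K(2) \<theta>] by (auto simp: inj_on_def)
  have "T ` interp_space X \<theta> = interp_space Y \<theta>"
  proof (intro equalityI subsetI)
    fix y assume "y \<in> T ` interp_space X \<theta>"
    then obtain x where x: "x \<in> interp_space X \<theta>" "y = T x" by auto
    then obtain M f where f: "Fb X M f" "f (of_real \<theta>) = x" by (meson X.interp_spaceE)
    then show "y \<in> interp_space Y \<theta>" using Y.interp_spaceI[OF Fb_T[OF f(1)], of \<theta>] x by simp
  next
    fix y assume "y \<in> interp_space Y \<theta>"
    then obtain M g where g: "M > 0" "Fb Y M g" "g (of_real \<theta>) = y" by (meson Y.interp_spaceE)
    from inv_at_surj[OF K(2) g(1,2)] obtain f where f: "Fb X (K * M) f" "T (f (of_real \<theta>)) = g (of_real \<theta>)" .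
    then show "y \<in> T ` interp_space X \<theta>" using X.interp_spaceI[OF f(1), of \<theta>] g(3) by force
  qed
  with inj have bij: "bij_betw T (interp_space X \<theta>) (interp_space Y \<theta>)" by (simp add: bij_betw_def)
  have "interp_norm X \<theta> (the_inv_into (interp_space X \<theta>) T y) \<le> K * interp_norm Y \<theta> y"
    if y: "y \<in> interp_space Y \<theta>" for y
  proof -
    have nn: "interp_norm Y \<theta> y \<ge> 0"
      unfolding interp_norm_def using y Y.F_norm_nonneg by (intro cInf_greatest) (auto simp: interp_space_def)
    have "interp_norm X \<theta> (the_inv_into (interp_space X \<theta>) T y) / K \<le> interp_norm Y \<theta> y"
    proof (rule field_le_epsilon)
      fix e :: real assume e: "e > 0"
      define M where "M = interp_norm Y \<theta> y + e"
      have "interp_norm Y \<theta> y < M" "M > 0" using nn e by (auto simp: M_def)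
      from Y.interp_norm_less[OF y this(1)] obtain g where g: "Fb Y M g" "g (of_real \<theta>) = y" .
      from inv_at_surj[OF K(2) \<open>M > 0\<close> g(1)] obtain f where
        f: "Fb X (K * M) f" "T (f (of_real \<theta>)) = g (of_real \<theta>)" .
      have "the_inv_into (interp_space X \<theta>) T y = f (of_real \<theta>)"
        using the_inv_into_f_f[OF inj X.interp_spaceI[OF f(1), of \<theta>]] f(2) g(2) by simp
      then have "interp_norm X \<theta> (the_inv_into (interp_space X \<theta>) T y) \<le> K * M"
        using X.interp_norm_le[OF f(1)] by simp
      then show "interp_norm X \<theta> (the_inv_into (interp_space X \<theta>) T y) / K \<le> interp_norm Y \<theta> y + e"
        using K(1) by (simp add: M_def field_simps)
    qed
    then show ?thesis using K(1) by (simp add: field_simps)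
  qed
  with bij show "interp_invertible X Y T \<theta>" unfolding interp_invertible_def by blast
qed

text \<open>One step of the iteration: solving exactly at \<open>s\<close> leaves the residual
  \<open>g - T f\<close>, which vanishes at \<open>s\<close> and has bound
  \<open>M + op_const * K * M\<close>, so it can be divided by \<open>\<psi> s\<close> at the cost
  \<open>quot_const s\<close>.\<close>

lemma solve_step:
  assumes s: "0 < s" "s < 1" and K: "K > 0" "inv_at s K" and g: "M > 0" "Fb Y M g"
  obtains f g' where "Fb X (K * M) f" "Fb Y (quot_const s * (1 + op_const * K) * M) g'"
    "\<And>z. z \<in> strip \<Longrightarrow> g z = T (f z) + smul Y (\<psi> s z) (g' z)"
proof -
  from inv_at_surj[OF K(2) g] obtain f where f: "Fb X (K * M) f" "T (f (of_real s)) = g (of_real s)" .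
  have "Fb Y (M + op_const * (K * M)) (\<lambda>z. g z - T (f z))" using Y.Fb_diff[OF g(2) Fb_T[OF f(1)]] .
  moreover have "g (of_real s) - T (f (of_real s)) = 0" using f(2) by simp
  ultimately obtain g' where g': "Fb Y (quot_const s * (M + op_const * (K * M))) g'"
    "\<And>z. z \<in> strip \<Longrightarrow> g z - T (f z) = smul Y (\<psi> s z) (g' z)"
    using Y.Fb_quotient[OF _ s] by (metis (no_types, lifting))
  have "quot_const s * (M + op_const * (K * M)) = quot_const s * (1 + op_const * K) * M" by (simp add: algebra_simps)
  then show thesis using g' f(1) by (intro that[of f g']) (auto simp: algebra_simps)
qed

end

section \<open>Openness of invertibility\<close>

context couple_map
begin

text \<open>Repeating \<open>solve_step\<close> expands \<open>g\<close> in powers of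
  \<open>\<psi> s\<close> with coefficients \<open>T (f k)\<close>, whose bounds grow like
  \<open>L ^ k\<close>. At \<open>s'\<close> the factor \<open>\<psi> s\<close> is at most
  \<open>\<bar>s' - s\<bar>\<close>, so under the smallness condition the bounds on the terms halve
  from one to the next; the geometric series accounts for \<open>2 * K\<close>.\<close>

lemma inv_at_surj_near:
  assumes s: "0 < s" "s < 1" and K: "K > 0" "inv_at s K" and s': "0 < s'" "s' < 1"
    and small: "\<bar>s' - s\<bar> * (quot_const s * (1 + op_const * K)) \<le> 1/2" and M: "M > 0" and g: "Fb Y M g"
  shows "\<exists>f. Fb X (2 * K * M) f \<and> T (f (of_real s')) = g (of_real s')"
proof -
  define L where "L = quot_const s * (1 + op_const * K)"
  have L: "L > 0" using s K(1) op_const(1) by (simp add: L_def quot_const_def add_pos_pos)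
  define c where "c = complex_of_real s'"
  have c: "c \<in> strip" using s' by (simp add: c_def strip_def)
  define \<epsilon> where "\<epsilon> = \<psi> s c"
  have "cmod \<epsilon> \<le> \<bar>s' - s\<bar>"
    using \<psi>_le_diff[OF c, of s] norm_of_real[of "s' - s", where ?'a = complex] by (simp add: \<epsilon>_def c_def)
  then have "cmod \<epsilon> * L \<le> \<bar>s' - s\<bar> * L" using L by (intro mult_right_mono) auto
  then have \<epsilon>: "cmod \<epsilon> * L \<le> 1/2" using small by (simp add: L_def)
  have pow: "cmod (\<epsilon> ^ k) * L ^ k \<le> (1/2) ^ k" for k
    using power_mono[OF \<epsilon>, of k] L by (simp add: norm_power power_mult_distrib)
  have "\<exists>G. \<forall>k. Fb Y (M * L ^ k) (G k) \<and> (k = 0 \<longrightarrow> G k = g) \<and>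
      (\<exists>f. Fb X (K * (M * L ^ k)) f \<and> (\<forall>z\<in>strip. G k z = T (f z) + smul Y (\<psi> s z) (G (Suc k) z)))"
  proof -
    have "\<exists>G. \<forall>k. (Fb Y (M * L ^ k) (G k) \<and> (k = 0 \<longrightarrow> G k = g)) \<and>
      (\<exists>f. Fb X (K * (M * L ^ k)) f \<and> (\<forall>z\<in>strip. G k z = T (f z) + smul Y (\<psi> s z) (G (Suc k) z)))"
    proof (rule dependent_nat_choice)
      show "\<exists>x. Fb Y (M * L ^ 0) x \<and> (0 = 0 \<longrightarrow> x = g)" using g by auto
      fix x :: "complex \<Rightarrow> 'b" and k
      assume x: "Fb Y (M * L ^ k) x \<and> (k = 0 \<longrightarrow> x = g)"
      have Mk: "M * L ^ k > 0" using M L by simp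
      obtain f g' where "Fb X (K * (M * L ^ k)) f" "Fb Y (quot_const s * (1 + op_const * K) * (M * L ^ k)) g'"
        "\<And>z. z \<in> strip \<Longrightarrow> x z = T (f z) + smul Y (\<psi> s z) (g' z)"
        using solve_step[OF s K Mk] x by metis
      moreover have "quot_const s * (1 + op_const * K) * (M * L ^ k) = M * L ^ Suc k" by (simp add: L_def mult_ac)
      ultimately show "\<exists>y. (Fb Y (M * L ^ Suc k) y \<and> (Suc k = 0 \<longrightarrow> y = g)) \<and>
          (\<exists>f. Fb X (K * (M * L ^ k)) f \<and> (\<forall>z\<in>strip. x z = T (f z) + smul Y (\<psi> s z) (y z)))"
        by auto
    qed
    then show ?thesis by auto
  qed
  then obtain G where G: "\<And>k. Fb Y (M * L ^ k) (G k)" "G 0 = g"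
    "\<And>k. \<exists>f. Fb X (K * (M * L ^ k)) f \<and> (\<forall>z\<in>strip. G k z = T (f z) + smul Y (\<psi> s z) (G (Suc k) z))"
    by blast
  from G(3) obtain f where f: "\<And>k. Fb X (K * (M * L ^ k)) (f k)"
    "\<And>k z. z \<in> strip \<Longrightarrow> G k z = T (f k z) + smul Y (\<psi> s z) (G (Suc k) z)" by metis
  \<comment> \<open>The powers are those of the number \<open>\<epsilon> = \<psi> s c\<close>, not
    of the function \<open>\<psi> s z\<close>: on the edges \<open>\<psi> s z\<close> is bounded by
    \<open>1\<close> but not small. Since only the value at \<open>c\<close> has to be right,
    constant coefficients do, and they make the partial sums converge in
    \<open>calF\<close>.\<close>
  define P where "P m z = (\<Sum>k<m. smul X (\<epsilon> ^ k) (f k z))" for m z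
  have summand: "Fb X (K * M * (1/2) ^ k) (\<lambda>z. smul X (\<epsilon> ^ k) (f k z))" for k
  proof (rule X.Fb_mono[OF X.Fb_scale_const[OF f(1)]])
    show "cmod (\<epsilon> ^ k) * (K * (M * L ^ k)) \<le> K * M * (1/2) ^ k"
      using mult_left_mono[OF pow[of k], of "K * M"] K(1) M by (simp add: mult_ac)
  qed
  have geom: "(\<Sum>k=a..<b. K * M * (1/2) ^ k) \<le> 2 * K * M * (1/2) ^ a" if "a \<le> b" for a b
  proof -
    have "(\<Sum>k=a..<b. (1/2::real) ^ k) = 2 * ((1/2) ^ a - (1/2) ^ b)"
      using that by (induction b rule: dec_induct) (auto simp: algebra_simps)
    then have "(\<Sum>k=a..<b. (1/2::real) ^ k) \<le> 2 * (1/2) ^ a" by simp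
    then have "K * M * (\<Sum>k=a..<b. (1/2::real) ^ k) \<le> K * M * (2 * (1/2) ^ a)"
      using K(1) M by (intro mult_left_mono) auto
    then show ?thesis by (simp add: sum_distrib_left mult_ac)
  qed
  have diffP: "Fb X (2 * K * M * (1/2) ^ a) (\<lambda>z. P b z - P a z)" if "a \<le> b" for a b
  proof -
    have "(\<lambda>z. P b z - P a z) = (\<lambda>z. \<Sum>k=a..<b. smul X (\<epsilon> ^ k) (f k z))"
      using that by (auto simp: P_def lessThan_atLeast0 sum_diff_nat_ivl)
    then show ?thesis
      using X.Fb_mono[OF X.Fb_sum[of "{a..<b}", OF summand] geom[OF that]] by simp
  qed
  have P0: "P 0 = (\<lambda>z. 0)" by (auto simp: P_def)
  have PFb: "Fb X (2 * K * M) (P m)" for m using diffP[of 0 m] by (simp add: P0)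
  have small': "\<exists>k0. \<forall>k\<ge>k0. B * (1/2) ^ k < e" if "e > 0" for e B :: real
  proof -
    have "(\<lambda>k. (1/2::real) ^ k) \<longlonglongrightarrow> 0" by (intro LIMSEQ_realpow_zero) auto
    from tendsto_mult_right_zero[OF this, of B] have "\<forall>\<^sub>F k in sequentially. B * (1/2) ^ k < e"
      using that by (rule order_tendstoD)
    then show ?thesis by (simp add: eventually_sequentially)
  qed
  obtain u where u: "u \<in> calF X" "\<And>e. e > 0 \<Longrightarrow> \<exists>k0. \<forall>k\<ge>k0. Fb X e (\<lambda>z. P k z - u z)"
  proof (rule X.Fb_cauchy_limit[of P])
    show "P k \<in> calF X" for k using FbD(1)[OF PFb] .
    show "\<exists>K. \<forall>m\<ge>K. \<forall>k\<ge>K. Fb X e (\<lambda>z. P m z - P k z)" if "e > 0" for e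
    proof -
      obtain k0 where k0: "\<forall>k\<ge>k0. 2 * K * M * (1/2) ^ k < e" using small'[OF \<open>e > 0\<close>] by blast
      have "Fb X e (\<lambda>z. P m z - P k z)" if "m \<ge> k0" "k \<ge> k0" for m k
      proof (cases "k \<le> m")
        case True
        then show ?thesis using X.Fb_mono[OF diffP[OF True]] k0 that by force
      next
        case False
        then have "Fb X e (\<lambda>z. P k z - P m z)" using X.Fb_mono[OF diffP[of m k]] k0 that by force
        from X.Fb_scale_const[OF this, of "-1"] show ?thesis by (simp add: X.E0.scale_minus_left)
      qed
      then show ?thesis by blast
    qed
  qed (use that in blast)
  have uFb: "Fb X (2 * K * M) u"
  proof (rule X.Fb_limit[OF u(1), of _ P])
    show "\<exists>k. Fb X e (\<lambda>z. P k z - u z)" if "e > 0" for e using u(2)[OF that] by blast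
  qed (rule PFb)
  have uS: "u c \<in> X.S" "\<And>k. f k c \<in> X.S" "\<And>k. P k c \<in> X.S" "\<And>k. G k c \<in> Y.S"
    using c X.locF_props(1)[OF X.calF_locF] Y.locF_props(1)[OF Y.calF_locF] FbD(1)[OF f(1)] FbD(1)[OF PFb]
      FbD(1)[OF G(1)] u(1) by auto
  have TP: "T (P m c) = g c - smul Y (\<epsilon> ^ m) (G m c)" for m
  proof (induction m)
    case 0
    then show ?case by (simp add: P_def T_zero G(2))
  next
    case (Suc m)
    have "T (P (Suc m) c) = T (P m c) + smul Y (\<epsilon> ^ m) (T (f m c))"
      using uS T_add[of "P m c" "smul X (\<epsilon> ^ m) (f m c)"] T_scale by (simp add: P_def)
    also have "T (f m c) = G m c - smul Y \<epsilon> (G (Suc m) c)"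
      using f(2)[OF c, of m] by (simp add: \<epsilon>_def)
    finally show ?case using Suc by (simp add: Y.E0.scale_right_diff_distrib mult.commute)
  qed
  have "Y.N (T (u c) - g c) \<le> 0"
  proof (rule field_le_epsilon)
    fix e :: real assume e: "e > 0"
    have "e / (2 * op_const) > 0" using e op_const(1) by simp
    then obtain k0 where k0: "\<forall>k\<ge>k0. Fb X (e / (2 * op_const)) (\<lambda>z. P k z - u z)" using u(2) by blast
    obtain k1 where k1: "\<forall>k\<ge>k1. M * (1/2) ^ k < e / 2" using small'[of "e/2"] e by auto
    define k where "k = max k0 k1"
    have a: "X.N (P k c - u c) \<le> e / (2 * op_const)"
      using X.Fb_sum_norm_le[OF k0[rule_format, of k] c] by (simp add: k_def)
    have "Y.N (T (P k c) - T (u c)) \<le> e / 2"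
      using T_N[of "P k c - u c"] T_diff[of "P k c" "u c"] uS mult_left_mono[OF a, of op_const] op_const(1) by simp
    moreover have "Y.N (g c - T (P k c)) \<le> e / 2"
    proof -
      have "Y.N (smul Y (\<epsilon> ^ k) (G k c)) \<le> cmod (\<epsilon> ^ k) * (M * L ^ k)"
        using uS Y.Fb_sum_norm_le[OF G(1) c, of k] by (simp add: Y.E.norm_scale mult_left_mono)
      also have "\<dots> \<le> M * (1/2) ^ k" using mult_left_mono[OF pow[of k], of M] M by (simp add: mult_ac)
      also have "\<dots> < e / 2" using k1 by (simp add: k_def)
      finally show ?thesis by (simp add: TP)
    qed
    moreover have gS: "g c \<in> Y.S" using uS(4)[of 0] G(2) by simp
    ultimately show "Y.N (T (u c) - g c) \<le> 0 + e"
      using Y.E.norm_triangle_via[of "g c" "T (P k c)" "T (u c)"] Y.E.norm_diff_commute[of "T (u c)" "g c"] uS T_S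
      by auto
  qed
  moreover have "T (u c) - g c \<in> Y.S" using uS(1) uS(4)[of 0] G(2) T_S by auto
  ultimately have "T (u c) - g c = 0"
    using Y.sum_norm_nonneg[of "T (u c) - g c"] Y.E.norm_eq_zero[of "T (u c) - g c"] by auto
  then show ?thesis using uFb by (auto simp: c_def)
qed

text \<open>A representative of an element of the kernel can be replaced by one of half the norm.\<close>

lemma inv_at_inj_near:
  assumes s: "0 < s" "s < 1" and K: "K > 0" "inv_at s K" and s': "0 < s'" "s' < 1" "s' \<noteq> s"
    and small1: "\<bar>s' - s\<bar> * (K * (quot_const s' * op_const)) \<le> 1/4" and small2: "\<bar>s' - s\<bar> * quot_const s \<le> 1/5"
    and f: "f \<in> calF X" "T (f (of_real s')) = 0"
  shows "f (of_real s') = 0"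
proof -
  define x where "x = f (of_real s')"
  define d where "d = \<bar>s' - s\<bar>"
  have Tx0: "T x = 0" using f(2) by (simp add: x_def)
  have d: "d > 0" using s'(3) by (simp add: d_def)
  have quot_const: "quot_const s > 0" "quot_const s' > 0" using s s' by (auto simp: quot_const_def)
  have \<psi>1: "cmod (\<psi> s' (of_real s)) \<le> d" "cmod (\<psi> s (of_real s')) \<le> d"
    using \<psi>_le_diff[OF of_real_strip[OF s], of s'] \<psi>_le_diff[OF of_real_strip[OF s'(1,2)], of s]
      norm_of_real[of "s' - s", where ?'a = complex] norm_of_real[of "s - s'", where ?'a = complex]
    by (simp_all add: d_def abs_minus_commute)
  have half: "\<exists>f. Fb X (M / 2) f \<and> f (of_real s') = x" if M: "M > 0" and ex: "\<exists>f. Fb X M f \<and> f (of_real s') = x" for M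
  proof -
    obtain f where f: "Fb X M f" "f (of_real s') = x" using ex by blast
    have Tx: "T (f (of_real s')) = 0" using f(2) Tx0 by simp
    obtain h where
      h: "Fb Y (quot_const s' * (op_const * M)) h" "\<And>z. z \<in> strip \<Longrightarrow> T (f z) = smul Y (\<psi> s' z) (h z)"
      by (rule Y.Fb_quotient[OF Fb_T[OF f(1)] s'(1,2) Tx]) (rule that)
    have pos: "d * (quot_const s' * (op_const * M)) > 0" using d quot_const op_const(1) M by simp
    \<comment> \<open>The factor \<open>\<psi> s'\<close> is frozen at the point \<open>s\<close>.
      The result is a constant multiple of \<open>h\<close> of size proportional to \<open>d\<close>
      whose value at \<open>s\<close> is still \<open>T (f s)\<close>.\<close>
    have "Fb Y (d * (quot_const s' * (op_const * M))) (\<lambda>z. smul Y (\<psi> s' (of_real s)) (h z))"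
      using \<psi>1(1) quot_const op_const(1) M by (intro Y.Fb_mono[OF Y.Fb_scale_const[OF h(1)]] mult_right_mono) auto
    from inv_at_surj[OF K(2) pos this] obtain v where
      v: "Fb X (K * (d * (quot_const s' * (op_const * M)))) v" "T (v (of_real s)) = smul Y (\<psi> s' (of_real s)) (h (of_real s))" .
    have Kd: "K * (d * (quot_const s' * (op_const * M))) \<le> M / 4"
      using mult_right_mono[OF small1, of M] M by (simp add: d_def mult_ac)
    have v': "Fb X (M / 4) v" by (rule X.Fb_mono[OF v(1) Kd])
    have "T (v (of_real s)) = T (f (of_real s))" using v(2) h(2)[OF of_real_strip[OF s]] by simp
    then have "v (of_real s) = f (of_real s)"
      using inv_at_inj[OF K(2) s] X.interp_spaceI[OF v'] X.interp_spaceI[OF f(1)] by blast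
    then have "f (of_real s) - v (of_real s) = 0" by simp
    note q = X.Fb_quotient[OF X.Fb_diff[OF f(1) v'] s this]
    obtain k where k: "Fb X (quot_const s * (M + M / 4)) k" "\<And>z. z \<in> strip \<Longrightarrow> f z - v z = smul X (\<psi> s z) (k z)"
      by (rule q) (rule that)
    \<comment> \<open>Freezing \<open>\<psi> s\<close> at \<open>s'\<close> preserves the value at
      \<open>s'\<close> in the same way. With the factors \<open>1/4\<close> and \<open>1/5\<close>
      in the hypotheses, \<open>v\<close> contributes \<open>M / 4\<close> and this part one fifth
      of \<open>5 * M / 4\<close>, together \<open>M / 2\<close>.\<close>
    have "Fb X (d * (quot_const s * (M + M / 4))) (\<lambda>z. smul X (\<psi> s (of_real s')) (k z))"
      using \<psi>1(2) quot_const M by (intro X.Fb_mono[OF X.Fb_scale_const[OF k(1)]] mult_right_mono) auto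
    then have "Fb X (M / 4) (\<lambda>z. smul X (\<psi> s (of_real s')) (k z))"
    proof (rule X.Fb_mono)
      show "d * (quot_const s * (M + M / 4)) \<le> M / 4"
        using mult_right_mono[OF small2, of "M + M / 4"] M by (simp add: d_def mult_ac)
    qed
    from X.Fb_add[OF v' this] have "Fb X (M / 2) (\<lambda>z. v z + smul X (\<psi> s (of_real s')) (k z))" by simp
    moreover have "v (of_real s') + smul X (\<psi> s (of_real s')) (k (of_real s')) = x"
      using k(2)[OF of_real_strip[OF s'(1,2)]] f(2) by (simp add: algebra_simps)
    ultimately show ?thesis by (intro exI[of _ "\<lambda>z. v z + smul X (\<psi> s (of_real s')) (k z)"]) simp
  qed
  obtain M where M: "M > 0" "Fb X M f" using X.calF_Fb[OF f(1)] by blast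
  have ex: "\<exists>f. Fb X (M * (1/2) ^ k) f \<and> f (of_real s') = x" for k
  proof (induction k)
    case 0
    then show ?case using M by (auto simp: x_def)
  next
    case (Suc k)
    then show ?case using half[of "M * (1/2) ^ k"] M(1) by simp
  qed
  have le: "X.N x \<le> M * (1/2) ^ k" for k
    using ex[of k] X.Fb_sum_norm_le[OF _ of_real_strip[OF s'(1,2)]] by blast
  have "(\<lambda>k. M * (1/2::real) ^ k) \<longlonglongrightarrow> 0"
    by (intro tendsto_mult_right_zero LIMSEQ_realpow_zero) auto
  then have "X.N x \<le> 0" using le by (intro LIMSEQ_le_const) auto
  moreover have "x \<in> X.S"
    using X.locF_props(1)[OF X.calF_locF[OF f(1)] of_real_strip[OF s'(1,2)]] by (simp add: x_def)
  ultimately have "x = 0" using X.sum_norm_nonneg[of x] X.E.norm_eq_zero[of x] by auto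
  then show ?thesis by (simp add: x_def)
qed

text \<open>The three smallness conditions depend continuously on \<open>s'\<close> and their
  left-hand sides vanish at \<open>s\<close>. That \<open>2 * K\<close> is the same for all
  \<open>s'\<close> nearby is what later makes the remainder of local solutions uniform.\<close>

lemma inv_at_near:
  assumes s: "0 < s" "s < 1" and K: "K > 0" "inv_at s K"
  obtains d where "d > 0" "\<And>s'. \<bar>s' - s\<bar> < d \<Longrightarrow> 0 < s' \<and> s' < 1 \<and> inv_at s' (2 * K)"
proof -
  have t: "((\<lambda>s'. s') \<longlongrightarrow> s) (nhds s)" by (rule filterlim_ident)
  have "((\<lambda>s'. \<bar>s' - s\<bar> * (quot_const s * (1 + op_const * K))) \<longlongrightarrow> \<bar>s - s\<bar> * (quot_const s * (1 + op_const * K))) (nhds s)"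
    by (intro tendsto_intros t)
  then have e1: "\<forall>\<^sub>F s' in nhds s. \<bar>s' - s\<bar> * (quot_const s * (1 + op_const * K)) < 1/2"
    by (rule order_tendstoD) auto
  have "((\<lambda>s'. \<bar>s' - s\<bar> * (K * (quot_const s' * op_const))) \<longlongrightarrow> \<bar>s - s\<bar> * (K * (quot_const s * op_const))) (nhds s)"
    unfolding quot_const_def using s by (intro tendsto_intros t) auto
  then have e2: "\<forall>\<^sub>F s' in nhds s. \<bar>s' - s\<bar> * (K * (quot_const s' * op_const)) < 1/4"
    by (rule order_tendstoD) auto
  have "((\<lambda>s'. \<bar>s' - s\<bar> * quot_const s) \<longlongrightarrow> \<bar>s - s\<bar> * quot_const s) (nhds s)"
    by (intro tendsto_intros t)
  then have e3: "\<forall>\<^sub>F s' in nhds s. \<bar>s' - s\<bar> * quot_const s < 1/5"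
    by (rule order_tendstoD) auto
  have e4: "\<forall>\<^sub>F s' in nhds s. 0 < s'" "\<forall>\<^sub>F s' in nhds s. s' < 1"
    using order_tendstoD[OF t] s by auto
  have "\<forall>\<^sub>F s' in nhds s. 0 < s' \<and> s' < 1 \<and> inv_at s' (2 * K)"
    using e1 e2 e3 e4
  proof eventually_elim
    case (elim s')
    have "f (of_real s') = 0" if "f \<in> calF X" "T (f (of_real s')) = 0" for f
    proof (cases "s' = s")
      case True
      then show ?thesis using K(2) that unfolding inv_at_def by blast
    next
      case False
      then show ?thesis using inv_at_inj_near[OF s K _ _ False _ _ that] elim by auto
    qed
    then show ?case
      using inv_at_surj_near[OF s K] elim unfolding inv_at_def by auto
  qed
  then obtain d where "d > 0" "\<And>s'. dist s' s < d \<Longrightarrow> 0 < s' \<and> s' < 1 \<and> inv_at s' (2 * K)"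
    unfolding eventually_nhds_metric by blast
  then show thesis using that by (auto simp: dist_real_def)
qed

lemma invertibility_set_iff: "s \<in> invertibility_set X Y T \<longleftrightarrow> 0 < s \<and> s < 1 \<and> (\<exists>K>0. inv_at s K)"
  unfolding invertibility_set_def using interp_invertible_iff by auto

lemma open_invertibility_set: "open (invertibility_set X Y T)"
  unfolding open_dist
proof
  fix s assume "s \<in> invertibility_set X Y T"
  then obtain K where s: "0 < s" "s < 1" and K: "K > 0" "inv_at s K"
    unfolding invertibility_set_iff by blast
  obtain d where d: "d > 0" "\<And>s'. \<bar>s' - s\<bar> < d \<Longrightarrow> 0 < s' \<and> s' < 1 \<and> inv_at s' (2 * K)"
    using inv_at_near[OF s K] by blast
  have "s' \<in> invertibility_set X Y T" if "dist s' s < d" for s'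
    using d(2)[of s'] that K(1) unfolding invertibility_set_iff dist_real_def
    by (meson mult_pos_pos zero_less_numeral)
  with d(1) show "\<exists>e>0. \<forall>y. dist y s < e \<longrightarrow> y \<in> invertibility_set X Y T" by blast
qed

end

section \<open>Inverses agree on the intersection\<close>

text \<open>By the reverse triangle inequality the real function \<open>n (x s - x a)\<close> has
  derivative zero, which reduces the claim to the scalar criterion for constancy.\<close>

lemma (in cnormed) constant_of_small_increments:
  fixes x :: "real \<Rightarrow> 'a"
  assumes ab: "a \<le> b" and x: "\<And>s. s \<in> {a..b} \<Longrightarrow> x s \<in> V"
    and inc: "\<And>s e. s \<in> {a..b} \<Longrightarrow> e > 0 \<Longrightarrow>
      \<exists>d>0. \<forall>s'\<in>{a..b}. \<bar>s' - s\<bar> < d \<longrightarrow> n (x s' - x s) \<le> e * \<bar>s' - s\<bar>"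
  shows "x a = x b"
proof -
  define \<delta> where "\<delta> s = n (x s - x a)" for s
  have lip: "\<bar>\<delta> s' - \<delta> s\<bar> \<le> n (x s' - x s)" if "s \<in> {a..b}" "s' \<in> {a..b}" for s s'
  proof -
    have m: "x s \<in> V" "x s' \<in> V" "x a \<in> V" using x that ab by auto
    show ?thesis
      using norm_triangle_via[of "x s" "x s'" "x a"] norm_triangle_via[of "x s'" "x s" "x a"] m
        norm_diff_commute[of "x s" "x s'"] by (auto simp: \<delta>_def)
  qed
  have "\<exists>c. \<forall>s\<in>{a..b}. \<delta> s = c"
  proof (rule has_field_derivative_zero_constant)
    fix s assume s: "s \<in> {a..b}"
    have "((\<lambda>s'. (\<delta> s' - \<delta> s) / (s' - s)) \<longlongrightarrow> 0) (at s within {a..b})"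
    proof (rule tendstoI)
      fix e :: real assume e: "e > 0"
      then have "e / 2 > 0" by simp
      from inc[OF s this] obtain d where d: "d > 0"
        "\<forall>s'\<in>{a..b}. \<bar>s' - s\<bar> < d \<longrightarrow> n (x s' - x s) \<le> e / 2 * \<bar>s' - s\<bar>" by (elim exE conjE)
      have "dist ((\<delta> s' - \<delta> s) / (s' - s)) 0 < e" if "s' \<in> {a..b}" "s' \<noteq> s" "dist s' s < d" for s'
      proof -
        have "\<bar>\<delta> s' - \<delta> s\<bar> \<le> e / 2 * \<bar>s' - s\<bar>"
          using lip[OF s that(1)] d(2) that by (auto simp: dist_real_def intro: order_trans)
        then have "\<bar>\<delta> s' - \<delta> s\<bar> / \<bar>s' - s\<bar> \<le> e / 2"
          using that(2) by (simp add: divide_le_eq)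
        then have "\<bar>(\<delta> s' - \<delta> s) / (s' - s)\<bar> \<le> e / 2" by (simp only: abs_divide)
        then show ?thesis using e unfolding dist_real_def diff_0_right by linarith
      qed
      with d(1) show "\<forall>\<^sub>F s' in at s within {a..b}. dist ((\<delta> s' - \<delta> s) / (s' - s)) 0 < e"
        unfolding eventually_at by blast
    qed
    then show "(\<delta> has_field_derivative 0) (at s within {a..b})" by (simp add: has_field_derivative_iff)
  qed simp
  then have "\<delta> b = \<delta> a" using ab by auto
  then show ?thesis
    using norm_eq_zero[of "x b - x a"] x ab by (auto simp: \<delta>_def)
qed

context couple_map
begin

text \<open>Two steps of the iteration give
  \<open>w = T f0 + \<psi> T f1 + \<psi>\<^sup>2 g2\<close>, and \<open>G = f0 + \<psi> f1\<close>.
  The exact solution at \<open>Re z\<close> differs from \<open>G z\<close> by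
  \<open>\<psi>\<^sup>2\<close> times a preimage of \<open>g2 z\<close>, bounded uniformly. Stopping
  at the second order makes the error quadratic, so that it does not affect derivatives at
  \<open>s\<close>.\<close>

lemma local_solution:
  assumes s: "0 < s" "s < 1" and K: "K > 0" "inv_at s K" and w: "w \<in> sp Y 0" "w \<in> sp Y 1"
  obtains G B d where "G \<in> calF X" "B > 0" "d > 0"
    "\<And>z x. \<bar>Re z - s\<bar> < d \<Longrightarrow> x \<in> interp_space X (Re z) \<Longrightarrow> T x = w \<Longrightarrow>
       Re z \<in> {0<..<1} \<and> X.N (x - G z) \<le> B * (cmod (z - of_real s))\<^sup>2"
proof -
  define M where "M = max (nm Y 0 w) (nm Y 1 w) + 1"
  have M: "M > 0" using Y.E0.norm_ge_zero[OF w(1)] by (simp add: M_def)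
  have wM: "Fb Y M (\<lambda>z. w)" by (rule Y.Fb_mono[OF Y.Fb_const[OF w]]) (simp add: M_def)
  define L where "L = quot_const s * (1 + op_const * K)"
  have L: "L > 0" using s K(1) op_const(1) by (simp add: L_def quot_const_def add_pos_pos)
  obtain f0 g1 where f0: "Fb X (K * M) f0" "Fb Y (L * M) g1"
    "\<And>z. z \<in> strip \<Longrightarrow> w = T (f0 z) + smul Y (\<psi> s z) (g1 z)"
    by (rule solve_step[OF s K M wM, folded L_def]) (rule that)
  have LM: "L * M > 0" using L M by simp
  obtain f1 g2 where f1: "Fb X (K * (L * M)) f1" "Fb Y (L * (L * M)) g2"
    "\<And>z. z \<in> strip \<Longrightarrow> g1 z = T (f1 z) + smul Y (\<psi> s z) (g2 z)"
    by (rule solve_step[OF s K LM f0(2), folded L_def]) (rule that)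
  define G where "G z = f0 z + smul X (\<psi> s z) (f1 z)" for z
  have GFb: "Fb X (K * M + 1 * (K * (L * M))) G"
    unfolding G_def
    by (intro X.Fb_add f0 X.Fb_scale[OF f1(1) \<psi>_continuous \<psi>_holomorphic, of s 1 1] \<psi>_le_one bd_strip) (use s in auto)
  obtain d where d: "d > 0" "\<And>s'. \<bar>s' - s\<bar> < d \<Longrightarrow> 0 < s' \<and> s' < 1 \<and> inv_at s' (2 * K)"
    by (rule inv_at_near[OF s K]) (rule that)
  define B where "B = 2 * K * (L * (L * M))"
  have main: "Re z \<in> {0<..<1} \<and> X.N (x - G z) \<le> B * (cmod (z - of_real s))\<^sup>2"
    if z: "\<bar>Re z - s\<bar> < d" and x: "x \<in> interp_space X (Re z)" "T x = w" for z x
  proof -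
    define r where "r = Re z"
    have r: "0 < r" "r < 1" "inv_at r (2 * K)" using d(2)[OF z] by (auto simp: r_def)
    have zr: "z = of_real r + \<i> * of_real (Im z)" by (simp add: r_def complex_eq)
    have zs: "z \<in> strip" using r by (simp add: strip_def r_def)
    have "L * (L * M) > 0" using L LM by simp
    \<comment> \<open>Translating \<open>g2\<close> by \<open>Im z\<close> turns its value at the
      complex point \<open>z\<close> into a value at the real point \<open>r\<close>, where the
      inverse is available. This is the source of the dependence on \<open>Re z\<close>
      only.\<close>
    from inv_at_surj[OF r(3) this Y.Fb_shift[OF f1(2), of "Im z"]] obtain v where
      v: "Fb X (2 * K * (L * (L * M))) v" "T (v (of_real r)) = g2 z"
      using zr by auto
    define \<epsilon> where "\<epsilon> = \<psi> s z"
    have V: "Fb X (K * M + 1 * (K * (L * M)) + cmod (\<epsilon>\<^sup>2) * B) (\<lambda>y. G (y + \<i> * of_real (Im z)) + smul X (\<epsilon>\<^sup>2) (v y))"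
      unfolding B_def by (intro X.Fb_add X.Fb_shift GFb X.Fb_scale_const v)
    have mem: "f0 z \<in> X.S" "f1 z \<in> X.S" "G z \<in> X.S" "v (of_real r) \<in> X.S" "g2 z \<in> Y.S"
      using X.locF_props(1)[OF X.calF_locF] Y.locF_props(1)[OF Y.calF_locF] FbD(1)[OF f0(1)] FbD(1)[OF f1(1)]
        FbD(1)[OF f1(2)] FbD(1)[OF GFb] FbD(1)[OF v(1)] zs of_real_strip[OF r(1,2)] by auto
    have eq: "x = G z + smul X (\<epsilon>\<^sup>2) (v (of_real r))"
    proof (rule inv_at_inj[OF r(3,1,2)])
      show "x \<in> interp_space X r" using x by (simp add: r_def)
      show "G z + smul X (\<epsilon>\<^sup>2) (v (of_real r)) \<in> interp_space X r"
        using X.interp_spaceI[OF V, of r] zr by simp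
      have "T (G z + smul X (\<epsilon>\<^sup>2) (v (of_real r))) = T (f0 z) + smul Y \<epsilon> (T (f1 z)) + smul Y (\<epsilon>\<^sup>2) (g2 z)"
        using mem v(2) by (simp add: G_def T_add T_scale \<epsilon>_def)
      also have "\<dots> = T (f0 z) + smul Y \<epsilon> (g1 z)"
        using f1(3)[OF zs] by (simp add: \<epsilon>_def Y.E0.scale_right_distrib power2_eq_square add.assoc)
      also have "\<dots> = w" using f0(3)[OF zs] by (simp add: \<epsilon>_def)
      finally show "T x = T (G z + smul X (\<epsilon>\<^sup>2) (v (of_real r)))" using x(2) by simp
    qed
    have "X.N (x - G z) = (cmod \<epsilon>)\<^sup>2 * X.N (v (of_real r))"
      using eq mem by (simp add: X.E.norm_scale norm_power)
    also have "\<dots> \<le> (cmod (z - of_real s))\<^sup>2 * B"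
      using \<psi>_le_diff[OF zs, of s] X.Fb_sum_norm_le[OF v(1) of_real_strip[OF r(1,2)]]
        X.sum_norm_nonneg[OF mem(4)]
      by (intro mult_mono power_mono) (auto simp: \<epsilon>_def B_def)
    finally show ?thesis using r by (simp add: r_def mult.commute)
  qed
  have "B > 0" using K L M by (simp add: B_def)
  from that[OF FbD(1)[OF GFb] this d(1) main] show thesis .
qed

text \<open>Translating along the imaginary axis does not change the solution, so the derivative of
  the local analytic solution vanishes in the imaginary, hence also in the real direction.\<close>

lemma solutions_agree:
  assumes ab: "a \<le> b" and I: "{a..b} \<subseteq> invertibility_set X Y T" and w: "w \<in> sp Y 0" "w \<in> sp Y 1"
    and x: "\<And>s. s \<in> {a..b} \<Longrightarrow> x s \<in> interp_space X s" "\<And>s. s \<in> {a..b} \<Longrightarrow> T (x s) = w"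
  shows "x a = x b"
proof (rule X.E.constant_of_small_increments[OF ab])
  have I': "0 < s \<and> s < 1 \<and> (\<exists>K>0. inv_at s K)" if "s \<in> {a..b}" for s
    using I that invertibility_set_iff by blast
  show "x s \<in> X.S" if "s \<in> {a..b}" for s
    using X.interp_space_sumspace x(1) I' that by blast
  fix s e :: real assume s: "s \<in> {a..b}" and e: "e > 0"
  then obtain K where s01: "0 < s" "s < 1" and K: "K > 0" "inv_at s K" using I' by blast
  obtain G B d where G: "G \<in> calF X" and B: "B > 0" and d: "d > 0" and
    main: "\<And>z x. \<bar>Re z - s\<bar> < d \<Longrightarrow> x \<in> interp_space X (Re z) \<Longrightarrow> T x = w \<Longrightarrow>
       Re z \<in> {0<..<1} \<and> X.N (x - G z) \<le> B * (cmod (z - of_real s))\<^sup>2"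
    by (rule local_solution[OF s01 K w]) (rule that)
  note GD = X.locF_props[OF X.calF_locF[OF G]]
  define c where "c = complex_of_real s"
  have c: "c \<in> ostrip" "c \<in> strip" using s01 by (auto simp: c_def ostrip_def strip_def)
  have xs: "x s \<in> X.S" using X.interp_space_sumspace[OF x(1)[OF s] s01] .
  have "X.N (x s - G c) \<le> 0"
    using main[of c "x s"] x s d by (simp add: c_def)
  then have Gc: "G c = x s"
    using X.sum_norm_nonneg[of "x s - G c"] X.E.norm_eq_zero[of "x s - G c"] GD(1)[OF c(2)] xs by auto
  have mem: "G z \<in> X.S" if "z \<in> ostrip" for z using GD(1) ostrip_subset_strip that by auto
  obtain r where r: "r > 0" "\<And>w. w \<in> ball c r \<Longrightarrow> w \<in> strip \<Longrightarrow> X.N (G w) \<le> X.N (G c) + 1"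
    by (rule X.E.cont_into_bounded_near[OF GD(2) c(2)]) (rule GD(1), assumption, rule that)
  have "X.E.strong_diff ostrip G c"
    using c mem GD(3) r ostrip_subset_strip
    by (intro X.E.weak_hol_imp_strong_diff[OF open_ostrip, where r = r and B = "X.N (G c) + 1"]) auto
  then obtain D where D: "D \<in> X.S" "\<forall>e>0. \<exists>d>0. \<forall>w\<in>ostrip. 0 < cmod (w - c) \<and> cmod (w - c) < d \<longrightarrow>
      X.N (smul X (1 / (w - c)) (G w - G c) - D) < e"
    unfolding X.E.strong_diff_def by (elim bexE)
  have "X.N D \<le> 0"
  proof (rule field_le_epsilon)
    fix \<eta> :: real assume \<eta>: "\<eta> > 0"
    then have "\<eta> / 2 > 0" by simp
    with D(2) obtain \<rho> where \<rho>: "\<rho> > 0" "\<forall>w\<in>ostrip. 0 < cmod (w - c) \<and> cmod (w - c) < \<rho> \<longrightarrow>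
      X.N (smul X (1 / (w - c)) (G w - G c) - D) < \<eta> / 2" by blast
    \<comment> \<open>The point \<open>c + i t\<close> has real part \<open>s\<close>, so the same
      solution \<open>x s\<close> is compared with \<open>G\<close> there. \<open>\<rho> / 2\<close>
      keeps it in the range of the difference quotient estimate, and \<open>\<eta> / (2 * B)\<close>
      leaves at most \<open>\<eta> / 2\<close> of the quadratic error after division by
      \<open>t\<close>.\<close>
    define t where "t = min (\<rho> / 2) (\<eta> / (2 * B))"
    have t: "t > 0" "t < \<rho>" "B * t \<le> \<eta> / 2"
    proof -
      show "t > 0" "t < \<rho>" using \<rho>(1) \<eta> B by (auto simp: t_def)
      have "B * t \<le> B * (\<eta> / (2 * B))" using B by (intro mult_left_mono) (auto simp: t_def)
      then show "B * t \<le> \<eta> / 2" using B by simp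
    qed
    define z where "z = c + \<i> * of_real t"
    have z: "z \<in> ostrip" "cmod (z - c) = t" "Re z = s"
      using s01 t by (auto simp: z_def c_def ostrip_def norm_mult)
    define q where "q = smul X (1 / (z - c)) (G z - G c)"
    have qS: "q \<in> X.S" using mem z c by (auto simp: q_def)
    have "X.N (x s - G z) \<le> B * t\<^sup>2"
      using main[of z "x s"] x s d z by (simp add: c_def)
    then have "X.N (G z - G c) \<le> B * t\<^sup>2"
      using X.E.norm_diff_commute[of "x s" "G z"] xs mem[OF z(1)] by (simp add: Gc)
    then have "X.N q \<le> (1 / t) * (B * t\<^sup>2)"
      unfolding q_def using mem[OF z(1)] mem[OF c(1)] z(2) t(1)
      by (simp add: X.E.norm_scale norm_divide divide_right_mono)
    also have "\<dots> = B * t" using t(1) by (simp add: power2_eq_square)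
    finally have "X.N q \<le> \<eta> / 2" using t(3) by linarith
    moreover have "X.N (q - D) < \<eta> / 2"
      using \<rho>(2)[rule_format, OF z(1), unfolded z(2)] t(1,2) unfolding q_def by blast
    ultimately show "X.N D \<le> 0 + \<eta>"
      using X.E.norm_le_via[of D q] X.E.norm_diff_commute[of D q] qS D(1) by simp
  qed
  then have D0: "D = 0" using X.sum_norm_nonneg[OF D(1)] X.E.norm_eq_zero[OF D(1)] by auto
  have "e / 2 > 0" using e by simp
  with D(2) obtain \<rho> where \<rho>: "\<rho> > 0" "\<forall>w\<in>ostrip. 0 < cmod (w - c) \<and> cmod (w - c) < \<rho> \<longrightarrow>
      X.N (smul X (1 / (w - c)) (G w - G c) - D) < e / 2" by blast
  \<comment> \<open>\<open>d\<close> and \<open>\<rho>\<close> are ranges of validity. The bound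
    \<open>e / (2 * B)\<close> lets the quadratic remainder use one half of \<open>e\<close>; the
    other half pays for the increment of \<open>G\<close>, whose derivative at \<open>c\<close> is
    now \<open>0\<close>.\<close>
  define \<eta> where "\<eta> = min d (min \<rho> (e / (2 * B)))"
  have "X.N (x s' - x s) \<le> e * \<bar>s' - s\<bar>" if s': "s' \<in> {a..b}" "\<bar>s' - s\<bar> < \<eta>" for s'
  proof (cases "s' = s")
    case True
    then show ?thesis by simp
  next
    case False
    define z where "z = complex_of_real s'"
    have h: "cmod (z - c) = \<bar>s' - s\<bar>"
      using norm_of_real[of "s' - s", where ?'a = complex] by (simp add: z_def c_def)
    have z: "z \<in> ostrip" using I'[OF s'(1)] by (simp add: z_def ostrip_def)
    have x's: "x s' \<in> X.S" using X.interp_space_sumspace[OF x(1)[OF s'(1)]] I'[OF s'(1)] by blast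
    have 1: "X.N (x s' - G z) \<le> B * \<bar>s' - s\<bar>\<^sup>2"
      using main[of z "x s'"] x[OF s'(1)] s'(2) h by (simp add: z_def c_def \<eta>_def)
    have 2: "B * \<bar>s' - s\<bar>\<^sup>2 \<le> e / 2 * \<bar>s' - s\<bar>"
    proof -
      have "B * \<bar>s' - s\<bar> \<le> B * (e / (2 * B))" using s'(2) B by (intro mult_left_mono) (auto simp: \<eta>_def)
      then have "B * \<bar>s' - s\<bar> \<le> e / 2" using B by simp
      from mult_right_mono[OF this, of "\<bar>s' - s\<bar>"] show ?thesis by (simp add: power2_eq_square mult_ac)
    qed
    have "X.N (smul X (1 / (z - c)) (G z - G c)) < e / 2"
      using \<rho>(2)[rule_format, OF z, unfolded h D0 diff_0_right] False s'(2) by (simp add: \<eta>_def)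
    then have "X.N (G z - G c) / \<bar>s' - s\<bar> < e / 2"
      using mem[OF z] mem[OF c(1)] h by (simp add: X.E.norm_scale norm_divide)
    then have "X.N (G z - G c) \<le> e / 2 * \<bar>s' - s\<bar>"
      using False by (simp add: divide_less_eq)
    with 1 2 show ?thesis
      using X.E.norm_triangle_via[of "x s'" "G z" "G c"] x's mem[OF z] mem[OF c(1)]
      by (simp add: Gc field_simps)
  qed
  moreover have "\<eta> > 0" using d \<rho>(1) e B by (simp add: \<eta>_def)
  ultimately show "\<exists>d>0. \<forall>s'\<in>{a..b}. \<bar>s' - s\<bar> < d \<longrightarrow> X.N (x s' - x s) \<le> e * \<bar>s' - s\<bar>" by blast
qed

end

section \<open>Periodic functions and their averages\<close>

definition strip_periodic :: "(complex \<Rightarrow> 'b) \<Rightarrow> bool" where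
  "strip_periodic f \<longleftrightarrow> (\<forall>z\<in>strip. f (z + \<i> * of_real (2 * pi)) = f z)"

lemma strip_shift: "z \<in> strip \<Longrightarrow> z + \<i> * of_real t \<in> strip"
  by (simp add: strip_def)

lemma strip_periodic_int:
  assumes f: "strip_periodic f" and z: "z \<in> strip"
  shows "f (z + \<i> * of_real (2 * pi * of_int k)) = f z"
proof -
  have nat: "f (z + \<i> * of_real (2 * pi * of_nat m)) = f z" if z: "z \<in> strip" for z m
  proof (induction m)
    case (Suc m)
    have "f (z + \<i> * of_real (2 * pi * of_nat m) + \<i> * of_real (2 * pi)) = f (z + \<i> * of_real (2 * pi * of_nat m))"
      using f strip_shift[OF z] unfolding strip_periodic_def by blast
    then show ?case using Suc by (simp add: algebra_simps)
  qed simp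
  show ?thesis
  proof (cases "k \<ge> 0")
    case True
    then show ?thesis using nat[OF z, of "nat k"] by simp
  next
    case False
    then show ?thesis
      using nat[OF strip_shift[OF z], of "2 * pi * of_int k" "nat (- k)"] by simp
  qed
qed

lemma strip_periodic_reduce:
  assumes f: "strip_periodic f" and z: "z \<in> strip"
  obtains z' k where "z' \<in> strip" "0 \<le> Im z'" "Im z' \<le> 2 * pi" "Re z' = Re z" "f z' = f z"
    "z' = z + \<i> * of_real (2 * pi * of_int k)"
proof -
  define q where "q = Im z / (2 * pi)"
  define k where "k = - \<lfloor>q\<rfloor>"
  have "0 \<le> q + of_int k" "q + of_int k \<le> 1" unfolding k_def by linarith+
  moreover have "Im (z + \<i> * of_real (2 * pi * of_int k)) = 2 * pi * (q + of_int k)"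
    by (simp add: q_def distrib_left)
  ultimately have "0 \<le> Im (z + \<i> * of_real (2 * pi * of_int k))" "Im (z + \<i> * of_real (2 * pi * of_int k)) \<le> 2 * pi"
    by (simp_all add: mult_left_le del: distrib_left_numeral)
  then show thesis
    using strip_periodic_int[OF f z, of k] strip_shift[OF z, of "2 * pi * of_int k"]
    by (intro that[of "z + \<i> * of_real (2 * pi * of_int k)" k]) auto
qed

lemma sum_lessThan_add: "(\<Sum>k<m + n. f k) = (\<Sum>k<m. f k) + (\<Sum>k<n. f (m + k))"
  for f :: "nat \<Rightarrow> 'b::comm_monoid_add"
  by (induction n) (auto simp: add.assoc)

definition node :: "nat \<Rightarrow> nat \<Rightarrow> real" where
  "node r k = 2 * pi * of_nat k / 2 ^ r"

lemma node_bounds: "k < 2 ^ r \<Longrightarrow> 0 \<le> node r k \<and> node r k \<le> 2 * pi"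
proof -
  assume "k < 2 ^ r"
  then have "real k \<le> 2 ^ r" by (metis less_imp_le of_nat_le_iff of_nat_numeral of_nat_power)
  then show ?thesis by (simp add: node_def field_simps)
qed

text \<open>The dyadic averages satisfy a doubling recursion because
  \<open>1/(b-1) + 1/(-b-1) = 2/(b\<^sup>2-1)\<close>.\<close>

lemma average_kernel:
  assumes "Re u \<noteq> 0"
  shows "(\<Sum>k<2 ^ r. 1 / (exp (u + \<i> * of_real (node r k)) - 1)) / 2 ^ r = 1 / (exp (2 ^ r * u) - 1)"
  using assms
proof (induction r arbitrary: u)
  case (Suc r)
  define b where "b k = exp (u + \<i> * of_real (node (Suc r) k))" for k
  have shift: "b (2 ^ r + k) = - b k" for k
  proof -
    have "u + \<i> * of_real (node (Suc r) (2 ^ r + k)) = u + \<i> * of_real (node (Suc r) k) + \<i> * of_real pi"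
      by (simp add: node_def field_simps)
    then show ?thesis by (simp add: b_def exp_add)
  qed
  have square: "(b k)\<^sup>2 = exp (2 * u + \<i> * of_real (node r k))" for k
    unfolding b_def exp_double[symmetric] by (rule arg_cong[where f = exp]) (simp add: node_def field_simps)
  have ne: "b k \<noteq> 1" "b k \<noteq> - 1" "(b k)\<^sup>2 \<noteq> 1" for k
  proof -
    have "cmod (b k) = exp (Re u)" by (simp add: b_def)
    then have "cmod (b k) \<noteq> 1" using Suc.prems by simp
    then show "b k \<noteq> 1" "b k \<noteq> - 1" "(b k)\<^sup>2 \<noteq> 1" by (auto simp: power2_eq_1_iff)
  qed
  have pair: "1 / (b k - 1) + 1 / (- b k - 1) = 2 * (1 / ((b k)\<^sup>2 - 1))" for k
  proof -
    have "b k - 1 \<noteq> 0" "- b k - 1 \<noteq> 0" "(b k)\<^sup>2 - 1 \<noteq> 0" using ne[of k] by (auto simp: minus_equation_iff[of _ 1] add_eq_0_iff2)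
    then show ?thesis by (simp add: divide_simps) (simp add: algebra_simps power2_eq_square)
  qed
  have "(\<Sum>k<2 ^ Suc r. 1 / (b k - 1)) = (\<Sum>k<2 ^ r. 1 / (b k - 1)) + (\<Sum>k<2 ^ r. 1 / (- b k - 1))"
    using sum_lessThan_add[of "\<lambda>k. 1 / (b k - 1)" "2 ^ r" "2 ^ r"] by (simp add: shift mult_2)
  also have "\<dots> = 2 * (\<Sum>k<2 ^ r. 1 / (exp (2 * u + \<i> * of_real (node r k)) - 1))"
    by (simp add: pair square sum_distrib_left flip: sum.distrib)
  finally have "(\<Sum>k<2 ^ Suc r. 1 / (b k - 1)) / 2 ^ Suc r
      = (\<Sum>k<2 ^ r. 1 / (exp (2 * u + \<i> * of_real (node r k)) - 1)) / 2 ^ r" by simp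
  also have "\<dots> = 1 / (exp (2 ^ r * (2 * u)) - 1)" using Suc.prems by (intro Suc.IH) simp
  finally show ?case by (simp add: b_def mult_ac)
qed (simp add: node_def)

text \<open>By the closed form the average equals \<open>1 / (exp (2 ^ r * c) - 1)\<close>. The two
  limits differ by \<open>1\<close>, the residue that a contour shift across the pole at
  \<open>c = 0\<close> would pick up.\<close>

lemma average_kernel_limit:
  assumes "c \<noteq> 0"
  shows "(\<lambda>r. (\<Sum>k<2 ^ r. 1 / (exp (of_real c + \<i> * of_real (node r k)) - 1)) / 2 ^ r)
    \<longlonglongrightarrow> (if c > 0 then 0 else - 1 :: complex)"
proof -
  have eq: "(\<Sum>k<2 ^ r. 1 / (exp (of_real c + \<i> * of_real (node r k)) - 1)) / 2 ^ r
      = complex_of_real (1 / (exp (2 ^ r * c) - 1))" for r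
    using average_kernel[of "of_real c" r] assms by (simp flip: exp_of_real)
  have "(\<lambda>r. 1 / (exp (2 ^ r * c) - 1)) \<longlonglongrightarrow> (if c > 0 then 0 else - 1)"
  proof (cases "c > 0")
    case True
    then have "(\<lambda>r. 1 / (exp (2 ^ r * c) - 1)) \<longlonglongrightarrow> 0" by real_asymp
    with True show ?thesis by simp
  next
    case False
    then have "c < 0" using assms by simp
    then have "(\<lambda>r. 1 / (exp (2 ^ r * c) - 1)) \<longlonglongrightarrow> - 1" by real_asymp
    with False show ?thesis by simp
  qed
  from tendsto_of_real[OF this, where ?'a = complex] show ?thesis unfolding eq by (simp split: if_splits)
qed

text \<open>Finite averages replace the contour integral, so independence of the line holds only in
  the limit. The average is itself periodic with the short period \<open>2 * pi / 2 ^ r\<close>; a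
  bounded holomorphic function with so short a period has a derivative of that order, hence is
  asymptotically constant inside the strip. Edges are reached by uniform continuity.\<close>

lemma average_independent:
  fixes h :: "complex \<Rightarrow> complex"
  assumes cont: "continuous_on strip h" and hol: "h holomorphic_on ostrip" and per: "strip_periodic h"
    and \<sigma>: "\<sigma> \<in> {0..1}" "\<sigma>' \<in> {0..1}"
  shows "(\<lambda>r. (\<Sum>k<2 ^ r. h (of_real \<sigma> + \<i> * of_real (node r k))) / 2 ^ r
            - (\<Sum>k<2 ^ r. h (of_real \<sigma>' + \<i> * of_real (node r k))) / 2 ^ r) \<longlonglongrightarrow> 0"
proof -
  define Q where "Q = cbox 0 (Complex 1 (2 * pi))"
  have Q: "z \<in> Q \<longleftrightarrow> 0 \<le> Re z \<and> Re z \<le> 1 \<and> 0 \<le> Im z \<and> Im z \<le> 2 * pi" for z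
    by (auto simp: Q_def in_cbox_complex_iff)
  have Qs: "Q \<subseteq> strip" by (auto simp: Q strip_def)
  have contQ: "continuous_on Q h" using cont Qs by (rule continuous_on_subset)
  have uc: "uniformly_continuous_on Q h"
    by (rule compact_uniformly_continuous[OF contQ]) (simp add: Q_def)
  obtain B where BQ: "\<And>z. z \<in> Q \<Longrightarrow> cmod (h z) \<le> B"
    using compact_imp_bounded[OF compact_continuous_image[OF contQ]] unfolding bounded_iff Q_def
    by (metis compact_cbox imageI)
  have B: "cmod (h z) \<le> B" if z: "z \<in> strip" for z
  proof -
    obtain z' k where "z' \<in> strip" "0 \<le> Im z'" "Im z' \<le> 2 * pi" "Re z' = Re z" "h z' = h z"
      by (rule strip_periodic_reduce[OF per z]) (rule that)
    then show ?thesis using BQ[of z'] by (auto simp: Q strip_def)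
  qed
  define A where "A r z = (\<Sum>k<2 ^ r. h (z + \<i> * of_real (node r k))) / 2 ^ r" for r z
  have avg_le: "cmod ((\<Sum>k<2 ^ r. \<phi> k) / 2 ^ r) \<le> e" if "\<And>k. k < 2 ^ r \<Longrightarrow> cmod (\<phi> k) \<le> e" for \<phi> :: "nat \<Rightarrow> complex" and e r
  proof -
    have "cmod (\<Sum>k<2 ^ r. \<phi> k) \<le> of_nat (card {..<(2::nat) ^ r}) * e"
      using that by (intro sum_norm_bound) auto
    then show ?thesis by (simp add: norm_divide norm_power divide_le_eq mult.commute)
  qed
  have AB: "cmod (A r z) \<le> B" if "z \<in> strip" for r z
    unfolding A_def using B strip_shift[OF that] by (intro avg_le) auto
  have Ahol: "A r holomorphic_on ostrip" for r
  proof -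
    have "(\<lambda>z. h (z + \<i> * of_real t)) holomorphic_on ostrip" for t
    proof -
      have "(h \<circ> (\<lambda>z. z + \<i> * of_real t)) holomorphic_on ostrip"
        by (rule holomorphic_on_compose_gen[OF _ hol]) (auto intro!: holomorphic_intros simp: ostrip_def)
      then show ?thesis by (simp add: o_def)
    qed
    then show ?thesis unfolding A_def by (intro holomorphic_intros) auto
  qed
  have Aper: "A r (z + \<i> * of_real (2 * pi / 2 ^ r)) = A r z" if z: "z \<in> strip" for r z
  proof -
    define \<phi> where "\<phi> k = h (z + \<i> * of_real (node r k))" for k
    have "h (z + \<i> * of_real (2 * pi / 2 ^ r) + \<i> * of_real (node r k)) = \<phi> (Suc k)" for k
      unfolding \<phi>_def by (rule arg_cong[where f = h]) (simp add: node_def field_simps)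
    moreover have "(\<Sum>k<2 ^ r. \<phi> (Suc k)) = (\<Sum>k<2 ^ r. \<phi> k)"
    proof -
      have "\<phi> (2 ^ r) = \<phi> 0" using per z by (simp add: \<phi>_def node_def strip_periodic_def)
      moreover have "(\<Sum>k<Suc m. \<phi> k) = \<phi> 0 + (\<Sum>k<m. \<phi> (Suc k))" for m
        by (rule sum.lessThan_Suc_shift)
      from this[of "2 ^ r"] have "(\<Sum>k<2 ^ r. \<phi> k) + \<phi> (2 ^ r) = \<phi> 0 + (\<Sum>k<2 ^ r. \<phi> (Suc k))" by simp
      ultimately show ?thesis by simp
    qed
    ultimately show ?thesis by (simp add: A_def \<phi>_def)
  qed
  have interior: "(\<lambda>r. A r (of_real a) - A r (of_real b)) \<longlonglongrightarrow> 0" if a: "0 < a" "a < 1" and b: "0 < b" "b < 1" for a b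
  proof -
    define \<rho> where "\<rho> = min (min a b) (min (1 - a) (1 - b)) / 2"
    have \<rho>: "\<rho> > 0" "2 * \<rho> \<le> a" "2 * \<rho> \<le> b" "2 * \<rho> \<le> 1 - a" "2 * \<rho> \<le> 1 - b" using a b by (auto simp: \<rho>_def)
    define W where "W = {z. min a b \<le> Re z \<and> Re z \<le> max a b}"
    have "convex W"
      using convex_Int[OF convex_halfspace_Re_ge[of "min a b"] convex_halfspace_Re_le[of "max a b"]]
      by (simp add: W_def Int_def)
    have ball: "ball z (2 * \<rho>) \<subseteq> ostrip" if "z \<in> W" for z
    proof
      fix w assume "w \<in> ball z (2 * \<rho>)"
      then have "\<bar>Re w - Re z\<bar> < 2 * \<rho>"
        using abs_Re_le_cmod[of "w - z"] by (auto simp: dist_norm norm_minus_commute)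
      then show "w \<in> ostrip" using \<rho> \<open>z \<in> W\<close> by (auto simp: W_def ostrip_def)
    qed
    have W_o: "z \<in> ostrip" if "z \<in> W" for z using ball[OF that] \<rho>(1) by auto
    define C where "C = 4 * B / \<rho>\<^sup>2"
    have der: "cmod (deriv (A r) z) \<le> C * (2 * pi / 2 ^ r)" if z: "z \<in> W" and r: "2 * pi / 2 ^ r < \<rho> / 2" for r z
    proof -
      \<comment> \<open>At \<open>w'\<close> the difference quotient of \<open>A r\<close> with base
        point \<open>z\<close> vanishes by the short period. Its Lipschitz estimate then bounds the
        derivative, its limit at \<open>z\<close>, by a multiple of the mesh width.\<close>
      define w' where "w' = z + \<i> * of_real (2 * pi / 2 ^ r)"
      have w': "w' \<in> ball z (\<rho> / 2)" "w' \<noteq> z" "cmod (w' - z) = 2 * pi / 2 ^ r"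
        using r by (auto simp: w'_def dist_norm norm_mult norm_divide norm_power)
      have A0: "A r w' = A r z" unfolding w'_def using Aper W_o[OF z] ostrip_subset_strip by blast
      have "((\<lambda>w. (A r w - A r z) / (w - z)) \<longlongrightarrow> deriv (A r) z) (at z)"
        using holomorphic_derivI[OF Ahol open_ostrip W_o[OF z]] by (simp add: has_field_derivative_iff)
      then have "((\<lambda>w. cmod ((A r w - A r z) / (w - z))) \<longlongrightarrow> cmod (deriv (A r) z)) (at z)" by (rule tendsto_norm)
      moreover have "((\<lambda>w. C * cmod (w - w')) \<longlongrightarrow> C * cmod (z - w')) (at z)" by (intro tendsto_intros)
      moreover have "\<forall>\<^sub>F w in at z. cmod ((A r w - A r z) / (w - z)) \<le> C * cmod (w - w')"
      proof -
        have "\<forall>\<^sub>F w in at z. w \<in> ball z (\<rho> / 2) \<and> w \<noteq> z"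
          unfolding eventually_at using \<rho>(1) by (intro exI[of _ "\<rho> / 2"]) (auto simp: dist_commute)
        then show ?thesis
        proof eventually_elim
          case (elim w)
          have "cmod ((A r w - A r z) / (w - z) - (A r w' - A r z) / (w' - z)) \<le> C * cmod (w - w')"
            unfolding C_def
          proof (rule difference_quotient_lipschitz)
            show "A r holomorphic_on ball z (2 * \<rho>)" using Ahol ball[OF z] by (rule holomorphic_on_subset)
            show "cmod (A r y) \<le> B" if "y \<in> ball z (2 * \<rho>)" for y
              using AB ball[OF z] that ostrip_subset_strip by blast
          qed (use elim w' \<rho> in auto)
          then show ?case by (simp add: A0)
        qed
      qed
      ultimately have "cmod (deriv (A r) z) \<le> C * cmod (z - w')"
        by (intro tendsto_le[OF trivial_limit_at])
      then show ?thesis using w'(3) by (simp add: norm_minus_commute)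
    qed
    have diff: "cmod (A r (of_real a) - A r (of_real b)) \<le> C * (2 * pi / 2 ^ r) * cmod (of_real a - of_real b)"
      if r: "2 * pi / 2 ^ r < \<rho> / 2" for r
    proof (rule field_differentiable_bound[OF \<open>convex W\<close>])
      show "(A r has_field_derivative deriv (A r) z) (at z within W)" if "z \<in> W" for z
        using holomorphic_derivI[OF Ahol open_ostrip W_o[OF that]] by (rule has_field_derivative_at_within)
    qed (use der r in \<open>auto simp: W_def\<close>)
    have l: "(\<lambda>r. 2 * pi / 2 ^ r) \<longlonglongrightarrow> 0" by real_asymp
    show ?thesis
    proof (rule Lim_null_comparison)
      show "(\<lambda>r. C * (2 * pi / 2 ^ r) * cmod (of_real a - of_real b)) \<longlonglongrightarrow> 0"
        by (intro tendsto_mult_left_zero tendsto_mult_right_zero l)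
      have "\<forall>\<^sub>F r in sequentially. 2 * pi / 2 ^ r < \<rho> / 2" using l \<rho>(1) by (intro order_tendstoD) auto
      then show "\<forall>\<^sub>F r in sequentially. cmod (A r (of_real a) - A r (of_real b))
          \<le> C * (2 * pi / 2 ^ r) * cmod (of_real a - of_real b)"
        by eventually_elim (rule diff)
    qed
  qed
  \<comment> \<open>On an edge there is no room for Cauchy estimates. Uniform continuity over one
    period replaces the line by an interior one, with an error independent of
    \<open>r\<close>.\<close>
  have near: "\<exists>a. 0 < a \<and> a < 1 \<and> (\<forall>r. cmod (A r (of_real s) - A r (of_real a)) \<le> e)"
    if s: "s \<in> {0..1}" and e: "e > 0" for s e
  proof -
    obtain d where d: "d > 0" "\<And>z w. z \<in> Q \<Longrightarrow> w \<in> Q \<Longrightarrow> dist w z < d \<Longrightarrow> dist (h w) (h z) < e"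
      using uc e unfolding uniformly_continuous_on_def by metis
    define a where "a = (if s < 1/2 then s + min (d/2) (1/4) else s - min (d/2) (1/4))"
    have a: "0 < a" "a < 1" "\<bar>s - a\<bar> < d" using d(1) s by (auto simp: a_def min_def)
    have "cmod (A r (of_real s) - A r (of_real a)) \<le> e" for r
    proof -
      have "A r (of_real s) - A r (of_real a)
          = (\<Sum>k<2 ^ r. h (of_real s + \<i> * of_real (node r k)) - h (of_real a + \<i> * of_real (node r k))) / 2 ^ r"
        by (simp add: A_def sum_subtractf diff_divide_distrib)
      also have "cmod \<dots> \<le> e"
      proof (rule avg_le)
        fix k assume "k < (2::nat) ^ r"
        from node_bounds[OF this] s a
        have "of_real s + \<i> * of_real (node r k) \<in> Q" "of_real a + \<i> * of_real (node r k) \<in> Q" by (auto simp: Q)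
        moreover have "dist (of_real s + \<i> * of_real (node r k)) (of_real a + \<i> * of_real (node r k)) < d"
          using a(3) norm_of_real[of "s - a", where ?'a = complex] by (simp add: dist_norm)
        ultimately show "cmod (h (of_real s + \<i> * of_real (node r k)) - h (of_real a + \<i> * of_real (node r k))) \<le> e"
          using d(2) by (force simp: dist_norm)
      qed
      finally show ?thesis .
    qed
    with a show ?thesis by blast
  qed
  have "(\<lambda>r. A r (of_real \<sigma>) - A r (of_real \<sigma>')) \<longlonglongrightarrow> 0"
  proof (rule LIMSEQ_I)
    fix e :: real assume e: "e > 0"
    then have e3: "e / 3 > 0" by simp
    obtain a where a: "0 < a" "a < 1" "\<And>r. cmod (A r (of_real \<sigma>) - A r (of_real a)) \<le> e / 3"
      using near[OF \<sigma>(1) e3] by blast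
    obtain b where b: "0 < b" "b < 1" "\<And>r. cmod (A r (of_real \<sigma>') - A r (of_real b)) \<le> e / 3"
      using near[OF \<sigma>(2) e3] by blast
    obtain R where R: "\<And>r. r \<ge> R \<Longrightarrow> cmod (A r (of_real a) - A r (of_real b) - 0) < e / 3"
      using LIMSEQ_D[OF interior[OF a(1,2) b(1,2)] e3] by blast
    have "cmod (A r (of_real \<sigma>) - A r (of_real \<sigma>')) < e" if "r \<ge> R" for r
    proof -
      have "A r (of_real \<sigma>) - A r (of_real \<sigma>') = (A r (of_real \<sigma>) - A r (of_real a))
          + ((A r (of_real a) - A r (of_real b)) - (A r (of_real \<sigma>') - A r (of_real b)))" by simp
      also have "cmod \<dots> \<le> cmod (A r (of_real \<sigma>) - A r (of_real a))
          + (cmod (A r (of_real a) - A r (of_real b)) + cmod (A r (of_real \<sigma>') - A r (of_real b)))"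
        by (intro norm_triangle_mono norm_triangle_ineq4 order_refl)
      also have "\<dots> < e" using a(3)[of r] b(3)[of r] R[OF that] by simp
      finally show ?thesis .
    qed
    then show "\<exists>no. \<forall>r\<ge>no. norm (A r (of_real \<sigma>) - A r (of_real \<sigma>') - 0) < e" by auto
  qed
  then show ?thesis by (simp add: A_def)
qed

lemma (in cnormed) periodic_uniformly_continuous:
  fixes h :: "real \<Rightarrow> 'a"
  assumes cont: "cont_into UNIV h" and h: "\<And>t. h t \<in> V"
    and per: "\<And>t k. h (t + 2 * pi * of_int k) = h t" and e: "e > 0"
  shows "\<exists>d>0. \<forall>s t. \<bar>s - t\<bar> < d \<longrightarrow> n (h s - h t) < e"
proof -
  have "e / 2 > 0" using e by simp
  then have "\<forall>t. \<exists>d>0. \<forall>s. dist s t < d \<longrightarrow> n (h s - h t) < e / 2"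
    using cont unfolding cont_into_def by (metis UNIV_I)
  then obtain D where D: "\<And>t. D t > 0" "\<And>t s. dist s t < D t \<Longrightarrow> n (h s - h t) < e / 2" by metis
  obtain \<epsilon> where \<epsilon>: "\<epsilon> > 0" "\<And>x. x \<in> {0..2*pi} \<Longrightarrow> \<exists>G\<in>(\<lambda>t. ball t (D t)) ` {0..2*pi}. ball x \<epsilon> \<subseteq> G"
  proof (rule Heine_Borel_lemma[of "{0..2*pi}" "(\<lambda>t. ball t (D t)) ` {0..2*pi}"])
    show "{0..2*pi} \<subseteq> \<Union> ((\<lambda>t. ball t (D t)) ` {0..2*pi})"
    proof
      fix t :: real assume "t \<in> {0..2*pi}"
      moreover have "t \<in> ball t (D t)" using D(1) by simp
      ultimately show "t \<in> \<Union> ((\<lambda>t. ball t (D t)) ` {0..2*pi})" by blast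
    qed
  qed (use that in auto)
  have "n (h s - h t) < e" if st: "\<bar>s - t\<bar> < \<epsilon>" for s t
  proof -
    \<comment> \<open>Only \<open>t\<close> is moved into the fundamental period. The point
      \<open>s\<close> is shifted by the same multiple and may leave it, which the Lebesgue number
      permits because the balls are those of the whole line.\<close>
    define k where "k = - \<lfloor>t / (2 * pi)\<rfloor>"
    have k01: "0 \<le> t / (2 * pi) + of_int k" "t / (2 * pi) + of_int k \<le> 1" unfolding k_def by linarith+
    define t' where "t' = t + 2 * pi * of_int k"
    define s' where "s' = s + 2 * pi * of_int k"
    have "t' = 2 * pi * (t / (2 * pi) + of_int k)" by (simp add: t'_def distrib_left)
    then have "t' \<in> {0..2*pi}" using k01 by (simp add: mult_left_le del: distrib_left_numeral)
    then obtain r where r: "ball t' \<epsilon> \<subseteq> ball r (D r)" using \<epsilon>(2) by blast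
    have "t' \<in> ball t' \<epsilon>" "s' \<in> ball t' \<epsilon>" using \<epsilon>(1) st by (auto simp: t'_def s'_def dist_real_def)
    then have "t' \<in> ball r (D r)" "s' \<in> ball r (D r)" using r by blast+
    then have "n (h t' - h r) < e / 2" "n (h s' - h r) < e / 2"
      using D(2)[of t' r] D(2)[of s' r] by (simp_all add: dist_commute)
    then have "n (h s' - h t') < e"
      using norm_triangle_via[of "h s'" "h r" "h t'"] norm_diff_commute[of "h r" "h t'"] h by fastforce
    then show ?thesis using per by (simp add: s'_def t'_def)
  qed
  with \<epsilon>(1) show ?thesis by blast
qed

section \<open>Periodization by weighted translates\<close>

definition exp_quot :: "complex \<Rightarrow> complex" where
  "exp_quot u = (if u = 0 then 1 else (exp u - 1) / u)"

lemma exp_quot_holomorphic: "exp_quot holomorphic_on UNIV"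
proof -
  have "deriv exp 0 = (1 :: complex)" by (rule DERIV_imp_deriv) (use DERIV_exp[of 0] in simp)
  then have "(\<lambda>z. if z = 0 then deriv exp 0 else (exp z - exp 0) / (z - 0)) = exp_quot"
    by (auto simp: exp_quot_def)
  then show ?thesis
    using pole_lemma_open[OF holomorphic_on_exp[of UNIV] open_UNIV, of 0] by simp
qed

lemma exp_quot_zero: "exp_quot 0 = 1" "k \<noteq> 0 \<Longrightarrow> exp_quot (\<i> * of_real (2 * pi * of_int k)) = 0"
proof -
  have "exp (\<i> * of_real (2 * pi * of_int k)) = 1"
    unfolding exp_eq_1 by auto
  then show "k \<noteq> 0 \<Longrightarrow> exp_quot (\<i> * of_real (2 * pi * of_int k)) = 0" by (simp add: exp_quot_def)
qed (simp add: exp_quot_def)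

text \<open>The weight vanishes at \<open>\<theta> + 2\<pi>\<i>k\<close> for \<open>k \<noteq> 0\<close>, so periodizing with it keeps the value at \<open>\<theta>\<close>.\<close>

definition period_weight :: "real \<Rightarrow> complex \<Rightarrow> complex" where
  "period_weight \<theta> z = (exp_quot (z - of_real \<theta>))\<^sup>2"

lemma period_weight_holomorphic: "period_weight \<theta> holomorphic_on U"
proof -
  have "(exp_quot \<circ> (\<lambda>z. z - of_real \<theta>)) holomorphic_on U"
    by (rule holomorphic_on_compose_gen[OF _ exp_quot_holomorphic]) (auto intro!: holomorphic_intros)
  then show ?thesis unfolding period_weight_def by (intro holomorphic_intros) (simp add: o_def)
qed

text \<open>The square in the weight gives decay of order \<open>1 / c\<^sup>2\<close>, enough to
  sum the translates. The number \<open>4\<close> bounds \<open>exp 1 + 1\<close>, and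
  \<open>16\<close> is its square.\<close>

lemma period_weight_le:
  assumes \<theta>: "0 < \<theta>" "\<theta> < 1" and z: "z \<in> strip" "c \<le> \<bar>Im z\<bar>" "c > 0"
  shows "cmod (period_weight \<theta> z) \<le> 16 / c\<^sup>2"
proof -
  define u where "u = z - of_real \<theta>"
  have u: "c \<le> cmod u" using abs_Im_le_cmod[of u] z by (simp add: u_def)
  then have "u \<noteq> 0" using z by auto
  have "exp (Re u) \<le> exp 1" using z \<theta> by (simp add: u_def strip_def)
  then have "cmod (exp u - 1) \<le> 4"
    using norm_triangle_ineq4[of "exp u" 1] exp_le unfolding norm_exp_eq_Re norm_one by linarith
  then have "cmod (exp_quot u) \<le> 4 / c"
    using u \<open>u \<noteq> 0\<close> z(3) by (simp add: exp_quot_def norm_divide frac_le)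
  from power_mono[OF this, of 2] show ?thesis by (simp add: period_weight_def u_def norm_power power_divide)
qed

lemma period_weight_bounded:
  assumes \<theta>: "0 < \<theta>" "\<theta> < 1"
  obtains B where "\<And>z. z \<in> strip \<Longrightarrow> cmod (period_weight \<theta> z) \<le> B"
proof -
  define Q where "Q = cbox (Complex 0 (- 1)) (Complex 1 1)"
  have "compact (period_weight \<theta> ` Q)"
    using holomorphic_on_imp_continuous_on[OF period_weight_holomorphic] by (intro compact_continuous_image) (auto simp: Q_def)
  from compact_imp_bounded[OF this] obtain B where B: "\<And>z. z \<in> Q \<Longrightarrow> cmod (period_weight \<theta> z) \<le> B"
    unfolding bounded_iff by (metis imageI)
  have "cmod (period_weight \<theta> z) \<le> max B 16" if z: "z \<in> strip" for z
  proof (cases "\<bar>Im z\<bar> \<le> 1")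
    case True
    then have "z \<in> Q" using z by (auto simp: Q_def in_cbox_complex_iff strip_def)
    then show ?thesis using B by (simp add: le_max_iff_disj)
  next
    case False
    then show ?thesis using period_weight_le[OF \<theta> z, of 1] by simp
  qed
  then show thesis by (rule that)
qed

context couple
begin

text \<open>Periodicity makes continuity on the edges uniform, so translation is continuous in the
  norm of \<open>calF\<close>. For an arbitrary element of \<open>calF\<close> this may fail, which
  is why Riemann averages are formed after periodization.\<close>

lemma periodic_uniform_shift:
  assumes f: "f \<in> calF A" and per: "strip_periodic f" and e: "e > 0"
  obtains d where "d > 0" "\<And>\<tau> \<tau>'. \<bar>\<tau> - \<tau>'\<bar> < d \<Longrightarrow> Fb A e (\<lambda>z. f (z + \<i> * of_real \<tau>) - f (z + \<i> * of_real \<tau>'))"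
proof -
  have "\<exists>d>0. \<forall>s t. \<bar>s - t\<bar> < d \<longrightarrow> nm A j (f (bd j s) - f (bd j t)) < e" if j: "j \<in> {0,1}" for j
  proof -
    interpret J: cnormed "smul A" "sp A j" "nm A j" by (rule cnormed_sp[OF j])
    have "f (bd j (t + 2 * pi * of_int k)) = f (bd j t)" for t k
      using strip_periodic_int[OF per bd_strip[OF j], of t k] by (simp only: bd_add)
    then show ?thesis
      using locF_props(4,5)[OF calF_locF[OF f] j] e
      by (intro J.periodic_uniformly_continuous) auto
  qed
  from this[of 0] this[of 1] obtain d0 d1 where
    d0: "d0 > 0" "\<forall>s t. \<bar>s - t\<bar> < d0 \<longrightarrow> nm A 0 (f (bd 0 s) - f (bd 0 t)) < e" and
    d1: "d1 > 0" "\<forall>s t. \<bar>s - t\<bar> < d1 \<longrightarrow> nm A 1 (f (bd 1 s) - f (bd 1 t)) < e" by auto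
  obtain M where M: "Fb A M f" using calF_Fb[OF f] by blast
  have "Fb A e (\<lambda>z. f (z + \<i> * of_real \<tau>) - f (z + \<i> * of_real \<tau>'))" if "\<bar>\<tau> - \<tau>'\<bar> < min d0 d1" for \<tau> \<tau>'
  proof -
    have "(\<lambda>z. f (z + \<i> * of_real \<tau>) - f (z + \<i> * of_real \<tau>')) \<in> calF A"
      using Fb_diff[OF Fb_shift[OF M, of \<tau>] Fb_shift[OF M, of \<tau>']] by (rule FbD)
    moreover have "nm A 0 (f (bd 0 t + \<i> * of_real \<tau>) - f (bd 0 t + \<i> * of_real \<tau>')) < e"
      "nm A 1 (f (bd 1 t + \<i> * of_real \<tau>) - f (bd 1 t + \<i> * of_real \<tau>')) < e" for t
      unfolding bd_add using d0(2) d1(2) that by auto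
    ultimately show ?thesis by (auto simp: Fb_def less_imp_le)
  qed
  then show thesis using that[of "min d0 d1"] d0(1) d1(1) by simp
qed

text \<open>The sum of all translates of the weighted function by multiples of
  \<open>2 * pi * i\<close> converges locally uniformly, which gives only regularity at first.
  Boundedness follows afterwards: the limit is periodic, and one period is controlled by a single
  partial sum.\<close>

lemma periodize:
  assumes f: "f \<in> calF A" and \<theta>: "0 < \<theta>" "\<theta> < 1"
  obtains g where "g \<in> calF A" "strip_periodic g" "g (of_real \<theta>) = f (of_real \<theta>)"
proof -
  obtain M where M: "M > 0" "Fb A M f" using calF_Fb[OF f] by blast
  obtain B where B: "\<And>z. z \<in> strip \<Longrightarrow> cmod (period_weight \<theta> z) \<le> B" using period_weight_bounded[OF \<theta>] by blast
  define \<phi> where "\<phi> z = smul A (period_weight \<theta> z) (f z)" for z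
  have \<phi>: "Fb A (B * M) \<phi>"
    unfolding \<phi>_def
  proof (rule Fb_scale[OF M(2) _ period_weight_holomorphic B])
    show "continuous_on strip (period_weight \<theta>)" by (rule holomorphic_on_imp_continuous_on[OF period_weight_holomorphic])
    show "cmod (period_weight \<theta> (bd j t)) \<le> B" if "j \<in> {0,1}" for j t using B bd_strip[OF that] by blast
  qed
  define \<tau> where "\<tau> k z = \<phi> (z + \<i> * of_real (2 * pi * of_int k))" for k z
  have \<tau>: "Fb A (B * M) (\<tau> k)" for k unfolding \<tau>_def by (rule Fb_shift[OF \<phi>])
  note \<tau>D = locF_props[OF calF_locF[OF FbD(1)[OF \<tau>]]] and fD = locF_props[OF calF_locF[OF f]]
  \<comment> \<open>Pairing the translates \<open>k\<close> and \<open>- k\<close> turns the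
    two-sided sum into a series over the naturals; the term \<open>k = 0\<close> must not be
    doubled.\<close>
  define s where "s k z = (if k = 0 then \<tau> 0 z else \<tau> (int k) z + \<tau> (- int k) z)" for k z
  define F where "F m z = (\<Sum>k<m. s k z)" for m z
  have sF: "\<exists>M. Fb A M (s k)" for k
    unfolding s_def[abs_def] using Fb_add[OF \<tau> \<tau>] \<tau> by (cases "k = 0") auto
  then obtain Ms where Ms: "\<And>k. Fb A (Ms k) (s k)" by metis
  have FF: "F m \<in> calF A" for m
    unfolding F_def[abs_def] by (rule FbD(1)[OF Fb_sum[OF Ms]])
  note sD = locF_props[OF calF_locF[OF FbD(1)[OF Ms]]] and FD = locF_props[OF calF_locF[OF FF]]
  have period_weight_shift: "cmod (period_weight \<theta> (z + \<i> * of_real (2 * pi * of_int k))) \<le> 16 / (of_int k)\<^sup>2"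
    if z: "z \<in> strip" "\<bar>Im z\<bar> \<le> R" and k: "R \<le> \<bar>of_int k\<bar>" "k \<noteq> 0" for z k R
  proof -
    have "\<bar>of_int k\<bar> \<le> \<bar>Im (z + \<i> * of_real (2 * pi * of_int k))\<bar>"
    proof -
      have "3 * \<bar>of_int k\<bar> \<le> pi * \<bar>of_int k\<bar>" using pi_gt3 by (intro mult_right_mono) auto
      then have "2 * \<bar>of_int k\<bar> \<le> \<bar>2 * pi * of_int k\<bar>" by (simp add: abs_mult)
      then show ?thesis using z(2) k(1) by simp
    qed
    from period_weight_le[OF \<theta> strip_shift[OF z(1)] this] k(2) show ?thesis by simp
  qed
  define a where "a k = 32 * M / (real k)\<^sup>2" for k
  have bS: "N (s k z) \<le> a k" if z: "z \<in> strip" "\<bar>Im z\<bar> \<le> R" and k: "R \<le> real k" "k \<noteq> 0" for z k R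
  proof -
    have 1: "N (\<tau> i z) \<le> 16 / (real k)\<^sup>2 * M" if i: "\<bar>i\<bar> = int k" for i
    proof -
      have ik: "\<bar>of_int i\<bar> = real k" "(of_int i)\<^sup>2 = (real k)\<^sup>2"
        using i by (metis of_int_abs of_int_of_nat_eq, metis of_int_abs of_int_of_nat_eq power2_abs)
      have "N (\<tau> i z) = cmod (period_weight \<theta> (z + \<i> * of_real (2 * pi * of_int i))) * N (f (z + \<i> * of_real (2 * pi * of_int i)))"
        unfolding \<tau>_def \<phi>_def using fD(1)[OF strip_shift[OF z(1)]] by (intro E.norm_scale)
      also have "\<dots> \<le> 16 / (real k)\<^sup>2 * M"
        using period_weight_shift[OF z, of i] k i ik Fb_sum_norm_le[OF M(2) strip_shift[OF z(1), of "2 * pi * of_int i"]]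
          sum_norm_nonneg[OF fD(1)[OF strip_shift[OF z(1), of "2 * pi * of_int i"]]] by (intro mult_mono) auto
      finally show ?thesis .
    qed
    have "N (s k z) \<le> N (\<tau> (int k) z) + N (\<tau> (- int k) z)"
      using k(2) E.norm_triangle[OF \<tau>D(1)[OF z(1)] \<tau>D(1)[OF z(1)]] by (simp add: s_def)
    also have "\<dots> \<le> 16 / (real k)\<^sup>2 * M + 16 / (real k)\<^sup>2 * M" by (intro add_mono 1) auto
    also have "\<dots> = a k" by (simp add: a_def)
    finally show ?thesis .
  qed
  have bB: "nm A j (s k (bd j t)) \<le> a k" if j: "j \<in> {0,1}" and t: "\<bar>t\<bar> \<le> R" and k: "R \<le> real k" "k \<noteq> 0" for j k t R
  proof -
    interpret J: cnormed "smul A" "sp A j" "nm A j" by (rule cnormed_sp[OF j])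
    have It: "\<bar>Im (bd j t)\<bar> \<le> R" using t by (simp add: bd_def)
    have 1: "nm A j (\<tau> i (bd j t)) \<le> 16 / (real k)\<^sup>2 * M" if i: "\<bar>i\<bar> = int k" for i
    proof -
      have ik: "\<bar>of_int i\<bar> = real k" "(of_int i)\<^sup>2 = (real k)\<^sup>2"
        using i by (metis of_int_abs of_int_of_nat_eq, metis of_int_abs of_int_of_nat_eq power2_abs)
      have m: "f (bd j t + \<i> * of_real (2 * pi * of_int i)) \<in> sp A j"
        "nm A j (f (bd j t + \<i> * of_real (2 * pi * of_int i))) \<le> M"
        unfolding bd_add using fD(4)[OF j] FbD(2)[OF M(2) j] by auto
      have "nm A j (\<tau> i (bd j t)) = cmod (period_weight \<theta> (bd j t + \<i> * of_real (2 * pi * of_int i)))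
          * nm A j (f (bd j t + \<i> * of_real (2 * pi * of_int i)))"
        unfolding \<tau>_def \<phi>_def using m by (intro J.norm_scale)
      also have "\<dots> \<le> 16 / (real k)\<^sup>2 * M"
        using period_weight_shift[OF bd_strip[OF j] It, of i] k i ik m J.norm_ge_zero[OF m(1)] by (intro mult_mono) auto
      finally show ?thesis .
    qed
    have "nm A j (s k (bd j t)) \<le> nm A j (\<tau> (int k) (bd j t)) + nm A j (\<tau> (- int k) (bd j t))"
      using k(2) J.norm_triangle[OF \<tau>D(4)[OF j] \<tau>D(4)[OF j]] by (simp add: s_def)
    also have "\<dots> \<le> 16 / (real k)\<^sup>2 * M + 16 / (real k)\<^sup>2 * M" by (intro add_mono 1) auto
    also have "\<dots> = a k" by (simp add: a_def)
    finally show ?thesis .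
  qed
  have "summable a"
    using summable_mult[OF inverse_power_summable[of 2, where ?'a = real], of "32 * M"]
    by (simp add: a_def[abs_def] field_simps)
  then have tail: "\<exists>K. \<forall>m\<ge>K. \<forall>l. (\<Sum>k=m..<l. a k) < e" if "e > 0" for e
    unfolding summable_Cauchy using that by (metis abs_ge_self le_less_trans real_norm_def)
  have F_diff: "F l z - F m z = (\<Sum>k=m..<l. s k z)" if "m \<le> l" for l m z
    using that by (simp add: F_def lessThan_atLeast0 sum_diff_nat_ivl)
  have cS: "\<exists>K. \<forall>m\<ge>K. \<forall>k\<ge>K. \<forall>z\<in>strip. \<bar>Im z\<bar> \<le> R \<longrightarrow> N (F m z - F k z) < e" if e: "e > 0" for R e
  proof -
    obtain K where K: "\<forall>m\<ge>K. \<forall>l. (\<Sum>k=m..<l. a k) < e" using tail[OF e] by blast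
    define K' where "K' = max K (Suc (nat \<lceil>R\<rceil>))"
    have le: "N (F l z - F m z) < e" if "m \<ge> K'" "m \<le> l" "z \<in> strip" "\<bar>Im z\<bar> \<le> R" for l m z
    proof -
      have "N (F l z - F m z) \<le> (\<Sum>k=m..<l. N (s k z))"
        unfolding F_diff[OF that(2)] using sD(1)[OF that(3)] by (intro E.norm_sum)
      also have "\<dots> \<le> (\<Sum>k=m..<l. a k)"
      proof (intro sum_mono bS[OF that(3,4)])
        fix k assume "k \<in> {m..<l}"
        then have "Suc (nat \<lceil>R\<rceil>) \<le> k" using that(1) by (simp add: K'_def)
        then show "R \<le> real k" "k \<noteq> 0" by linarith+
      qed
      also have "\<dots> < e" using K that(1) by (simp add: K'_def)
      finally show ?thesis .
    qed
    have "N (F m z - F k z) < e" if "m \<ge> K'" "k \<ge> K'" "z \<in> strip" "\<bar>Im z\<bar> \<le> R" for m k z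
    proof (cases "k \<le> m")
      case True
      then show ?thesis using le that by auto
    next
      case False
      then show ?thesis
        using le[of m k z] that E.norm_diff_commute[of "F m z" "F k z"] FD(1)[OF that(3)] by auto
    qed
    then show ?thesis by blast
  qed
  have cB: "\<exists>K. \<forall>m\<ge>K. \<forall>k\<ge>K. \<forall>t. \<bar>t\<bar> \<le> R \<longrightarrow> nm A j (F m (bd j t) - F k (bd j t)) < e"
    if j: "j \<in> {0,1}" and e: "e > 0" for j R e
  proof -
    interpret J: cnormed "smul A" "sp A j" "nm A j" by (rule cnormed_sp[OF j])
    obtain K where K: "\<forall>m\<ge>K. \<forall>l. (\<Sum>k=m..<l. a k) < e" using tail[OF e] by blast
    define K' where "K' = max K (Suc (nat \<lceil>R\<rceil>))"
    have le: "nm A j (F l (bd j t) - F m (bd j t)) < e" if "m \<ge> K'" "m \<le> l" "\<bar>t\<bar> \<le> R" for l m t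
    proof -
      have "nm A j (F l (bd j t) - F m (bd j t)) \<le> (\<Sum>k=m..<l. nm A j (s k (bd j t)))"
        unfolding F_diff[OF that(2)] using sD(4)[OF j] by (intro J.norm_sum)
      also have "\<dots> \<le> (\<Sum>k=m..<l. a k)"
      proof (intro sum_mono bB[OF j that(3)])
        fix k assume "k \<in> {m..<l}"
        then have "Suc (nat \<lceil>R\<rceil>) \<le> k" using that(1) by (simp add: K'_def)
        then show "R \<le> real k" "k \<noteq> 0" by linarith+
      qed
      also have "\<dots> < e" using K that(1) by (simp add: K'_def)
      finally show ?thesis .
    qed
    have "nm A j (F m (bd j t) - F k (bd j t)) < e" if "m \<ge> K'" "k \<ge> K'" "\<bar>t\<bar> \<le> R" for m k t
    proof (cases "k \<le> m")
      case True
      then show ?thesis using le that by auto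
    next
      case False
      then show ?thesis
        using le[of m k t] that J.norm_diff_commute[of "F m (bd j t)" "F k (bd j t)"] FD(4)[OF j] by auto
    qed
    then show ?thesis by blast
  qed
  have "\<exists>g. locF g \<and>
    (\<forall>R. \<forall>e>0. \<exists>K. \<forall>k\<ge>K. \<forall>z\<in>strip. \<bar>Im z\<bar> \<le> R \<longrightarrow> N (F k z - g z) < e) \<and>
    (\<forall>j\<in>{0,1}. \<forall>R. \<forall>e>0. \<exists>K. \<forall>k\<ge>K. \<forall>t. \<bar>t\<bar> \<le> R \<longrightarrow> nm A j (F k (bd j t) - g (bd j t)) < e)"
    by (rule locF_limit) (rule calF_locF[OF FF], rule cS, assumption, rule cB, assumption+)
  then obtain g where g: "locF g"
    "\<forall>R. \<forall>e>0. \<exists>K. \<forall>k\<ge>K. \<forall>z\<in>strip. \<bar>Im z\<bar> \<le> R \<longrightarrow> N (F k z - g z) < e"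
    "\<forall>j\<in>{0,1}. \<forall>R. \<forall>e>0. \<exists>K. \<forall>k\<ge>K. \<forall>t. \<bar>t\<bar> \<le> R \<longrightarrow> nm A j (F k (bd j t) - g (bd j t)) < e"
    by (elim exE conjE)
  note gD = locF_props[OF g(1)]
  have lim: "(\<lambda>k. N (F k z - g z)) \<longlonglongrightarrow> 0" if z: "z \<in> strip" for z
  proof (rule LIMSEQ_I)
    fix r :: real assume "r > 0"
    with g(2) obtain K where K: "\<forall>k\<ge>K. \<forall>w\<in>strip. \<bar>Im w\<bar> \<le> \<bar>Im z\<bar> \<longrightarrow> N (F k w - g w) < r" by blast
    have "norm (N (F k z - g z) - 0) < r" if "k \<ge> K" for k
      using K z that sum_norm_nonneg[of "F k z - g z"] FD(1) gD(1) by auto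
    then show "\<exists>no. \<forall>n\<ge>no. norm (N (F n z - g z) - 0) < r" by blast
  qed
  have per: "strip_periodic g"
    unfolding strip_periodic_def
  proof
    fix z assume z: "z \<in> strip"
    define z' where "z' = z + \<i> * of_real (2 * pi)"
    have z': "z' \<in> strip" using strip_shift[OF z, of "2 * pi"] by (simp add: z'_def)
    have \<tau>z': "\<tau> k z' = \<tau> (k + 1) z" for k
      by (simp add: \<tau>_def z'_def algebra_simps)
    \<comment> \<open>A translation by one period moves the window of summation by one place: the
      translate \<open>m + 1\<close> is gained and \<open>- m\<close> is lost, and both tend to
      \<open>0\<close>.\<close>
    have tel: "F (Suc m) z' - F (Suc m) z = \<tau> (int m + 1) z - \<tau> (- int m) z" for m
    proof (induction m)
      case 0
      then show ?case by (simp add: F_def s_def \<tau>z')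
    next
      case (Suc m)
      have st: "F (Suc (Suc m)) y = F (Suc m) y + (\<tau> (int (Suc m)) y + \<tau> (- int (Suc m)) y)" for y
        by (simp add: F_def s_def)
      have i: "int (Suc m) = int m + 1" "- int (Suc m) + 1 = - int m" by auto
      show ?case
        unfolding st \<tau>z' i(2) unfolding i(1) using Suc by (simp add: algebra_simps)
    qed
    have le: "N (F (Suc k) z' - F (Suc k) z) \<le> 2 * (16 / (real k)\<^sup>2 * M)" if k: "k \<noteq> 0" "\<bar>Im z\<bar> \<le> real k" for k
    proof -
      have 1: "N (\<tau> i z) \<le> 16 / (real k)\<^sup>2 * M" if i: "int k \<le> \<bar>i\<bar>" for i
      proof -
        have ki: "real k \<le> \<bar>of_int i\<bar>" using i by linarith
        have "i \<noteq> 0" using i k by auto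
        have "N (\<tau> i z) = cmod (period_weight \<theta> (z + \<i> * of_real (2 * pi * of_int i))) * N (f (z + \<i> * of_real (2 * pi * of_int i)))"
          unfolding \<tau>_def \<phi>_def using fD(1)[OF strip_shift[OF z(1)]] by (intro E.norm_scale)
        also have "\<dots> \<le> 16 / (of_int i)\<^sup>2 * M"
          using period_weight_shift[OF z order_refl, of i] k ki \<open>i \<noteq> 0\<close> Fb_sum_norm_le[OF M(2) strip_shift[OF z(1), of "2 * pi * of_int i"]]
            sum_norm_nonneg[OF fD(1)[OF strip_shift[OF z(1), of "2 * pi * of_int i"]]] by (intro mult_mono) auto
        also have "\<dots> \<le> 16 / (real k)\<^sup>2 * M"
          using power_mono[OF ki, of 2] k M(1) by (intro mult_right_mono frac_le) auto
        finally show ?thesis .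
      qed
      show ?thesis
        unfolding tel using E.norm_triangle_diff[OF \<tau>D(1)[OF z] \<tau>D(1)[OF z], of "int k + 1" "- int k"]
          1[of "int k + 1"] 1[of "- int k"] by simp
    qed
    have z0: "(\<lambda>k. 2 * (16 / (real k)\<^sup>2 * M)) \<longlonglongrightarrow> 0" by real_asymp
    have "(\<lambda>k. N (F (Suc k) z' - F (Suc k) z)) \<longlonglongrightarrow> 0"
    proof (rule Lim_null_comparison[OF _ z0])
      have "\<forall>\<^sub>F k in sequentially. k \<ge> Suc (nat \<lceil>\<bar>Im z\<bar>\<rceil>)" by (rule eventually_ge_at_top)
      then show "\<forall>\<^sub>F k in sequentially. norm (N (F (Suc k) z' - F (Suc k) z)) \<le> 2 * (16 / (real k)\<^sup>2 * M)"
      proof eventually_elim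
        case (elim k)
        then have "k \<noteq> 0" "\<bar>Im z\<bar> \<le> real k" by linarith+
        from le[OF this] show ?case
          using sum_norm_nonneg[of "F (Suc k) z' - F (Suc k) z"] FD(1) z z' by auto
      qed
    qed
    from tendsto_add[OF this LIMSEQ_Suc[OF lim[OF z]]]
    have "(\<lambda>k. N (F (Suc k) z' - F (Suc k) z) + N (F (Suc k) z - g z)) \<longlonglongrightarrow> 0" by simp
    then have "(\<lambda>k. N (F (Suc k) z' - g z)) \<longlonglongrightarrow> 0"
    proof (rule Lim_null_comparison[rotated])
      have "norm (N (F (Suc k) z' - g z)) \<le> N (F (Suc k) z' - F (Suc k) z) + N (F (Suc k) z - g z)" for k
        using E.norm_triangle_via[OF FD(1)[OF z'] FD(1)[OF z] gD(1)[OF z]]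
          sum_norm_nonneg[of "F (Suc k) z' - g z"] FD(1)[OF z'] gD(1)[OF z] by auto
      then show "\<forall>\<^sub>F k in sequentially. norm (N (F (Suc k) z' - g z))
          \<le> N (F (Suc k) z' - F (Suc k) z) + N (F (Suc k) z - g z)" by simp
    qed
    then show "g (z + \<i> * of_real (2 * pi)) = g z"
      using E.limit_unique[of "\<lambda>k. F (Suc k) z'" "g z'" "g z"] LIMSEQ_Suc[OF lim[OF z']] FD(1)[OF z'] gD(1) z z'
      by (simp add: z'_def)
  qed
  have "g \<in> calF A"
    unfolding calF_iff
  proof (intro conjI ballI g(1))
    \<comment> \<open>Closeness to one partial sum over a single period suffices, since periodicity
      of \<open>g\<close> carries the bound to the whole strip.\<close>
    obtain K where K: "\<forall>k\<ge>K. \<forall>z\<in>strip. \<bar>Im z\<bar> \<le> 2 * pi \<longrightarrow> N (F k z - g z) < 1"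
      using g(2) zero_less_one by blast
    obtain C where C: "\<And>z. z \<in> strip \<Longrightarrow> N (F K z) \<le> C" using calF_bounded[OF FF] by metis
    have "N (g z) \<le> 1 + C" if z: "z \<in> strip" for z
    proof -
      obtain z' k where z': "z' \<in> strip" "0 \<le> Im z'" "Im z' \<le> 2 * pi" "g z' = g z"
        by (rule strip_periodic_reduce[OF per z]) (rule that)
      have "N (F K z' - g z') < 1" using K[rule_format, OF order_refl z'(1)] z'(2,3) by simp
      then show ?thesis
        using E.norm_le_via[OF gD(1)[OF z'(1)] FD(1)[OF z'(1)], of K] C[OF z'(1)] z'(4)
          E.norm_diff_commute[OF gD(1)[OF z'(1)] FD(1)[OF z'(1)], of K] by simp
    qed
    then show "\<exists>B. \<forall>z\<in>strip. N (g z) \<le> B" by blast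
    fix j :: nat assume j: "j \<in> {0,1}"
    interpret J: cnormed "smul A" "sp A j" "nm A j" by (rule cnormed_sp[OF j])
    obtain K where K: "\<forall>k\<ge>K. \<forall>t. \<bar>t\<bar> \<le> 2 * pi \<longrightarrow> nm A j (F k (bd j t) - g (bd j t)) < 1"
      using g(3) j zero_less_one by blast
    obtain C where C: "Fb A C (F K)" using calF_Fb[OF FF] by metis
    have "nm A j (g (bd j t)) \<le> 1 + C" for t
    proof -
      obtain z' k where z': "0 \<le> Im z'" "Im z' \<le> 2 * pi" "g z' = g (bd j t)"
        "z' = bd j t + \<i> * of_real (2 * pi * of_int k)"
        by (rule strip_periodic_reduce[OF per bd_strip[OF j]]) (rule that)
      define t' where "t' = t + 2 * pi * of_int k"
      have eq: "z' = bd j t'" using z'(4) by (simp only: bd_add t'_def)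
      then have "\<bar>t'\<bar> \<le> 2 * pi" using z'(1,2) by (simp add: bd_def)
      then have "nm A j (F K (bd j t') - g (bd j t')) < 1" using K by blast
      then show ?thesis
        using J.norm_le_via[OF gD(4)[OF j, of t'] FD(4)[OF j, of K t']] FbD(2)[OF C j, of t'] z'(3)
          J.norm_diff_commute[OF gD(4)[OF j, of t'] FD(4)[OF j, of K t']] by (simp add: eq)
    qed
    then show "\<exists>B. \<forall>t. nm A j (g (bd j t)) \<le> B" by blast
  qed
  moreover have "g (of_real \<theta>) = f (of_real \<theta>)"
  proof -
    define c where "c = complex_of_real \<theta>"
    have c: "c \<in> strip" using \<theta> by (simp add: c_def strip_def)
    have "\<tau> k c = (if k = 0 then f c else 0)" for k
      using exp_quot_zero(2)[of k] by (simp add: \<tau>_def \<phi>_def period_weight_def c_def exp_quot_zero(1))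
    then have "s k c = (if k = 0 then f c else 0)" for k by (simp add: s_def)
    then have "F (Suc m) c = f c" for m by (simp add: F_def)
    then have "(\<lambda>k. N (F (Suc k) c - f c)) \<longlonglongrightarrow> 0" by simp
    then show ?thesis
      using E.limit_unique[of "\<lambda>k. F (Suc k) c" "g c" "f c"] LIMSEQ_Suc[OF lim[OF c]] FD(1)[OF c] gD(1)[OF c] fD(1)[OF c]
      by (simp add: c_def)
  qed
  ultimately show thesis using per by (intro that)
qed

end

section \<open>Riemann averages of vertical translates\<close>

lemma sum_div_group:
  fixes \<phi> :: "nat \<Rightarrow> 'b::comm_monoid_add"
  assumes "n > 0"
  shows "(\<Sum>k<m * n. \<phi> (k div n)) = (\<Sum>q<m. \<Sum>i<n. \<phi> q)"
proof (induction m)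
  case (Suc m)
  have "(\<Sum>k<m * n + n. \<phi> (k div n)) = (\<Sum>k<m * n. \<phi> (k div n)) + (\<Sum>i<n. \<phi> ((m * n + i) div n))"
    by (rule sum_lessThan_add)
  also have "(\<Sum>i<n. \<phi> ((m * n + i) div n)) = (\<Sum>i<n. \<phi> m)"
    using assms by (intro sum.cong) auto
  finally show ?case using Suc by (simp add: add.commute)
qed simp

text \<open>Each fine node is compared with the coarse node at or to the left of it, at a distance
  of at most one coarse mesh width.\<close>

lemma node_refine:
  assumes "k < 2 ^ (r + d)"
  shows "k div 2 ^ d < 2 ^ r" "\<bar>node (r + d) k - node r (k div 2 ^ d)\<bar> \<le> 2 * pi / 2 ^ r"
proof -
  show "k div 2 ^ d < 2 ^ r" using assms by (simp add: less_mult_imp_div_less power_add)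
  define u where "u = real (k mod 2 ^ d)"
  have "real k = real (k div 2 ^ d * 2 ^ d + k mod 2 ^ d)" by (simp only: div_mult_mod_eq)
  then have "real k = real (k div 2 ^ d) * 2 ^ d + u"
    unfolding u_def by (simp only: of_nat_add of_nat_mult of_nat_power of_nat_numeral)
  then have "node (r + d) k - node r (k div 2 ^ d) = 2 * pi * u / 2 ^ (r + d)"
    by (simp add: node_def power_add field_simps)
  then have "\<bar>node (r + d) k - node r (k div 2 ^ d)\<bar> = 2 * pi * u / 2 ^ (r + d)"
    by (simp add: u_def)
  also have "\<dots> \<le> 2 * pi * 2 ^ d / 2 ^ (r + d)"
  proof -
    have "k mod 2 ^ d \<le> 2 ^ d" by (simp add: less_imp_le)
    from of_nat_mono[OF this] have "u \<le> 2 ^ d" by (simp add: u_def)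
    then show ?thesis by (intro divide_right_mono mult_left_mono) auto
  qed
  also have "\<dots> = 2 * pi / 2 ^ r" by (simp add: power_add)
  finally show "\<bar>node (r + d) k - node r (k div 2 ^ d)\<bar> \<le> 2 * pi / 2 ^ r" .
qed

context couple
begin

lemma sum_const_smul: "(\<Sum>i<m. c) = smul A (of_nat m) c" for m :: nat
  by (induction m) (auto simp: E0.scale_left_distrib add.commute)

text \<open>The kernel depends on the node and not on \<open>z\<close>, so every average is a fixed
  combination of translates of \<open>f\<close> and stays in \<open>calF\<close>. Continuity of
  translation makes the dyadic averages Cauchy there; their limit is a vector-valued integral for
  all \<open>z\<close> at once.\<close>

lemma riemann_average:
  assumes f: "f \<in> calF A" and per: "strip_periodic f" and K: "continuous_on {0..2*pi} K"
  obtains G where "G \<in> calF A" "\<And>z. z \<in> strip \<Longrightarrow>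
    (\<lambda>r. N (smul A (1 / 2 ^ r) (\<Sum>k<2 ^ r. smul A (K (node r k)) (f (z + \<i> * of_real (node r k)))) - G z)) \<longlonglongrightarrow> 0"
proof -
  define g where "g t z = smul A (K t) (f (z + \<i> * of_real t))" for t z
  define R where "R r z = smul A (1 / 2 ^ r) (\<Sum>k<2 ^ r. g (node r k) z)" for r z
  obtain M where M: "M > 0" "Fb A M f" using calF_Fb[OF f] by blast
  have gFb: "Fb A (cmod (K t) * M) (g t)" for t
    unfolding g_def[abs_def] by (intro Fb_scale_const Fb_shift M)
  obtain BK where BK: "BK > 0" "\<And>t. t \<in> {0..2*pi} \<Longrightarrow> cmod (K t) \<le> BK"
    using compact_imp_bounded[OF compact_continuous_image[OF K compact_Icc]] unfolding bounded_pos by auto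
  have ucK: "uniformly_continuous_on {0..2*pi} K" by (rule compact_uniformly_continuous[OF K compact_Icc])
  have modulus: "\<exists>d>0. \<forall>t\<in>{0..2*pi}. \<forall>t'\<in>{0..2*pi}. \<bar>t - t'\<bar> < d \<longrightarrow> Fb A e (\<lambda>z. g t z - g t' z)"
    if e: "e > 0" for e
  proof -
    have e1: "e / (2 * BK) > 0" and e2: "e / (2 * M) > 0" using e BK M by auto
    obtain d1 where d1: "d1 > 0"
      "\<And>t t'. \<bar>t - t'\<bar> < d1 \<Longrightarrow> Fb A (e / (2 * BK)) (\<lambda>z. f (z + \<i> * of_real t) - f (z + \<i> * of_real t'))"
      by (rule periodic_uniform_shift[OF f per e1]) (rule that)
    obtain d2 where d2: "d2 > 0"
      "\<forall>t\<in>{0..2*pi}. \<forall>t'\<in>{0..2*pi}. \<bar>t' - t\<bar> < d2 \<longrightarrow> cmod (K t' - K t) < e / (2 * M)"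
      using ucK[unfolded uniformly_continuous_on_def, rule_format, OF e2] unfolding dist_norm real_norm_def by blast
    have "Fb A e (\<lambda>z. g t z - g t' z)" if t: "t \<in> {0..2*pi}" "t' \<in> {0..2*pi}" "\<bar>t - t'\<bar> < min d1 d2" for t t'
    proof -
      have 1: "Fb A (e / 2) (\<lambda>z. smul A (K t) (f (z + \<i> * of_real t) - f (z + \<i> * of_real t')))"
      proof (rule Fb_mono[OF Fb_scale_const[OF d1(2)]])
        show "\<bar>t - t'\<bar> < d1" using t by simp
        have "cmod (K t) * (e / (2 * BK)) \<le> BK * (e / (2 * BK))"
          using BK t e by (intro mult_right_mono) auto
        then show "cmod (K t) * (e / (2 * BK)) \<le> e / 2" using BK(1) by simp
      qed
      have 2: "Fb A (e / 2) (\<lambda>z. smul A (K t - K t') (f (z + \<i> * of_real t')))"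
      proof (rule Fb_mono[OF Fb_scale_const[OF Fb_shift[OF M(2)]]])
        have "cmod (K t - K t') * M \<le> e / (2 * M) * M"
          using d2(2)[rule_format, of t' t] t M by (intro mult_right_mono) auto
        then show "cmod (K t - K t') * M \<le> e / 2" using M(1) by simp
      qed
      from Fb_add[OF 1 2] show ?thesis
        by (simp add: g_def E0.scale_right_diff_distrib E0.scale_left_diff_distrib)
    qed
    then show ?thesis using d1(1) d2(1) by (intro exI[of _ "min d1 d2"]) auto
  qed
  have RF: "R r \<in> calF A" for r
    unfolding R_def[abs_def] by (rule FbD(1)[OF Fb_scale_const[OF Fb_sum[OF gFb]]])
  \<comment> \<open>The coarse average is rewritten on the fine mesh by repeating each coarse node
    \<open>2 ^ d\<close> times, so that the difference is an average of small differences.\<close>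
  have refine: "R (r + d) z - R r z
      = smul A (1 / 2 ^ (r + d)) (\<Sum>k<2 ^ (r + d). g (node (r + d) k) z - g (node r (k div 2 ^ d)) z)" for r d z
  proof -
    have "(\<Sum>k<2 ^ (r + d). g (node r (k div 2 ^ d)) z) = (\<Sum>q<2 ^ r. smul A (of_nat (2 ^ d)) (g (node r q) z))"
      using sum_div_group[of "2 ^ d" "\<lambda>q. g (node r q) z" "2 ^ r"] by (simp only: power_add sum_const_smul) simp
    also have "\<dots> = smul A (2 ^ d) (\<Sum>q<2 ^ r. g (node r q) z)" by (simp add: E0.scale_sum_right)
    finally have "smul A (1 / 2 ^ (r + d)) (\<Sum>k<2 ^ (r + d). g (node r (k div 2 ^ d)) z) = R r z"
      by (simp add: R_def power_add)
    then show ?thesis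
      by (simp add: R_def sum_subtractf E0.scale_right_diff_distrib)
  qed
  obtain G where G: "G \<in> calF A" "\<And>e. e > 0 \<Longrightarrow> \<exists>r0. \<forall>r\<ge>r0. Fb A e (\<lambda>z. R r z - G z)"
  proof (rule Fb_cauchy_limit[OF RF])
    fix e :: real assume e: "e > 0"
    obtain d where d: "d > 0"
      "\<forall>t\<in>{0..2*pi}. \<forall>t'\<in>{0..2*pi}. \<bar>t - t'\<bar> < d \<longrightarrow> Fb A e (\<lambda>z. g t z - g t' z)"
      using modulus[OF e] by blast
    have "(\<lambda>r. 2 * pi / 2 ^ r) \<longlonglongrightarrow> 0" by real_asymp
    then have "\<forall>\<^sub>F r in sequentially. 2 * pi / 2 ^ r < d" using d(1) by (rule order_tendstoD)
    then obtain r0 where r0: "\<And>r. r \<ge> r0 \<Longrightarrow> 2 * pi / 2 ^ r < d" unfolding eventually_sequentially by blast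
    have le: "Fb A e (\<lambda>z. R (r + l) z - R r z)" if r: "r \<ge> r0" for r l
    proof -
      have "Fb A e (\<lambda>z. g (node (r + l) k) z - g (node r (k div 2 ^ l)) z)" if k: "k < 2 ^ (r + l)" for k
        using d(2) node_bounds[OF k] node_bounds[OF node_refine(1)[OF k]] node_refine(2)[OF k] r0[OF r] by auto
      then have "Fb A (\<Sum>k<(2::nat) ^ (r + l). e) (\<lambda>z. \<Sum>k<2 ^ (r + l). g (node (r + l) k) z - g (node r (k div 2 ^ l)) z)"
        by (intro Fb_sum) auto
      from Fb_scale_const[OF this, of "1 / 2 ^ (r + l)"] show ?thesis
        unfolding refine by (simp add: norm_divide norm_power)
    qed
    have "Fb A e (\<lambda>z. R m z - R k z)" if "m \<ge> r0" "k \<ge> r0" for m k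
    proof (cases "k \<le> m")
      case True
      then show ?thesis using le[of k "m - k"] that by simp
    next
      case False
      then have "Fb A e (\<lambda>z. R k z - R m z)" using le[of m "k - m"] that by simp
      from Fb_scale_const[OF this, of "-1"] show ?thesis by (simp add: E0.scale_minus_left)
    qed
    then show "\<exists>K. \<forall>m\<ge>K. \<forall>k\<ge>K. Fb A e (\<lambda>z. R m z - R k z)" by blast
  qed (rule that)
  show thesis
  proof (rule that[OF G(1)])
    fix z assume z: "z \<in> strip"
    have "(\<lambda>r. N (R r z - G z)) \<longlonglongrightarrow> 0"
    proof (rule LIMSEQ_I)
      fix e :: real assume "e > 0"
      then obtain r0 where r0: "\<forall>r\<ge>r0. Fb A (e / 2) (\<lambda>z. R r z - G z)" using G(2)[of "e / 2"] by auto
      have "norm (N (R r z - G z) - 0) < e" if "r \<ge> r0" for r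
      proof -
        have "R r z - G z \<in> S" using locF_props(1)[OF calF_locF z] RF G(1) by auto
        then show ?thesis
          using Fb_sum_norm_le[OF r0[rule_format, OF that] z] \<open>e > 0\<close> sum_norm_nonneg by auto
      qed
      then show "\<exists>no. \<forall>r\<ge>no. norm (N (R r z - G z) - 0) < e" by blast
    qed
    then show "(\<lambda>r. N (smul A (1 / 2 ^ r) (\<Sum>k<2 ^ r. smul A (K (node r k)) (f (z + \<i> * of_real (node r k)))) - G z)) \<longlonglongrightarrow> 0"
      by (simp add: R_def g_def)
  qed
qed

end

section \<open>Splitting of interpolation space elements\<close>

text \<open>The denominator vanishes at all points \<open>\<theta> + 2 * pi * i * k\<close>, and by
  periodicity so does the numerator; hence all singularities are removable. This is the purpose of
  the periodization.\<close>

lemma periodic_difference_quotient: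
  fixes g :: "complex \<Rightarrow> complex"
  assumes cont: "continuous_on strip g" and hol: "g holomorphic_on ostrip" and per: "strip_periodic g"
    and \<theta>: "0 < \<theta>" "\<theta> < 1"
  obtains h where "continuous_on strip h" "h holomorphic_on ostrip" "strip_periodic h"
    "\<And>z. z \<in> strip \<Longrightarrow> Re z \<noteq> \<theta> \<Longrightarrow> h z = (g z - g (of_real \<theta>)) / (exp (z - of_real \<theta>) - 1)"
proof -
  define c where "c = complex_of_real \<theta>"
  have c: "c \<in> strip" using \<theta> by (simp add: c_def strip_def)
  define q where "q z = (g z - g c) / (exp (z - c) - 1)" for z
  \<comment> \<open>At a zero of the denominator the value \<open>deriv g z\<close> is the limit of
    \<open>q\<close>, since the exponential has derivative \<open>1\<close> there.\<close>
  define h where "h z = (if exp (z - c) = 1 then deriv g z else q z)" for z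
  have ne: "exp (z - c) \<noteq> 1" if "Re z \<noteq> \<theta>" for z
    using that by (auto simp: exp_eq_1 c_def)
  have hol_at: "h field_differentiable at z" if z: "z \<in> ostrip" for z
  proof (cases "exp (z - c) = 1")
    case False
    define U where "U = ostrip \<inter> {w. exp (w - c) \<noteq> 1}"
    have "open {w. exp (w - c) \<noteq> 1}" by (intro open_Collect_neq continuous_intros)
    then have U: "open U" unfolding U_def by (intro open_Int open_ostrip)
    have "q holomorphic_on U"
      unfolding q_def by (intro holomorphic_intros holomorphic_on_subset[OF hol]) (auto simp: U_def)
    then have "h holomorphic_on U" by (rule holomorphic_transform) (auto simp: U_def h_def)
    then show ?thesis using U z False by (intro holomorphic_on_imp_differentiable_at[of _ U]) (auto simp: U_def)
  next
    case True
    obtain \<rho> where \<rho>: "\<rho> > 0" "ball z \<rho> \<subseteq> ostrip" using open_ostrip z openE by blast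
    \<comment> \<open>A radius of at most \<open>1\<close> keeps the zeros of
      \<open>exp_quot (w - z)\<close>, which lie at distance \<open>2 * pi\<close> or more from
      \<open>z\<close>, out of \<open>U\<close>.\<close>
    define U where "U = ball z (min \<rho> 1)"
    have U: "open U" "z \<in> U" "U \<subseteq> ostrip" using \<rho> by (auto simp: U_def)
    obtain k :: int where "Re (z - c) = 0" "Im (z - c) = of_int (2 * k) * pi" using True unfolding exp_eq_1 by auto
    then have "z = c + \<i> * of_real (2 * pi * of_int k)" by (simp add: complex_eq_iff algebra_simps)
    then have gz: "g z = g c" using strip_periodic_int[OF per c, of k] by simp
    have enz: "exp_quot (w - z) \<noteq> 0" if w: "w \<in> U" for w
    proof
      assume "exp_quot (w - z) = 0"
      then have *: "w \<noteq> z" "exp (w - z) = 1" by (auto simp: exp_quot_def split: if_splits)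
      then obtain m :: int where m: "Re (w - z) = 0" "Im (w - z) = of_int (2 * m) * pi" unfolding exp_eq_1 by auto
      have "cmod (w - z) < 1" using w by (simp add: U_def dist_norm norm_minus_commute)
      then have "\<bar>Im (w - z)\<bar> < 1" using abs_Im_le_cmod[of "w - z"] by linarith
      then have "\<bar>real_of_int (2 * m)\<bar> * pi < 1"
        unfolding m(2) by (simp only: abs_mult abs_of_pos[OF pi_gt_zero])
      moreover have "m \<noteq> 0" using m * by (auto simp: complex_eq_iff)
      then have "1 * pi \<le> \<bar>real_of_int (2 * m)\<bar> * pi" by (intro mult_right_mono) auto
      ultimately show False using pi_gt3 by linarith
    qed
    have "(\<lambda>w. (if w = z then deriv g z else (g w - g z) / (w - z)) / exp_quot (w - z)) holomorphic_on U"
    proof (intro holomorphic_on_divide)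
      show "(\<lambda>w. if w = z then deriv g z else (g w - g z) / (w - z)) holomorphic_on U"
        by (rule pole_lemma_open[OF holomorphic_on_subset[OF hol U(3)] U(1)])
      have "(exp_quot \<circ> (\<lambda>w. w - z)) holomorphic_on U"
        by (rule holomorphic_on_compose_gen[OF _ exp_quot_holomorphic]) (auto intro!: holomorphic_intros)
      then show "(\<lambda>w. exp_quot (w - z)) holomorphic_on U" by (simp add: o_def)
    qed (rule enz)
    then have "h holomorphic_on U"
    proof (rule holomorphic_transform)
      fix w assume w: "w \<in> U"
      have e: "exp (w - c) = exp (w - z)" using True exp_add[of "w - z" "z - c"] by simp
      show "(if w = z then deriv g z else (g w - g z) / (w - z)) / exp_quot (w - z) = h w"
      proof (cases "w = z")
        case True
        then show ?thesis using \<open>exp (z - c) = 1\<close> by (simp add: h_def exp_quot_zero(1))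
      next
        case False
        then have "exp (w - z) \<noteq> 1" using enz[OF w] by (auto simp: exp_quot_def)
        then show ?thesis using False e by (simp add: h_def q_def exp_quot_def gz)
      qed
    qed
    then show ?thesis using U by (intro holomorphic_on_imp_differentiable_at[of _ U]) auto
  qed
  then have hol_h: "h holomorphic_on ostrip"
    by (auto simp: holomorphic_on_def intro: field_differentiable_at_within)
  moreover have "continuous_on strip h"
    unfolding continuous_on_eq_continuous_within
  proof
    fix z assume z: "z \<in> strip"
    show "continuous (at z within strip) h"
    proof (cases "Re z = \<theta>")
      case True
      then have "z \<in> ostrip" using \<theta> by (simp add: ostrip_def)
      then have "isCont h z" using hol_at field_differentiable_imp_continuous_at by blast
      then show ?thesis by (rule continuous_at_imp_continuous_at_within)
    next
      case False
      define W where "W = strip \<inter> {w. Re w \<noteq> \<theta>}"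
      have "continuous_on W q"
        unfolding q_def using ne by (intro continuous_intros continuous_on_subset[OF cont]) (auto simp: W_def)
      then have "continuous_on W h"
        by (rule continuous_on_eq) (use ne in \<open>auto simp: h_def W_def\<close>)
      then have "continuous (at z within W) h"
        using z False by (auto simp: continuous_on_eq_continuous_within W_def)
      moreover have "at z within W = at z within strip"
      proof (rule at_within_nhd[of _ "{w. Re w \<noteq> \<theta>}"])
        show "open {w. Re w \<noteq> \<theta>}" by (intro open_Collect_neq continuous_intros)
      qed (use False in \<open>auto simp: W_def\<close>)
      ultimately show ?thesis by (simp add: continuous_within)
    qed
  qed
  moreover have "strip_periodic h"
    unfolding strip_periodic_def
  proof
    fix z assume z: "z \<in> strip"
    define p where "p = \<i> * complex_of_real (2 * pi)"
    have ep: "exp (z + p - c) = exp (z - c)"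
      using exp_add[of "z - c" p] by (simp add: p_def algebra_simps)
    have gp: "g (w + p) = g w" if "w \<in> strip" for w using per that by (simp add: strip_periodic_def p_def)
    have "deriv g (z + p) = deriv g z" if "exp (z - c) = 1"
    proof -
      have "Re z = \<theta>" using ne[of z] that by blast
      then have zo: "z \<in> ostrip" using \<theta> by (simp add: ostrip_def)
      from zo have "z + p \<in> ostrip" by (simp add: ostrip_def p_def)
      then have "(g has_field_derivative deriv g (z + p)) (at (z + p))"
        using holomorphic_derivI[OF hol open_ostrip] by blast
      then have "((\<lambda>w. g (w + p)) has_field_derivative deriv g (z + p)) (at z)" by (simp add: DERIV_shift)
      then have "(g has_field_derivative deriv g (z + p)) (at z)"
        by (rule has_field_derivative_transform_within_open[OF _ open_ostrip zo]) (use gp ostrip_subset_strip in auto)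
      then show ?thesis by (simp add: DERIV_imp_deriv)
    qed
    then show "h (z + \<i> * of_real (2 * pi)) = h z"
      using ep gp[OF z] unfolding p_def[symmetric] by (simp add: h_def q_def)
  qed
  moreover have "h z = (g z - g (of_real \<theta>)) / (exp (z - of_real \<theta>) - 1)" if "Re z \<noteq> \<theta>" for z
    using ne[OF that] by (simp add: h_def q_def c_def)
  ultimately show thesis using that by blast
qed

context couple
begin

text \<open>Both parts are averages over vertical lines of the function
  \<open>f z / (exp (z - \<theta>) - 1)\<close>; crossing the pole at \<open>\<theta>\<close> contributes \<open>x\<close>.\<close>

lemma interp_space_decompose:
  assumes x: "x \<in> interp_space A \<theta>" and r: "0 < r" "r < \<theta>" and s: "\<theta> < s" "s < 1"
  obtains p q where "x = p - q" "p \<in> sp A 1" "p \<in> interp_space A s" "q \<in> sp A 0" "q \<in> interp_space A r"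
proof -
  have \<theta>: "0 < \<theta>" "\<theta> < 1" using r s by auto
  obtain f0 where f0: "f0 \<in> calF A" "x = f0 (of_real \<theta>)" using x by (auto simp: interp_space_def)
  obtain f where f: "f \<in> calF A" "strip_periodic f" "f (of_real \<theta>) = x"
    using periodize[OF f0(1) \<theta>] f0(2) by metis
  note fD = locF_props[OF calF_locF[OF f(1)]]
  define K where "K \<sigma> t = 1 / (exp (of_real (\<sigma> - \<theta>) + \<i> * of_real t) - 1)" for \<sigma> t :: real
  define R where "R \<sigma> m = smul A (1 / 2 ^ m) (\<Sum>k<2 ^ m. smul A (K \<sigma> (node m k)) (f (of_real \<sigma> + \<i> * of_real (node m k))))" for \<sigma> m
  have "\<exists>G\<in>calF A. (\<lambda>m. N (R \<sigma> m - G (of_real \<sigma>))) \<longlonglongrightarrow> 0" if \<sigma>: "\<sigma> \<in> {0..1}" "\<sigma> \<noteq> \<theta>" for \<sigma>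
  proof -
    have "continuous_on {0..2*pi} (K \<sigma>)"
      unfolding K_def using \<sigma>(2) by (intro continuous_intros) (auto simp: exp_eq_1)
    then obtain G where G: "G \<in> calF A" "\<And>z. z \<in> strip \<Longrightarrow>
      (\<lambda>m. N (smul A (1 / 2 ^ m) (\<Sum>k<2 ^ m. smul A (K \<sigma> (node m k)) (f (z + \<i> * of_real (node m k)))) - G z)) \<longlonglongrightarrow> 0"
      by (rule riemann_average[OF f(1,2)]) (rule that)
    have "complex_of_real \<sigma> \<in> strip" using \<sigma> by (simp add: strip_def)
    from G(2)[OF this] G(1) show ?thesis by (auto simp: R_def)
  qed
  then obtain G where G: "\<And>\<sigma>. \<sigma> \<in> {0..1} \<Longrightarrow> \<sigma> \<noteq> \<theta> \<Longrightarrow> G \<sigma> \<in> calF A"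
    "\<And>\<sigma>. \<sigma> \<in> {0..1} \<Longrightarrow> \<sigma> \<noteq> \<theta> \<Longrightarrow> (\<lambda>m. N (R \<sigma> m - G \<sigma> (of_real \<sigma>))) \<longlonglongrightarrow> 0"
    by metis
  define P where "P \<sigma> = G \<sigma> (of_real \<sigma>)" for \<sigma>
  have st: "complex_of_real \<sigma> \<in> strip" if "\<sigma> \<in> {0..1}" for \<sigma> using that by (simp add: strip_def)
  have xS: "x \<in> S" using interp_space_sumspace[OF x \<theta>] .
  have PS: "P \<sigma> \<in> S" if "\<sigma> \<in> {0..1}" "\<sigma> \<noteq> \<theta>" for \<sigma>
    using locF_props(1)[OF calF_locF[OF G(1)[OF that]] st[OF that(1)]] by (simp add: P_def)
  have RS: "R \<sigma> m \<in> S" if "\<sigma> \<in> {0..1}" for \<sigma> m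
    unfolding R_def using fD(1)[OF strip_shift[OF st[OF that]]] by auto
  \<comment> \<open>\<open>\<omega> \<sigma>\<close> is the limit of the kernel averages on the line
    \<open>Re z = \<sigma>\<close>. Its jump across \<open>\<theta>\<close> is what produces
    \<open>x\<close> as a difference of two averages.\<close>
  define \<omega> where "\<omega> \<sigma> = (if \<sigma> > \<theta> then 0 else - 1 :: complex)" for \<sigma>
  have key: "P \<sigma> - smul A (\<omega> \<sigma>) x = P \<sigma>' - smul A (\<omega> \<sigma>') x"
    if \<sigma>: "\<sigma> \<in> {0..1}" "\<sigma> \<noteq> \<theta>" and \<sigma>': "\<sigma>' \<in> {0..1}" "\<sigma>' \<noteq> \<theta>" for \<sigma> \<sigma>'
  proof (rule E.eq_dual)
    show "P \<sigma> - smul A (\<omega> \<sigma>) x \<in> S" "P \<sigma>' - smul A (\<omega> \<sigma>') x \<in> S" using PS \<sigma> \<sigma>' xS by auto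
    fix l assume l: "l \<in> E.dual"
    have g: "continuous_on strip (\<lambda>z. l (f z))" "(\<lambda>z. l (f z)) holomorphic_on ostrip" "strip_periodic (\<lambda>z. l (f z))"
      using E.dual_continuous[OF l fD(2,1)] fD(3) l f(2) by (auto simp: E.weak_hol_def strip_periodic_def)
    \<comment> \<open>Subtracting the constant \<open>l x\<close> in the numerator removes the
      poles, so the averages of \<open>h\<close> agree in the limit on all lines. The subtracted
      term is a multiple of the kernel, whose averages have the limit
      \<open>\<omega>\<close>.\<close>
    obtain h where h: "continuous_on strip h" "h holomorphic_on ostrip" "strip_periodic h"
      "\<And>z. z \<in> strip \<Longrightarrow> Re z \<noteq> \<theta> \<Longrightarrow> h z = (l (f z) - l (f (of_real \<theta>))) / (exp (z - of_real \<theta>) - 1)"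
      by (rule periodic_difference_quotient[OF g \<theta>]) (rule that)
    have lim: "(\<lambda>m. (\<Sum>k<2 ^ m. h (of_real \<rho> + \<i> * of_real (node m k))) / 2 ^ m) \<longlonglongrightarrow> l (P \<rho>) - \<omega> \<rho> * l x"
      if \<rho>: "\<rho> \<in> {0..1}" "\<rho> \<noteq> \<theta>" for \<rho>
    proof -
      have hK: "h (of_real \<rho> + \<i> * of_real t) = K \<rho> t * l (f (of_real \<rho> + \<i> * of_real t)) - K \<rho> t * l x" for t
      proof -
        have e: "complex_of_real \<rho> + \<i> * of_real t - of_real \<theta> = of_real (\<rho> - \<theta>) + \<i> * of_real t" by simp
        show ?thesis
          using h(4)[OF strip_shift[OF st[OF \<rho>(1)], of t], unfolded e] \<rho>(2) f(3)
          by (simp add: K_def diff_divide_distrib)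
      qed
      have lR: "l (R \<rho> m) = (\<Sum>k<2 ^ m. K \<rho> (node m k) * l (f (of_real \<rho> + \<i> * of_real (node m k)))) / 2 ^ m" for m
      proof -
        have mem: "f (of_real \<rho> + \<i> * of_real t) \<in> S" for t using fD(1)[OF strip_shift[OF st[OF \<rho>(1)]]] .
        show ?thesis
          unfolding R_def using l mem by (simp add: E.dual_scale E.dual_sum)
      qed
      have eq: "(\<Sum>k<2 ^ m. h (of_real \<rho> + \<i> * of_real (node m k))) / 2 ^ m
          = l (R \<rho> m) - (\<Sum>k<2 ^ m. K \<rho> (node m k)) / 2 ^ m * l x" for m
        unfolding hK lR by (simp add: sum_subtractf diff_divide_distrib sum_distrib_right)
      have "(\<lambda>m. l (R \<rho> m) - l (P \<rho>)) \<longlonglongrightarrow> 0"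
      proof (rule Lim_null_comparison)
        show "(\<lambda>m. N (R \<rho> m - P \<rho>)) \<longlonglongrightarrow> 0" using G(2)[OF \<rho>] by (simp add: P_def)
        have "cmod (l (R \<rho> m) - l (P \<rho>)) \<le> N (R \<rho> m - P \<rho>)" for m
          using E.dual_bound[OF l, of "R \<rho> m - P \<rho>"] E.dual_diff[OF l, of "R \<rho> m" "P \<rho>"] RS[OF \<rho>(1), of m] PS[OF \<rho>] by simp
        then show "\<forall>\<^sub>F m in sequentially. cmod (l (R \<rho> m) - l (P \<rho>)) \<le> N (R \<rho> m - P \<rho>)" by simp
      qed
      then have 1: "(\<lambda>m. l (R \<rho> m)) \<longlonglongrightarrow> l (P \<rho>)" by (rule LIM_zero_cancel)
      have "(\<lambda>m. (\<Sum>k<2 ^ m. K \<rho> (node m k)) / 2 ^ m) \<longlonglongrightarrow> \<omega> \<rho>"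
        using average_kernel_limit[of "\<rho> - \<theta>"] \<rho>(2) by (simp add: K_def \<omega>_def)
      then show ?thesis unfolding eq by (intro tendsto_intros 1)
    qed
    have "(\<lambda>m. (\<Sum>k<2 ^ m. h (of_real \<sigma> + \<i> * of_real (node m k))) / 2 ^ m
            - (\<Sum>k<2 ^ m. h (of_real \<sigma>' + \<i> * of_real (node m k))) / 2 ^ m)
        \<longlonglongrightarrow> (l (P \<sigma>) - \<omega> \<sigma> * l x) - (l (P \<sigma>') - \<omega> \<sigma>' * l x)"
      by (intro tendsto_diff lim \<sigma> \<sigma>')
    from LIMSEQ_unique[OF this average_independent[OF h(1-3) \<sigma>(1) \<sigma>'(1)]]
    show "l (P \<sigma> - smul A (\<omega> \<sigma>) x) = l (P \<sigma>' - smul A (\<omega> \<sigma>') x)"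
      using l PS[OF \<sigma>] PS[OF \<sigma>'] xS by (simp add: E.dual_diff E.dual_scale)
  qed
  have mem: "0 \<in> {0..1::real}" "1 \<in> {0..1::real}" "r \<in> {0..1}" "s \<in> {0..1}" using r s by auto
  \<comment> \<open>Averages on lines on the same side of \<open>\<theta>\<close> coincide. Hence
    one element is at once a value on the edge, in the edge space, and a value at \<open>s\<close>,
    in the interpolation space.\<close>
  have "P 1 = P s" using key[OF mem(2) _ mem(4)] \<theta> s by (simp add: \<omega>_def)
  moreover have "P 0 = P r" using key[OF mem(1) _ mem(3)] \<theta> r by (simp add: \<omega>_def)
  moreover have "x = P 1 - P 0"
    using key[OF mem(1) _ mem(2)] \<theta> by (simp add: \<omega>_def E0.scale_minus_left algebra_simps)
  moreover have "P 1 \<in> sp A 1"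
    using locF_props(4)[OF calF_locF[OF G(1)], of 1 1 0] \<theta> by (simp add: P_def bd_def)
  moreover have "P 0 \<in> sp A 0"
    using locF_props(4)[OF calF_locF[OF G(1)], of 0 0 0] \<theta> by (simp add: P_def bd_def)
  moreover have "P s \<in> interp_space A s" "P r \<in> interp_space A r"
    using G(1) mem r s unfolding P_def interp_space_def by auto
  ultimately show thesis by (intro that[of "P 1" "P 0"]) auto
qed

end

section \<open>Agreement of inverses on an interval of invertibility\<close>

theorem theorem4p10:
  fixes X :: "'a::ab_group_add couple" and Y :: "'b::ab_group_add couple"
    and T :: "'a \<Rightarrow> 'b" and I :: "real set"
  assumes "banach_couple X" and "banach_couple Y"
    and "couple_operator X Y T"
    and "I \<in> components (invertibility_set X Y T)"
  shows "\<forall>\<theta>0\<in>I. \<forall>\<theta>1\<in>I. \<forall>y \<in> interp_space Y \<theta>0 \<inter> interp_space Y \<theta>1.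
           the_inv_into (interp_space X \<theta>0) T y = the_inv_into (interp_space X \<theta>1) T y"
proof (intro ballI)
  interpret couple_map X Y T
    using assms(1-3) by (simp add: couple_map_def couple_def couple_map_axioms_def)
  fix \<theta>0 \<theta>1 y assume \<theta>: "\<theta>0 \<in> I" "\<theta>1 \<in> I" and y: "y \<in> interp_space Y \<theta>0 \<inter> interp_space Y \<theta>1"
  have sub: "I \<subseteq> invertibility_set X Y T" using assms(4) by (rule in_components_subset)
  have "open I" using open_components[OF open_invertibility_set assms(4)] .
  have conn: "connected I" using assms(4) by (rule in_components_connected)
  have inv: "0 < t \<and> t < 1 \<and> (\<exists>K>0. inv_at t K)" if "t \<in> I" for t
    using sub that invertibility_set_iff by blast
  have bij: "bij_betw T (interp_space X t) (interp_space Y t)" if "t \<in> I" for t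
    using sub that by (auto simp: invertibility_set_def interp_invertible_def)
  have inv_into: "the_inv_into (interp_space X t) T y \<in> interp_space X t"
    "T (the_inv_into (interp_space X t) T y) = y" if "t \<in> I" "y \<in> interp_space Y t" for t y
    using bij[OF that(1)] that(2) the_inv_into_into[of T "interp_space X t" y] f_the_inv_into_f[of T "interp_space X t" y]
    by (auto simp: bij_betw_def)
  define x0 where "x0 = the_inv_into (interp_space X \<theta>0) T y"
  define x1 where "x1 = the_inv_into (interp_space X \<theta>1) T y"
  have x0: "x0 \<in> interp_space X \<theta>0" "T x0 = y" and x1: "x1 \<in> interp_space X \<theta>1" "T x1 = y"
    using inv_into \<theta> y by (auto simp: x0_def x1_def)
  have nbhd: "\<exists>r s. r \<in> I \<and> s \<in> I \<and> r < t \<and> t < s" if "t \<in> I" for t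
  proof -
    obtain e where e: "e > 0" "\<And>u. dist u t < e \<Longrightarrow> u \<in> I" using \<open>open I\<close> \<open>t \<in> I\<close> unfolding open_dist by metis
    then have "t - e / 2 \<in> I" "t + e / 2 \<in> I" by (auto simp: dist_real_def)
    then show ?thesis using e(1) by (intro exI[of _ "t - e / 2"] exI[of _ "t + e / 2"]) auto
  qed
  obtain r0 s0 r1 s1 where rs: "r0 \<in> I" "s0 \<in> I" "r0 < \<theta>0" "\<theta>0 < s0" "r1 \<in> I" "s1 \<in> I" "r1 < \<theta>1" "\<theta>1 < s1"
    using nbhd[OF \<theta>(1)] nbhd[OF \<theta>(2)] by blast
  \<comment> \<open>A common pair \<open>r\<close>, \<open>s\<close> for both preimages puts
    \<open>q0 - q1\<close> and \<open>p0 - p1\<close> into one interpolation space each.\<close>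
  define r where "r = min r0 r1"
  define s where "s = max s0 s1"
  have r: "r \<in> I" "r < \<theta>0" "r < \<theta>1" and s: "s \<in> I" "\<theta>0 < s" "\<theta>1 < s"
    using rs by (auto simp: r_def s_def min_def max_def)
  have r0: "0 < r" and s1: "s < 1" using inv r(1) s(1) by auto
  obtain p0 q0 where d0: "x0 = p0 - q0" "p0 \<in> sp X 1" "p0 \<in> interp_space X s" "q0 \<in> sp X 0" "q0 \<in> interp_space X r"
    by (rule X.interp_space_decompose[OF x0(1) r0 r(2) s(2) s1]) (rule that)
  obtain p1 q1 where d1: "x1 = p1 - q1" "p1 \<in> sp X 1" "p1 \<in> interp_space X s" "q1 \<in> sp X 0" "q1 \<in> interp_space X r"
    by (rule X.interp_space_decompose[OF x1(1) r0 r(3) s(3) s1]) (rule that)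
  have S: "p0 \<in> X.S" "p1 \<in> X.S" "q0 \<in> X.S" "q1 \<in> X.S"
    using d0 d1 X.sp_subset_sumspace[of 0] X.sp_subset_sumspace[of 1] by auto
  define w where "w = T (p0 - p1)"
  have "T p0 - T q0 = T p1 - T q1" using x0(2) x1(2) S by (simp add: d0(1) d1(1) T_diff)
  then have w': "w = T (q0 - q1)" using S by (simp add: w_def T_diff algebra_simps)
  have w: "w \<in> sp Y 0" "w \<in> sp Y 1"
    using T_sp[of 0 "q0 - q1"] T_sp[of 1 "p0 - p1"] d0 d1 w' by (auto simp: w_def)
  have Icc: "{r..s} \<subseteq> I" using conn r(1) s(1) by (rule connected_contains_Icc)
  \<comment> \<open>The constant representing function works for every \<open>t\<close>, so
    \<open>w\<close> has a preimage at each parameter of \<open>{r..s}\<close>, not only at the end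
    points.\<close>
  have wY: "w \<in> interp_space Y t" for t using Y.interp_spaceI[OF Y.Fb_const[OF w]] .
  define z where "z t = the_inv_into (interp_space X t) T w" for t
  have z: "z t \<in> interp_space X t" "T (z t) = w" if "t \<in> {r..s}" for t
    using inv_into[OF _ wY] Icc that by (auto simp: z_def)
  have rs_le: "r \<le> s" using r s by simp
  have "z r = z s"
    by (rule solutions_agree[OF rs_le _ w z]) (use Icc sub in auto)
  moreover have "z r = q0 - q1"
  proof -
    obtain K where "inv_at r K" using inv[OF r(1)] by blast
    then show ?thesis
      using inv_at_inj[of r K "z r" "q0 - q1"] inv[OF r(1)] z[of r] rs_le X.interp_space_diff[OF d0(5) d1(5)] w' by auto
  qed
  moreover have "z s = p0 - p1"
  proof -
    obtain K where "inv_at s K" using inv[OF s(1)] by blast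
    then show ?thesis
      using inv_at_inj[of s K "z s" "p0 - p1"] inv[OF s(1)] z[of s] rs_le X.interp_space_diff[OF d0(3) d1(3)] by (auto simp: w_def)
  qed
  ultimately have "p0 - q0 = p1 - q1" by (simp add: algebra_simps)
  then show "the_inv_into (interp_space X \<theta>0) T y = the_inv_into (interp_space X \<theta>1) T y"
    using d0(1) d1(1) by (simp add: x0_def x1_def)
qed

end
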